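(* Let $0\le i<j\le n$ and $x\in[x_0,x_n]$. If $x_j<x$, then each of $G_j(x)$, $G_{i,j}(x)$ and $\bar G_{i,j}(x)$ can be evaluated in $O(n^2)$ time; if $x<x_i$, then each of $H_i(x)$, $H_{i,j}(x)$ and $\bar H_{i,j}(x)$ can be evaluated in $O(n^2)$ time.
   Context: A path $P$ has vertices at positions $0=x_0<x_1<\dots<x_n$; edge $(v_i,v_{i+1})$ has capacity $c_i>0$; the input is these data together with weight intervals $[w_i^-,w_i^+]$, $0\le w_i^-\le w_i^+$. A scenario $s$ gives nonnegative weights $w_t(s)$; $W_{i,j}(s)=\sum_{t=i}^jw_t(s)$. For $x\le x'$: $d(x,x')=x'-x$, $c(x,x')=\min\{c_t:i\le t<j\}$ with $i=\max\{i':x_{i'}\le x\}$, $j=\min\{j':x_{j'}\ge x'\}$. For $x_i<x$: $g_i(x:s)=d(x_i,x)+W_{0,i}(s)/c(x_i,x)$ if $W_{0,i}(s)>0$, else $0$; for $x_i>x$: $h_i(x:s)=d(x,x_i)+W_{i,n}(s)/c(x,x_i)$ if $W_{i,n}(s)>0$, else $0$. $\Theta_L(P,x:s)=\max_{i:x_i<x}g_i(x:s)$, $\Theta_R(P,x:s)=\max_{i:x_i>x}h_i(x:s)$ (empty maximum $=0$), $\Theta(P,x:s)=\max\{\Theta_L,\Theta_R\}$. For $i\le j$, $s_{i,j}(\alpha,\beta)$ has $w_t=w_t^-$ for $t<i$ or $t>j$, $w_t^+$ for $i<t<j$, $w_i=\alpha$, $w_j=\beta$ ($\alpha=\beta$ if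 $i=j$); $S_{i,j}=\{s_{i,j}(\alpha,\beta):\alpha\in[w_i^-,w_i^+],\beta\in[w_j^-,w_j^+]\}$. For $i<j$: $G_j(x)=\max_{s\in S_{j,j}}\{g_j(x:s)-\min_{y\in[x_j,x_n]}\Theta(P,y:s)\}$, $H_i(x)=\max_{s\in S_{i,i}}\{h_i(x:s)-\min_{y\in[x_0,x_i]}\Theta(P,y:s)\}$, $G_{i,j}(x)=\max_{s\in S_{i,j},w_j(s)=w_j^+}\{g_j(x:s)-\min_{y\in[x_j,x_n]}\Theta(P,y:s)\}$, $\bar G_{i,j}(x)=\max_{s\in S_{i,j}}\{\max_{t:x_j\le x_t<x}g_t(x:s)-\min_{y\in[x_i,x_j]}\Theta(P,y:s)\}$, $H_{i,j}(x)=\max_{s\in S_{i,j},w_i(s)=w_i^+}\{h_i(x:s)-\min_{y\in[x_0,x_i]}\Theta(P,y:s)\}$, $\bar H_{i,j}(x)=\max_{s\in S_{i,j}}\{\max_{t:x<x_t\le x_i}h_t(x:s)-\min_{y\in[x_i,x_j]}\Theta(P,y:s)\}$.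
   Formalization: The maxima over scenarios defining the six functions are read as suprema, since the jump of g and h at total weight 0 can leave a maximum unattained; where the maximum exists the two values agree. *)

theory Defs
  imports Complex_Main "HOL-Library.Landau_Symbols"
begin

section \<open>Path networks and evacuation times\<close>

record path_network =
  len  :: nat
  pos  :: "nat \<Rightarrow> real"
  cap  :: "nat \<Rightarrow> real"
  wmin :: "nat \<Rightarrow> real"
  wmax :: "nat \<Rightarrow> real"

text \<open>Vertices are \<open>0, \<dots>, len P\<close>; edge \<open>i < len P\<close> joins \<open>i\<close> and \<open>Suc i\<close>.
  Values of the four functions outside these ranges are irrelevant.\<close>

definition valid_network :: "path_network \<Rightarrow> bool" where
  "valid_network P \<longleftrightarrow>
     pos P 0 = 0 \<and>
     (\<forall>i<len P. pos P i < pos P (Suc i)) \<and>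
     (\<forall>i<len P. 0 < cap P i) \<and>
     (\<forall>i\<le>len P. 0 \<le> wmin P i \<and> wmin P i \<le> wmax P i)"

type_synonym scenario = "nat \<Rightarrow> real"

definition wsum :: "scenario \<Rightarrow> nat \<Rightarrow> nat \<Rightarrow> real" where
  "wsum s i j = (\<Sum>t=i..j. s t)"

definition path_dist :: "real \<Rightarrow> real \<Rightarrow> real" where
  "path_dist x x' = x' - x"

definition path_cap :: "path_network \<Rightarrow> real \<Rightarrow> real \<Rightarrow> real" where
  "path_cap P x x' =
     (let i = Max {i'. i' \<le> len P \<and> pos P i' \<le> x};
          j = Min {j'. j' \<le> len P \<and> x' \<le> pos P j'}
      in Min (cap P ` {i..<j}))"

definition g_time :: "path_network \<Rightarrow> nat \<Rightarrow> real \<Rightarrow> scenario \<Rightarrow> real" where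
  "g_time P i x s =
     (if 0 < wsum s 0 i
      then path_dist (pos P i) x + wsum s 0 i / path_cap P (pos P i) x else 0)"

definition h_time :: "path_network \<Rightarrow> nat \<Rightarrow> real \<Rightarrow> scenario \<Rightarrow> real" where
  "h_time P i x s =
     (if 0 < wsum s i (len P)
      then path_dist x (pos P i) + wsum s i (len P) / path_cap P x (pos P i) else 0)"

definition Max0 :: "real set \<Rightarrow> real" where
  "Max0 A = (if A = {} then 0 else Max A)"

definition Theta_L :: "path_network \<Rightarrow> real \<Rightarrow> scenario \<Rightarrow> real" where
  "Theta_L P x s = Max0 ((\<lambda>i. g_time P i x s) ` {i. i \<le> len P \<and> pos P i < x})"

definition Theta_R :: "path_network \<Rightarrow> real \<Rightarrow> scenario \<Rightarrow> real" where
  "Theta_R P x s = Max0 ((\<lambda>i. h_time P i x s) ` {i. i \<le> len P \<and> x < pos P i})"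

definition Theta :: "path_network \<Rightarrow> real \<Rightarrow> scenario \<Rightarrow> real" where
  "Theta P x s = max (Theta_L P x s) (Theta_R P x s)"

definition scen :: "path_network \<Rightarrow> nat \<Rightarrow> nat \<Rightarrow> real \<Rightarrow> real \<Rightarrow> scenario" where
  "scen P i j \<alpha> \<beta> = (\<lambda>t.
     if t < i \<or> j < t then wmin P t
     else if i < t \<and> t < j then wmax P t
     else if t = i then \<alpha> else \<beta>)"

definition scens :: "path_network \<Rightarrow> nat \<Rightarrow> nat \<Rightarrow> scenario set" where
  "scens P i j =
     {scen P i j \<alpha> \<beta> | \<alpha> \<beta>.
        \<alpha> \<in> {wmin P i..wmax P i} \<and> \<beta> \<in> {wmin P j..wmax P j} \<and> (i = j \<longrightarrow> \<alpha> = \<beta>)}"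

section \<open>The functions to be evaluated\<close>

text \<open>Maxima over scenario sets are written as suprema: they are attained in general, except
  that the jump of \<^const>\<open>g_time\<close> and \<^const>\<open>h_time\<close> where a weight sum becomes \<open>0\<close> can leave
  the supremum (always finite) unattained.\<close>

definition G_single :: "path_network \<Rightarrow> nat \<Rightarrow> real \<Rightarrow> real" where
  "G_single P j x =
     (SUP s\<in>scens P j j. g_time P j x s - (INF y\<in>{pos P j..pos P (len P)}. Theta P y s))"

definition H_single :: "path_network \<Rightarrow> nat \<Rightarrow> real \<Rightarrow> real" where
  "H_single P i x =
     (SUP s\<in>scens P i i. h_time P i x s - (INF y\<in>{pos P 0..pos P i}. Theta P y s))"

definition G_pair :: "path_network \<Rightarrow> nat \<Rightarrow> nat \<Rightarrow> real \<Rightarrow> real" where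
  "G_pair P i j x =
     (SUP s\<in>{s \<in> scens P i j. s j = wmax P j}.
        g_time P j x s - (INF y\<in>{pos P j..pos P (len P)}. Theta P y s))"

definition H_pair :: "path_network \<Rightarrow> nat \<Rightarrow> nat \<Rightarrow> real \<Rightarrow> real" where
  "H_pair P i j x =
     (SUP s\<in>{s \<in> scens P i j. s i = wmax P i}.
        h_time P i x s - (INF y\<in>{pos P 0..pos P i}. Theta P y s))"

definition G_bar :: "path_network \<Rightarrow> nat \<Rightarrow> nat \<Rightarrow> real \<Rightarrow> real" where
  "G_bar P i j x =
     (SUP s\<in>scens P i j.
        Max ((\<lambda>t. g_time P t x s) ` {t. t \<le> len P \<and> pos P j \<le> pos P t \<and> pos P t < x})
        - (INF y\<in>{pos P i..pos P j}. Theta P y s))"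

definition H_bar :: "path_network \<Rightarrow> nat \<Rightarrow> nat \<Rightarrow> real \<Rightarrow> real" where
  "H_bar P i j x =
     (SUP s\<in>scens P i j.
        Max ((\<lambda>t. h_time P t x s) ` {t. t \<le> len P \<and> x < pos P t \<and> pos P t \<le> pos P i})
        - (INF y\<in>{pos P i..pos P j}. Theta P y s))"

section \<open>Real RAM programs\<close>

text \<open>A structured real RAM.  Memory consists of named arrays of natural numbers, used for
  indexing and control, and named arrays of reals; a scalar variable is cell 0 of an array.
  Every arithmetic operation, comparison, constant and memory access has unit cost.  To exclude the
  known ways of cheating with unit cost, reals cannot be converted to naturals (no rounding), real
  constants are integer literals, and naturals are not multiplied.\<close>

type_synonym store = "(string \<Rightarrow> nat \<Rightarrow> nat) \<times> (string \<Rightarrow> nat \<Rightarrow> real)"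

datatype nexp = NConst nat | NRead string nexp | NPlus nexp nexp | NMinus nexp nexp

datatype rexp = RConst int | RRead string nexp
  | RPlus rexp rexp | RMinus rexp rexp | RTimes rexp rexp | RDivide rexp rexp

datatype bexp = NLess nexp nexp | RLess rexp rexp | BNot bexp | BAnd bexp bexp

datatype com = Skip
  | NWrite string nexp nexp
  | RWrite string nexp rexp
  | Seq com com
  | IfElse bexp com com
  | While bexp com

primrec nval :: "nexp \<Rightarrow> store \<Rightarrow> nat" where
  "nval (NConst k) m = k"
| "nval (NRead a e) m = fst m a (nval e m)"
| "nval (NPlus e f) m = nval e m + nval f m"
| "nval (NMinus e f) m = nval e m - nval f m"

primrec rval :: "rexp \<Rightarrow> store \<Rightarrow> real" where
  "rval (RConst k) m = of_int k"
| "rval (RRead a e) m = snd m a (nval e m)"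
| "rval (RPlus e f) m = rval e m + rval f m"
| "rval (RMinus e f) m = rval e m - rval f m"
| "rval (RTimes e f) m = rval e m * rval f m"
| "rval (RDivide e f) m = rval e m / rval f m"

primrec bval :: "bexp \<Rightarrow> store \<Rightarrow> bool" where
  "bval (NLess e f) m = (nval e m < nval f m)"
| "bval (RLess e f) m = (rval e m < rval f m)"
| "bval (BNot b) m = (\<not> bval b m)"
| "bval (BAnd b c) m = (bval b m \<and> bval c m)"

primrec ncost :: "nexp \<Rightarrow> nat" where
  "ncost (NConst k) = 1"
| "ncost (NRead a e) = 1 + ncost e"
| "ncost (NPlus e f) = 1 + ncost e + ncost f"
| "ncost (NMinus e f) = 1 + ncost e + ncost f"

primrec rcost :: "rexp \<Rightarrow> nat" where
  "rcost (RConst k) = 1"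
| "rcost (RRead a e) = 1 + ncost e"
| "rcost (RPlus e f) = 1 + rcost e + rcost f"
| "rcost (RMinus e f) = 1 + rcost e + rcost f"
| "rcost (RTimes e f) = 1 + rcost e + rcost f"
| "rcost (RDivide e f) = 1 + rcost e + rcost f"

primrec bcost :: "bexp \<Rightarrow> nat" where
  "bcost (NLess e f) = 1 + ncost e + ncost f"
| "bcost (RLess e f) = 1 + rcost e + rcost f"
| "bcost (BNot b) = 1 + bcost b"
| "bcost (BAnd b c) = 1 + bcost b + bcost c"

definition nupd :: "store \<Rightarrow> string \<Rightarrow> nat \<Rightarrow> nat \<Rightarrow> store" where
  "nupd m a k v = ((fst m)(a := (fst m a)(k := v)), snd m)"

definition rupd :: "store \<Rightarrow> string \<Rightarrow> nat \<Rightarrow> real \<Rightarrow> store" where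
  "rupd m a k v = (fst m, (snd m)(a := (snd m a)(k := v)))"

text \<open>\<open>exec p m t m'\<close>: started in store \<open>m\<close>, program \<open>p\<close> halts in store \<open>m'\<close> after time \<open>t\<close>.\<close>

inductive exec :: "com \<Rightarrow> store \<Rightarrow> nat \<Rightarrow> store \<Rightarrow> bool" where
  Skip: "exec Skip m 1 m"
| NWrite: "exec (NWrite a e f) m (1 + ncost e + ncost f) (nupd m a (nval e m) (nval f m))"
| RWrite: "exec (RWrite a e f) m (1 + ncost e + rcost f) (rupd m a (nval e m) (rval f m))"
| Seq: "exec p m t m' \<Longrightarrow> exec q m' u m'' \<Longrightarrow> exec (Seq p q) m (t + u) m''"
| IfTrue: "bval b m \<Longrightarrow> exec p m t m' \<Longrightarrow> exec (IfElse b p q) m (1 + bcost b + t) m'"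
| IfFalse: "\<not> bval b m \<Longrightarrow> exec q m t m' \<Longrightarrow> exec (IfElse b p q) m (1 + bcost b + t) m'"
| WhileFalse: "\<not> bval b m \<Longrightarrow> exec (While b p) m (1 + bcost b) m"
| WhileTrue: "bval b m \<Longrightarrow> exec p m t m' \<Longrightarrow> exec (While b p) m' u m'' \<Longrightarrow>
    exec (While b p) m (1 + bcost b + t + u) m''"

inductive_cases exec_elims:
  "exec Skip m t m'"
  "exec (NWrite a e f) m t m'"
  "exec (RWrite a e f) m t m'"
  "exec (Seq p q) m t m'"
  "exec (IfElse b p q) m t m'"

inductive_cases exec_While_elim: "exec (While b p) m t m'"

lemma exec_deterministic:
  "exec p m t m' \<Longrightarrow> exec p m u m'' \<Longrightarrow> u = t \<and> m'' = m'"
proof (induction arbitrary: u m'' rule: exec.induct)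
  case (Skip m)
  then show ?case by (rule exec_elims(1)) simp
next
  case (NWrite a e f m)
  then show ?case by (rule exec_elims(2)) simp
next
  case (RWrite a e f m)
  then show ?case by (rule exec_elims(3)) simp
next
  case (Seq p m t m1 q v m2)
  from Seq.prems obtain t' m1' v' where
    "exec p m t' m1'" "exec q m1' v' m''" "u = t' + v'"
    by (rule exec_elims(4))
  with Seq.IH(1)[of t' m1'] Seq.IH(2)[of v' m''] show ?case by simp
next
  case (IfTrue b m p t m1 q)
  from IfTrue.prems show ?case
    by (rule exec_elims(5)) (use IfTrue.hyps(1) IfTrue.IH in auto)
next
  case (IfFalse b m q t m1 p)
  from IfFalse.prems show ?case
    by (rule exec_elims(5)) (use IfFalse.hyps(1) IfFalse.IH in auto)
next
  case (WhileFalse b m p)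
  from WhileFalse.prems show ?case
    by (rule exec_While_elim) (use WhileFalse.hyps in auto)
next
  case (WhileTrue b m p t m1 v m2)
  from WhileTrue.prems show ?case
  proof (rule exec_While_elim)
    fix t' m1' v'
    assume "u = Suc (bcost b + t' + v')" "exec p m t' m1'" "exec (While b p) m1' v' m''"
    with WhileTrue.IH(1)[of t' m1'] WhileTrue.IH(2)[of v' m''] show ?thesis by simp
  qed (use WhileTrue.hyps(1) in simp)
qed

section \<open>Evaluation within a time bound\<close>

text \<open>Cells that do not carry input are \<open>0\<close>; in particular the irrelevant values of the network
  functions are not passed to the program.\<close>

definition input :: "path_network \<Rightarrow> nat \<Rightarrow> nat \<Rightarrow> real \<Rightarrow> store" where
  "input P i j x =
     ((\<lambda>a k. if a = ''n'' \<and> k = 0 then len P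
             else if a = ''i'' \<and> k = 0 then i
             else if a = ''j'' \<and> k = 0 then j
             else 0),
      (\<lambda>a k. if a = ''pos'' \<and> k \<le> len P then pos P k
             else if a = ''cap'' \<and> k < len P then cap P k
             else if a = ''wmin'' \<and> k \<le> len P then wmin P k
             else if a = ''wmax'' \<and> k \<le> len P then wmax P k
             else if a = ''x'' \<and> k = 0 then x
             else 0))"

text \<open>One program has to work for all path networks of all lengths, and the time bound depends on
  the length only.\<close>

definition evaluable_in ::
    "(nat \<Rightarrow> real) \<Rightarrow> (path_network \<Rightarrow> nat \<Rightarrow> nat \<Rightarrow> real \<Rightarrow> bool) \<Rightarrow>
     (path_network \<Rightarrow> nat \<Rightarrow> nat \<Rightarrow> real \<Rightarrow> real) \<Rightarrow> bool" where
  "evaluable_in B D F \<longleftrightarrow>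
     (\<exists>p. \<exists>T\<in>O(B). \<forall>P i j x.
        valid_network P \<and> i < j \<and> j \<le> len P \<and> x \<in> {pos P 0..pos P (len P)} \<and> D P i j x \<longrightarrow>
        (\<exists>t m. exec p (input P i j x) t m \<and> snd m ''out'' 0 = F P i j x \<and> real t \<le> T (len P)))"

end

(* The value of each function is the supremum of g_t(x:s) - z over scenarios s, sinks y and bounds
   z >= Theta(y:s).  Since W / min c = max W / c, the condition Theta_L(y:s) <= z with k vertices to
   the left of y reads rho_k <= r and alpha <= A_k(r), where r = z - y, alpha is the variable weight
   on the left and A_k is a minimum of k + 1 lines; the right side is the reflection, with the
   coordinate r' = z + y - x_n.  Adding the lines one at a time, each new line is minimal on an
   interval, so all A_k together have only O(n) breakpoints, and the minimal line between any two
   consecutive breakpoints is tabulated for all k in O(n^2) time.  The objective is a maximum of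
   O(n) linear functions of the total weight alpha + beta with ordered slopes.  For a sink inside an
   edge it separates into a function of r and one of r'; for a sink at a vertex it is a concave
   function of z.  In both cases the optimum is at a breakpoint, and because the optimum moves
   monotonically with the slope, one scan over the breakpoints serves all slopes: O(n) time per
   vertex or edge. *)

theory Submission
  imports Defs
begin

section \<open>Counted loops over the real RAM, with running time read off the nesting depth\<close>

section \<open>For programs\<close>

text \<open>Three obstacles shape the proof. A vertex counts only if some weight lies behind it, so
  evacuation times jump where a weight sum becomes 0 and the supremum need not be attained. Each
  variable weight is therefore treated separately at 0 and on the half-open rest of its range; in
  each of the four resulting regimes the set of counting vertices is fixed and the conditions are
  linear, and limits of admissible weights are recovered by concavity. The separate optima in r and
  r' may describe a point y outside the edge. Moving from any admissible pair towards the optimal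
  pair never lowers the value, and the motion leaves the edge through one of its ends, so the two
  vertex computations already cover this case. The time bound concerns an unstructured cost.
  Programs are therefore written with counted loops whose bounds are never overwritten; nesting
  depth 2 then gives the exponent 2. Pointer walks become loops with a fixed number of rounds that
  idle once the walk is over, and triangular loops become square loops with a guard.\<close>

datatype prog = PSkip | PN string nexp nexp | PR string nexp rexp
  | PSeq prog prog (infixr ";;" 60) | PIf bexp prog prog | PFor string string prog

text \<open>\<open>PFor v b p\<close> runs \<open>p\<close> with the loop counter \<open>v\<close> ranging below the value of \<open>b\<close>; the body
  must change neither of them.\<close>

primrec compile :: "prog \<Rightarrow> com" where
  "compile PSkip = Skip"
| "compile (PN a e f) = NWrite a e f"
| "compile (PR a e f) = RWrite a e f"
| "compile (PSeq p q) = Seq (compile p) (compile q)"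
| "compile (PIf b p q) = IfElse b (compile p) (compile q)"
| "compile (PFor v b p) = Seq (NWrite v (NConst 0) (NConst 0))
     (While (NLess (NRead v (NConst 0)) (NRead b (NConst 0)))
       (Seq (compile p) (NWrite v (NConst 0) (NPlus (NRead v (NConst 0)) (NConst 1)))))"

text \<open>The number of rounds is read once, on entry, and the counter is advanced from its value
  before the body. Both agree with the compiled while loop only because a well-formed body writes
  neither the counter nor the bound.\<close>

primrec sem :: "prog \<Rightarrow> store \<Rightarrow> store" where
  "sem PSkip m = m"
| "sem (PN a e f) m = nupd m a (nval e m) (nval f m)"
| "sem (PR a e f) m = rupd m a (nval e m) (rval f m)"
| "sem (PSeq p q) m = sem q (sem p m)"
| "sem (PIf b p q) m = (if bval b m then sem p m else sem q m)"
| "sem (PFor v b p) m =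
     ((\<lambda>m'. nupd (sem p m') v 0 (Suc (fst m' v 0))) ^^ fst m b 0) (nupd m v 0 0)"

primrec wrN :: "prog \<Rightarrow> string set" where
  "wrN PSkip = {}"
| "wrN (PN a e f) = {a}"
| "wrN (PR a e f) = {}"
| "wrN (PSeq p q) = wrN p \<union> wrN q"
| "wrN (PIf b p q) = wrN p \<union> wrN q"
| "wrN (PFor v b p) = insert v (wrN p)"

primrec wrR :: "prog \<Rightarrow> string set" where
  "wrR PSkip = {}"
| "wrR (PN a e f) = {}"
| "wrR (PR a e f) = {a}"
| "wrR (PSeq p q) = wrR p \<union> wrR q"
| "wrR (PIf b p q) = wrR p \<union> wrR q"
| "wrR (PFor v b p) = wrR p"

primrec bounds :: "prog \<Rightarrow> string set" where
  "bounds PSkip = {}"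
| "bounds (PN a e f) = {}"
| "bounds (PR a e f) = {}"
| "bounds (PSeq p q) = bounds p \<union> bounds q"
| "bounds (PIf b p q) = bounds p \<union> bounds q"
| "bounds (PFor v b p) = insert b (bounds p)"

primrec wf_prog :: "prog \<Rightarrow> bool" where
  "wf_prog PSkip = True"
| "wf_prog (PN a e f) = True"
| "wf_prog (PR a e f) = True"
| "wf_prog (PSeq p q) = (wf_prog p \<and> wf_prog q)"
| "wf_prog (PIf b p q) = (wf_prog p \<and> wf_prog q)"
| "wf_prog (PFor v b p) = (wf_prog p \<and> v \<noteq> b \<and> v \<notin> wrN p \<and> b \<notin> wrN p)"

primrec depth :: "prog \<Rightarrow> nat" where
  "depth PSkip = 0"
| "depth (PN a e f) = 0"
| "depth (PR a e f) = 0"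
| "depth (PSeq p q) = max (depth p) (depth q)"
| "depth (PIf b p q) = max (depth p) (depth q)"
| "depth (PFor v b p) = Suc (depth p)"

text \<open>A coefficient rather than a running time: the rounds of a loop are accounted for by one
  factor per nesting level in \<open>exec_compile\<close>. The constant 20 absorbs 3 units for
  initialising the counter, 6 for each test and 6 for each increment. Both branches of a conditional
  are added, which bounds their maximum.\<close>

primrec cost :: "prog \<Rightarrow> nat" where
  "cost PSkip = 1"
| "cost (PN a e f) = 1 + ncost e + ncost f"
| "cost (PR a e f) = 1 + ncost e + rcost f"
| "cost (PSeq p q) = cost p + cost q"
| "cost (PIf b p q) = 1 + bcost b + cost p + cost q"
| "cost (PFor v b p) = cost p + 20"

lemma fst_nupd [simp]: "fst (nupd m a k v) = (fst m)(a := (fst m a)(k := v))"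
  and snd_nupd [simp]: "snd (nupd m a k v) = snd m"
  and fst_rupd [simp]: "fst (rupd m a k r) = fst m"
  and snd_rupd [simp]: "snd (rupd m a k r) = (snd m)(a := (snd m a)(k := r))"
  by (simp_all add: nupd_def rupd_def)

lemma sem_frame:
  "a \<notin> wrN p \<Longrightarrow> fst (sem p m) a = fst m a"
  "a \<notin> wrR p \<Longrightarrow> snd (sem p m) a = snd m a"
proof (induction p arbitrary: m)
  case (PFor v b p)
  let ?f = "\<lambda>m'. nupd (sem p m') v 0 (Suc (fst m' v 0))"
  { case 1
    have "fst ((?f ^^ k) m') a = fst m' a" for k m'
      by (induction k) (use 1 PFor.IH(1) in auto)
    with 1 show ?case by simp
  next
    case 2
    have "snd ((?f ^^ k) m') a = snd m' a" for k m'
      by (induction k) (use 2 PFor.IH(2) in auto)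
    with 2 show ?case by simp
  }
qed auto

text \<open>The frame facts are handed to the induction step for free, so an invariant has to
  mention only what the body writes.\<close>

lemma For_rule:
  assumes v: "v \<notin> wrN p" "v \<noteq> b"
  assumes init: "I 0 (nupd m v 0 0)"
  assumes step: "\<And>k m'. k < fst m b 0 \<Longrightarrow> fst m' v 0 = k \<Longrightarrow>
      (\<And>a. a \<notin> insert v (wrN p) \<Longrightarrow> fst m' a = fst m a) \<Longrightarrow>
      (\<And>a. a \<notin> wrR p \<Longrightarrow> snd m' a = snd m a) \<Longrightarrow>
      I k m' \<Longrightarrow> I (Suc k) (nupd (sem p m') v 0 (Suc k))"
  shows "I (fst m b 0) (sem (PFor v b p) m)"
proof -
  let ?f = "\<lambda>m'. nupd (sem p m') v 0 (Suc (fst m' v 0))"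
  have "k \<le> fst m b 0 \<Longrightarrow> I k ((?f ^^ k) (nupd m v 0 0)) \<and> fst ((?f ^^ k) (nupd m v 0 0)) v 0 = k \<and>
      (\<forall>a. a \<notin> insert v (wrN p) \<longrightarrow> fst ((?f ^^ k) (nupd m v 0 0)) a = fst m a) \<and>
      (\<forall>a. a \<notin> wrR p \<longrightarrow> snd ((?f ^^ k) (nupd m v 0 0)) a = snd m a)" for k
  proof (induction k)
    case 0
    then show ?case using init by simp
  next
    case (Suc k)
    then have h: "k < fst m b 0" by simp
    let ?m = "(?f ^^ k) (nupd m v 0 0)"
    have IH: "I k ?m" "fst ?m v 0 = k" "\<And>a. a \<notin> insert v (wrN p) \<Longrightarrow> fst ?m a = fst m a"
      "\<And>a. a \<notin> wrR p \<Longrightarrow> snd ?m a = snd m a" using Suc.IH h by auto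
    have "I (Suc k) (nupd (sem p ?m) v 0 (Suc k))"
      by (rule step) (use IH h in auto)
    then show ?case using IH by (auto simp: sem_frame)
  qed
  then show ?thesis by simp
qed

text \<open>Since no loop bound is ever written, the estimate \<open>K\<close> made in the initial
  store stays valid during the whole run, and each nesting level costs at most a factor
  \<open>Suc K\<close>.\<close>

lemma exec_compile:
  assumes "wf_prog p" "bounds p \<inter> wrN p = {}" "\<forall>b\<in>bounds p. fst m b 0 \<le> K"
  shows "\<exists>t \<le> cost p * Suc K ^ depth p. exec (compile p) m t (sem p m)"
  using assms
proof (induction p arbitrary: m)
  case PSkip
  show ?case using exec.Skip[of m] by (intro exI[of _ 1]) simp
next
  case (PN a e f)
  show ?case using exec.NWrite[of a e f m] by (intro exI conjI) (simp_all del: fst_nupd)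
next
  case (PR a e f)
  show ?case using exec.RWrite[of a e f m] by (intro exI conjI) (simp_all del: fst_nupd)
next
  case (PSeq p q)
  obtain t where t: "t \<le> cost p * Suc K ^ depth p" "exec (compile p) m t (sem p m)"
    using PSeq.IH(1)[of m] PSeq.prems by auto
  have fr: "fst (sem p m) b = fst m b" if "b \<in> bounds q" for b
    using PSeq.prems that by (intro sem_frame(1)) auto
  obtain u where u: "u \<le> cost q * Suc K ^ depth q" "exec (compile q) (sem p m) u (sem q (sem p m))"
    using PSeq.IH(2)[of "sem p m"] PSeq.prems fr by auto
  have "cost p * Suc K ^ depth p \<le> cost p * Suc K ^ max (depth p) (depth q)"
    "cost q * Suc K ^ depth q \<le> cost q * Suc K ^ max (depth p) (depth q)"
    by (intro mult_le_mono2 power_increasing; simp)+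
  with t u have "t + u \<le> (cost p + cost q) * Suc K ^ max (depth p) (depth q)"
    unfolding add_mult_distrib by linarith
  then show ?case using exec.Seq[OF t(2) u(2)] by auto
next
  case (PIf b p q)
  have *: "cost p * Suc K ^ depth p \<le> cost p * Suc K ^ max (depth p) (depth q)"
    "cost q * Suc K ^ depth q \<le> cost q * Suc K ^ max (depth p) (depth q)"
    by (intro mult_le_mono2 power_increasing; simp)+
  have "1 \<le> Suc K ^ max (depth p) (depth q)" by simp
  then have **: "1 + bcost b \<le> (1 + bcost b) * Suc K ^ max (depth p) (depth q)"
    by (metis mult.right_neutral mult_le_mono2)
  show ?case
  proof (cases "bval b m")
    case True
    obtain t where t: "t \<le> cost p * Suc K ^ depth p" "exec (compile p) m t (sem p m)"
      using PIf.IH(1)[of m] PIf.prems by auto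
    have "1 + bcost b + t \<le> (1 + bcost b + cost p + cost q) * Suc K ^ max (depth p) (depth q)"
      using t * ** unfolding add_mult_distrib by linarith
    then show ?thesis using exec.IfTrue[OF True t(2), of "compile q"] True by auto
  next
    case False
    obtain t where t: "t \<le> cost q * Suc K ^ depth q" "exec (compile q) m t (sem q m)"
      using PIf.IH(2)[of m] PIf.prems by auto
    have "1 + bcost b + t \<le> (1 + bcost b + cost p + cost q) * Suc K ^ max (depth p) (depth q)"
      using t * ** unfolding add_mult_distrib by linarith
    then show ?thesis using exec.IfFalse[OF False t(2), of "compile p"] False by auto
  qed
next
  case (PFor v b p)
  let ?f = "\<lambda>m'. nupd (sem p m') v 0 (Suc (fst m' v 0))"
  let ?T = "cost p * Suc K ^ depth p"
  let ?W = "While (NLess (NRead v (NConst 0)) (NRead b (NConst 0)))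
       (Seq (compile p) (NWrite v (NConst 0) (NPlus (NRead v (NConst 0)) (NConst 1))))"
  \<comment> \<open>Induction on the number \<open>d\<close> of rounds still to run, with the
    counter at its bound minus \<open>d\<close>; a round costs the body plus 12, the failing test
    6.\<close>
  have loop: "\<exists>t \<le> d * (?T + 12) + 6. exec ?W m' t ((?f ^^ d) m')"
    if "fst m' b 0 = fst m' v 0 + d" "\<forall>b\<in>bounds (PFor v b p). fst m' b 0 \<le> K" for d m'
    using that
  proof (induction d arbitrary: m')
    case 0
    then show ?case
      using exec.WhileFalse[of "NLess (NRead v (NConst 0)) (NRead b (NConst 0))" m'
          "Seq (compile p) (NWrite v (NConst 0) (NPlus (NRead v (NConst 0)) (NConst 1)))"]
      by (intro exI[of _ 6]) (simp add: numeral_eq_Suc)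
  next
    case (Suc d)
    obtain t where t: "t \<le> ?T" "exec (compile p) m' t (sem p m')"
      using PFor.IH[of m'] PFor.prems Suc.prems by auto
    have fb: "fst (sem p m') b' = fst m' b'" if "b' \<in> bounds (PFor v b p) \<or> b' = v" for b'
      using PFor.prems that by (intro sem_frame(1)) auto
    have 1: "exec (Seq (compile p) (NWrite v (NConst 0) (NPlus (NRead v (NConst 0)) (NConst 1))))
        m' (t + 6) (?f m')"
      using exec.Seq[OF t(2) exec.NWrite[of v "NConst 0" "NPlus (NRead v (NConst 0)) (NConst 1)"]]
      by (simp add: fb numeral_eq_Suc)
    have vb: "v \<notin> bounds (PFor v b p)" using PFor.prems by auto
    have "\<exists>t \<le> d * (?T + 12) + 6. exec ?W (?f m') t ((?f ^^ d) (?f m'))"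
      using Suc.prems fb vb by (intro Suc.IH) (auto simp: sem_frame)
    then obtain u where u: "u \<le> d * (?T + 12) + 6" "exec ?W (?f m') u ((?f ^^ d) (?f m'))"
      by blast
    have "exec ?W m' (1 + 5 + (t + 6) + u) ((?f ^^ d) (?f m'))"
      using exec.WhileTrue[OF _ 1 u(2)] Suc.prems by (simp add: numeral_eq_Suc)
    moreover have "1 + 5 + (t + 6) + u \<le> Suc d * (?T + 12) + 6"
      using t u by (simp add: algebra_simps)
    moreover have "(?f ^^ Suc d) m' = (?f ^^ d) (?f m')" by (simp only: funpow_Suc_right o_apply)
    ultimately show ?case by (intro exI conjI) (assumption, simp only:)
  qed
  have d: "fst (nupd m v 0 0) b 0 = fst (nupd m v 0 0) v 0 + fst m b 0"
    using PFor.prems by auto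
  have "\<forall>b\<in>bounds (PFor v b p). fst (nupd m v 0 0) b 0 \<le> K" using PFor.prems by auto
  from loop[OF d this] obtain t where t: "t \<le> fst m b 0 * (?T + 12) + 6"
      "exec ?W (nupd m v 0 0) t (sem (PFor v b p) m)" by auto
  have "exec (compile (PFor v b p)) m (1 + 1 + 1 + t) (sem (PFor v b p) m)"
    using exec.Seq[OF exec.NWrite[of v "NConst 0" "NConst 0"]] t(2) by (simp add: numeral_eq_Suc)
  moreover have "1 + 1 + 1 + t \<le> cost (PFor v b p) * Suc K ^ depth (PFor v b p)"
  proof -
    have K: "fst m b 0 \<le> K" using PFor.prems by simp
    have "1 + 1 + 1 + t \<le> K * (?T + 12) + 9"
      using t(1) mult_le_mono1[OF K, of "?T + 12"] by linarith
    also have "\<dots> \<le> Suc K * (?T + 20)" by (simp add: algebra_simps)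
    also have "?T + 20 \<le> (cost p + 20) * Suc K ^ depth p" by (simp add: algebra_simps)
    finally have "1 + 1 + 1 + t \<le> Suc K * ((cost p + 20) * Suc K ^ depth p)"
      by (simp only: mult_le_mono2)
    also have "\<dots> = cost (PFor v b p) * Suc K ^ depth (PFor v b p)"
      by (simp only: cost.simps depth.simps power_Suc mult_ac)
    finally show ?thesis .
  qed
  ultimately show ?case by (intro exI conjI)
qed

section \<open>The condition that an evacuation time is at most z, as linear inequalities\<close>

section \<open>Evacuation times as systems of linear inequalities\<close>

lemma pos_less:
  assumes "valid_network P" "i < j" "j \<le> len P"
  shows "pos P i < pos P j"
  using assms(2,3)
proof (induction j)
  case (Suc j)
  have "pos P j < pos P (Suc j)" using assms(1) Suc.prems by (simp add: valid_network_def)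
  then show ?case using Suc by (cases "i = j") auto
qed simp

lemma pos_less_iff:
  assumes "valid_network P" "i \<le> len P" "j \<le> len P"
  shows "pos P i < pos P j \<longleftrightarrow> i < j"
  using pos_less[OF assms(1)] assms(2,3) by (metis less_asym linorder_neqE_nat less_irrefl)

lemma pos_le_iff:
  assumes "valid_network P" "i \<le> len P" "j \<le> len P"
  shows "pos P i \<le> pos P j \<longleftrightarrow> i \<le> j"
  using pos_less_iff[OF assms(1,3,2)] by (simp only: not_less[symmetric])

text \<open>Selecting edges by their left end points, \<open>pos P e < y\<close>, treats a sink at a
  vertex and a sink inside an edge alike; the index bounds in the definition of
  \<open>path_cap\<close> would need a case distinction.\<close>

lemma path_cap_right:
  assumes P: "valid_network P" and t: "t \<le> len P" and y: "pos P t < y" "y \<le> pos P (len P)"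
  shows "path_cap P (pos P t) y = Min (cap P ` {e. t \<le> e \<and> e < len P \<and> pos P e < y})"
proof -
  have 1: "Max {i'. i' \<le> len P \<and> pos P i' \<le> pos P t} = t"
    using t by (intro Max_eqI) (auto simp: pos_le_iff[OF P])
  let ?S = "{j'. j' \<le> len P \<and> y \<le> pos P j'}"
  let ?j = "Min ?S"
  have j: "?j \<in> ?S"
  proof (intro Min_in)
    have "len P \<in> ?S" using y by simp
    then show "?S \<noteq> {}" by blast
  qed simp
  have eq: "e < ?j \<longleftrightarrow> e < len P \<and> pos P e < y" for e
  proof
    assume e: "e < ?j"
    then have "e < len P" using j by simp
    moreover have "e \<notin> ?S"
    proof
      assume "e \<in> ?S"
      then have "?j \<le> e" by (intro Min_le) simp
      with e show False by simp
    qed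
    ultimately show "e < len P \<and> pos P e < y" by auto
  next
    assume e: "e < len P \<and> pos P e < y"
    then have "pos P e < pos P ?j" using j by auto
    then show "e < ?j" using e j pos_less_iff[OF P, of e ?j] by auto
  qed
  have "{t..<?j} = {e. t \<le> e \<and> e < ?j}" by (simp add: set_eq_iff)
  then have "{t..<?j} = {e. t \<le> e \<and> e < len P \<and> pos P e < y}" by (simp only: eq)
  then show ?thesis unfolding path_cap_def Let_def 1 by simp
qed

lemma path_cap_left:
  assumes P: "valid_network P" and t: "t \<le> len P" and y: "y < pos P t" "0 \<le> y"
  shows "path_cap P y (pos P t) = Min (cap P ` {e. e < t \<and> y < pos P (Suc e)})"
proof -
  have 1: "Min {j'. j' \<le> len P \<and> pos P t \<le> pos P j'} = t"
    using t by (intro Min_eqI) (auto simp: pos_le_iff[OF P])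
  let ?S = "{i'. i' \<le> len P \<and> pos P i' \<le> y}"
  let ?i = "Max ?S"
  have i: "?i \<in> ?S" 
  proof (intro Max_in)
    have "0 \<in> ?S" using y P by (simp add: valid_network_def)
    then show "?S \<noteq> {}" by blast
  qed simp
  have "?i \<le> e \<longleftrightarrow> y < pos P (Suc e)" if "e < t" for e
  proof
    assume e: "?i \<le> e"
    have "Suc e \<notin> ?S"
    proof
      assume "Suc e \<in> ?S"
      then have "Suc e \<le> ?i" by (intro Max_ge) simp
      with e show False by simp
    qed
    then show "y < pos P (Suc e)" using that t by auto
  next
    assume "y < pos P (Suc e)"
    then have "pos P ?i < pos P (Suc e)" using i by auto
    then show "?i \<le> e" using i that t pos_less_iff[OF P, of ?i "Suc e"] by auto
  qed
  then have "{?i..<t} = {e. e < t \<and> y < pos P (Suc e)}" by auto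
  then show ?thesis unfolding path_cap_def Let_def 1 by simp
qed

lemma divide_Min_le_iff:
  fixes c :: "nat \<Rightarrow> real"
  assumes "finite E" "E \<noteq> {}" "\<And>e. e \<in> E \<Longrightarrow> 0 < c e" "0 \<le> W"
  shows "W / Min (c ` E) \<le> u \<longleftrightarrow> (\<forall>e\<in>E. W / c e \<le> u)"
proof
  assume h: "W / Min (c ` E) \<le> u"
  show "\<forall>e\<in>E. W / c e \<le> u"
  proof
    fix e assume e: "e \<in> E"
    have "Min (c ` E) \<in> c ` E" using assms by (intro Min_in) auto
    then have "0 < Min (c ` E)" using assms by auto
    moreover have "Min (c ` E) \<le> c e" using e assms by auto
    ultimately have "W / c e \<le> W / Min (c ` E)" using assms(4) assms(3)[OF e]
      by (intro divide_left_mono mult_pos_pos)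
    then show "W / c e \<le> u" using h by simp
  qed
next
  assume h: "\<forall>e\<in>E. W / c e \<le> u"
  have "Min (c ` E) \<in> c ` E" using assms by (intro Min_in) auto
  then show "W / Min (c ` E) \<le> u" using h by auto
qed

lemma g_time_cong:
  assumes "\<And>l. l \<le> t \<Longrightarrow> s l = s' l"
  shows "g_time P t y s = g_time P t y s'"
proof -
  have "wsum s 0 t = wsum s' 0 t" unfolding wsum_def by (rule sum.cong) (use assms in auto)
  then show ?thesis by (simp add: g_time_def)
qed

lemma Theta_L_cong:
  assumes "\<And>l. l \<le> len P \<Longrightarrow> s l = s' l"
  shows "Theta_L P y s = Theta_L P y s'"
proof -
  have "(\<lambda>i. g_time P i y s) ` {i. i \<le> len P \<and> pos P i < y}
      = (\<lambda>i. g_time P i y s') ` {i. i \<le> len P \<and> pos P i < y}"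
    by (rule image_cong) (auto intro!: g_time_cong assms)
  then show ?thesis by (simp add: Theta_L_def)
qed

lemma g_time_nonneg:
  assumes P: "valid_network P" and t: "t \<le> len P" and y: "pos P t < y" "y \<le> pos P (len P)"
  shows "0 \<le> g_time P t y s"
proof (cases "0 < wsum s 0 t")
  case True
  let ?E = "{e. t \<le> e \<and> e < len P \<and> pos P e < y}"
  have "t < len P" using y t by (cases "t = len P") auto
  then have "t \<in> ?E" using y by simp
  then have "Min (cap P ` ?E) \<in> cap P ` ?E" by (intro Min_in) auto
  then have "0 < Min (cap P ` ?E)" using P by (auto simp: valid_network_def)
  then have "0 < path_cap P (pos P t) y" unfolding path_cap_right[OF P t y] .
  then have "0 \<le> wsum s 0 t / path_cap P (pos P t) y" using True by simp
  then show ?thesis using True y(1) by (simp add: g_time_def path_dist_def)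
qed (simp add: g_time_def)

lemma Theta_L_nonneg:
  assumes P: "valid_network P" and y: "y \<le> pos P (len P)"
  shows "0 \<le> Theta_L P y s"
proof (cases "\<exists>i. i \<le> len P \<and> pos P i < y")
  case True
  then obtain i where i: "i \<le> len P" "pos P i < y" by blast
  have "0 \<le> g_time P i y s" using g_time_nonneg[OF P i y] .
  also have "\<dots> \<le> Max ((\<lambda>i. g_time P i y s) ` {i. i \<le> len P \<and> pos P i < y})"
    using i by (intro Max_ge) auto
  finally show ?thesis using i unfolding Theta_L_def Max0_def by (subst if_not_P) blast+
next
  case False
  then have "{i. i \<le> len P \<and> pos P i < y} = {}" by blast
  then show ?thesis unfolding Theta_L_def Max0_def by simp
qed

text \<open>Since the capacity of a stretch of the path is a minimum over its edges, \<open>g\<close> is a maximum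
  of linear functions, one for each edge.\<close>

lemma Theta_L_le_iff:
  assumes P: "valid_network P" and y: "y \<le> pos P (len P)"
    and k: "\<And>l. l \<le> len P \<Longrightarrow> pos P l < y \<longleftrightarrow> l < k" and kn: "k \<le> len P"
  shows "Theta_L P y s \<le> z \<longleftrightarrow> 0 \<le> z \<and>
    (\<forall>e<k. \<forall>l\<le>e. 0 < wsum s 0 l \<longrightarrow> wsum s 0 l \<le> cap P e * (z - y + pos P l))"
    (is "_ \<longleftrightarrow> _ \<and> ?R")
proof -
  have set: "{i. i \<le> len P \<and> pos P i < y} = {..<k}"
  proof (intro set_eqI)
    fix l show "l \<in> {i. i \<le> len P \<and> pos P i < y} \<longleftrightarrow> l \<in> {..<k}"
      using k[of l] kn by auto
  qed
  \<comment> \<open>The conjunct \<open>0 \<le> z\<close> accounts for vertices without weight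
    behind them, whose time is 0 by convention.\<close>
  have g: "g_time P l y s \<le> z \<longleftrightarrow> 0 \<le> z \<and>
      (\<forall>e. l \<le> e \<and> e < k \<and> 0 < wsum s 0 l \<longrightarrow> wsum s 0 l \<le> cap P e * (z - y + pos P l))"
    if l: "l < k" for l
  proof (cases "0 < wsum s 0 l")
    case True
    have ly: "l \<le> len P" "pos P l < y" using l kn k[of l] by auto
    have E: "{e. l \<le> e \<and> e < len P \<and> pos P e < y} = {l..<k}"
    proof (intro set_eqI)
      fix e show "e \<in> {e. l \<le> e \<and> e < len P \<and> pos P e < y} \<longleftrightarrow> e \<in> {l..<k}"
        using k[of e] kn by auto
    qed
    have c: "0 < cap P e" if "e \<in> {l..<k}" for e using P that kn by (auto simp: valid_network_def)
    have eq: "wsum s 0 l / cap P e \<le> z - (y - pos P l) \<longleftrightarrow>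
       wsum s 0 l \<le> cap P e * (z - y + pos P l)" if "e \<in> {l..<k}" for e
      using c[OF that] by (simp add: field_simps)
    have "g_time P l y s \<le> z \<longleftrightarrow> wsum s 0 l / Min (cap P ` {l..<k}) \<le> z - (y - pos P l)"
      using True by (auto simp: g_time_def path_dist_def path_cap_right[OF P ly y] E)
    also have "\<dots> \<longleftrightarrow> (\<forall>e\<in>{l..<k}. wsum s 0 l / cap P e \<le> z - (y - pos P l))"
      by (rule divide_Min_le_iff) (use l c True in auto)
    also have "\<dots> \<longleftrightarrow> (\<forall>e\<in>{l..<k}. wsum s 0 l \<le> cap P e * (z - y + pos P l))" using eq by blast
    finally have "g_time P l y s \<le> z \<longleftrightarrow> (\<forall>e\<in>{l..<k}. wsum s 0 l \<le> cap P e * (z - y + pos P l))" .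
    moreover have "0 \<le> z" if "g_time P l y s \<le> z"
      using g_time_nonneg[OF P ly y, of s] that by linarith
    ultimately show ?thesis using True by auto
  qed (simp add: g_time_def)
  show ?thesis
  proof (cases "k = 0")
    case True
    then show ?thesis by (simp add: Theta_L_def set Max0_def)
  next
    case False
    then have "{..<k} \<noteq> {}" by (metis lessThan_iff empty_iff gr0I)
    then have "Theta_L P y s \<le> z \<longleftrightarrow> (\<forall>l<k. g_time P l y s \<le> z)"
      by (simp add: Theta_L_def set Max0_def Max_le_iff) blast
    also have "\<dots> \<longleftrightarrow> 0 \<le> z \<and> ?R"
    proof
      assume h: "\<forall>l<k. g_time P l y s \<le> z"
      have "0 \<le> z" using h g[of 0] False by blast
      moreover have ?R
      proof (intro allI impI)
        fix e l assume "e < k" "l \<le> e" "0 < wsum s 0 l"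
        then show "wsum s 0 l \<le> cap P e * (z - y + pos P l)" using h g[of l] by auto
      qed
      ultimately show "0 \<le> z \<and> ?R" by blast
    next
      assume "0 \<le> z \<and> ?R"
      then show "\<forall>l<k. g_time P l y s \<le> z" using g by blast
    qed
    finally show ?thesis .
  qed
qed

section \<open>Reversing the path, so that only evacuation from the left has to be studied\<close>

subsection \<open>Reflection\<close>

text \<open>Edge \<open>e\<close> joins \<open>e\<close> and \<open>Suc e\<close>; its image joins
  the images of these, hence the index shift \<open>len P - Suc e\<close> for capacities, in
  contrast to \<open>len P - l\<close> for vertices.\<close>

definition mirror :: "path_network \<Rightarrow> path_network" where
  "mirror P = \<lparr>len = len P, pos = (\<lambda>l. pos P (len P) - pos P (len P - l)),
     cap = (\<lambda>e. cap P (len P - Suc e)), wmin = (\<lambda>l. wmin P (len P - l)),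
     wmax = (\<lambda>l. wmax P (len P - l))\<rparr>"

lemma mirror_simps [simp]:
  "len (mirror P) = len P" "pos (mirror P) l = pos P (len P) - pos P (len P - l)"
  "cap (mirror P) l = cap P (len P - Suc l)" "wmin (mirror P) l = wmin P (len P - l)"
  "wmax (mirror P) l = wmax P (len P - l)"
  by (simp_all add: mirror_def)

lemma valid_mirror: "valid_network P \<Longrightarrow> valid_network (mirror P)"
  using pos_less[of P] by (auto simp: valid_network_def)

text \<open>Reversal turns the suffix sum of the weights into a prefix sum and the edges used from x
  up to vertex \<open>i\<close> into the edges used from the image of \<open>i\<close> up to the
  image of x.\<close>

lemma h_time_mirror:
  assumes P: "valid_network P" and i: "i \<le> len P" and x: "x < pos P i" "0 \<le> x"
  shows "h_time P i x s = g_time (mirror P) (len P - i) (pos P (len P) - x) (\<lambda>l. s (len P - l))"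
proof -
  have V: "valid_network (mirror P)" by (rule valid_mirror[OF P])
  have w: "wsum (\<lambda>l. s (len P - l)) 0 (len P - i) = wsum s i (len P)"
    unfolding wsum_def
    by (rule sum.reindex_bij_witness[of _ "\<lambda>l. len P - l" "\<lambda>l. len P - l"]) (use i in auto)
  have "{e. len P - i \<le> e \<and> e < len P \<and> pos (mirror P) e < pos P (len P) - x}
      = (\<lambda>e. len P - Suc e) ` {e. e < i \<and> x < pos P (Suc e)}" (is "?A = ?f ` ?B")
  proof (intro equalityI subsetI)
    fix e assume "e \<in> ?A"
    then have "?f e \<in> ?B" "e = ?f (?f e)" using i by (auto simp: Suc_diff_Suc)
    then show "e \<in> ?f ` ?B" by blast
  qed (use i in \<open>auto simp: Suc_diff_Suc\<close>)
  then have E: "cap (mirror P) ` {e. len P - i \<le> e \<and> e < len P \<and> pos (mirror P) e < pos P (len P) - x}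
      = cap P ` {e. e < i \<and> x < pos P (Suc e)}"
    using i by (force simp: image_image)
  have m: "pos (mirror P) (len P - i) = pos P (len P) - pos P i" using i by simp
  have "path_cap (mirror P) (pos (mirror P) (len P - i)) (pos P (len P) - x) = path_cap P x (pos P i)"
    using path_cap_right[OF V, of "len P - i" "pos P (len P) - x"] path_cap_left[OF P i x] x i E P
    by (simp add: valid_network_def)
  then show ?thesis using w m by (simp add: h_time_def g_time_def path_dist_def)
qed

lemma Theta_R_mirror:
  assumes P: "valid_network P" and x: "0 \<le> x"
  shows "Theta_R P x s = Theta_L (mirror P) (pos P (len P) - x) (\<lambda>l. s (len P - l))"
proof -
  let ?f = "\<lambda>i. len P - i"
  have "{i. i \<le> len P \<and> pos (mirror P) i < pos P (len P) - x} = ?f ` {i. i \<le> len P \<and> x < pos P i}"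
    (is "?A = ?f ` ?B")
  proof (intro equalityI subsetI)
    fix e assume "e \<in> ?A"
    then have "?f e \<in> ?B" "e = ?f (?f e)" by auto
    then show "e \<in> ?f ` ?B" by blast
  qed auto
  moreover have "(\<lambda>i. g_time (mirror P) i (pos P (len P) - x) (\<lambda>l. s (len P - l))) ` (?f ` ?B)
     = (\<lambda>i. h_time P i x s) ` ?B"
    unfolding image_image by (rule image_cong) (use h_time_mirror[OF P _ _ x] in auto)
  ultimately show ?thesis by (simp add: Theta_R_def Theta_L_def)
qed

section \<open>Minima of lines as piecewise affine functions, and the side constraint they
  express\<close>

section \<open>One side of the sink\<close>

text \<open>The affine formula is required on the closed interval although only its interior has to
  avoid \<open>S\<close>. Neighbouring pieces thus agree at the points of \<open>S\<close>, and
  continuity needs no separate assumption.\<close>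

definition piecewise_affine :: "real \<Rightarrow> real set \<Rightarrow> (real \<Rightarrow> real) \<Rightarrow> bool" where
  "piecewise_affine \<zeta> S \<phi> \<longleftrightarrow> (\<forall>u v. \<zeta> \<le> u \<longrightarrow> u < v \<longrightarrow> S \<inter> {u<..<v} = {} \<longrightarrow>
     (\<exists>m b. \<forall>r\<in>{u..v}. \<phi> r = m * r + b))"

lemma piecewise_affine_shift:
  assumes "piecewise_affine \<zeta> S \<phi>"
  shows "piecewise_affine (\<zeta> + d) ((\<lambda>s. s + d) ` S) (\<lambda>z. \<phi> (z - d))"
  unfolding piecewise_affine_def
proof (intro allI impI)
  fix u v assume uv: "\<zeta> + d \<le> u" "u < v" "(\<lambda>s. s + d) ` S \<inter> {u<..<v} = {}"
  have "S \<inter> {u - d<..<v - d} = {}"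
  proof (rule ccontr)
    assume "S \<inter> {u - d<..<v - d} \<noteq> {}"
    then obtain s where s: "s \<in> S" "u - d < s" "s < v - d" by auto
    then have "s + d \<in> (\<lambda>s. s + d) ` S \<inter> {u<..<v}" by auto
    then show False using uv(3) by blast
  qed
  then obtain m b where mb: "\<forall>r\<in>{u - d..v - d}. \<phi> r = m * r + b"
    using assms[unfolded piecewise_affine_def, rule_format, of "u - d" "v - d"] uv by auto
  show "\<exists>m b. \<forall>r\<in>{u..v}. \<phi> (r - d) = m * r + b"
    by (rule exI[of _ m], rule exI[of _ "b - m * d"]) (use mb in \<open>auto simp: algebra_simps\<close>)
qed

lemma piecewise_affine_add:
  assumes "piecewise_affine \<zeta> S \<phi>" "piecewise_affine \<zeta> S' \<psi>"
  shows "piecewise_affine \<zeta> (S \<union> S') (\<lambda>z. \<phi> z + \<psi> z)"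
  unfolding piecewise_affine_def
proof (intro allI impI)
  fix u v assume uv: "\<zeta> \<le> u" "u < v" "(S \<union> S') \<inter> {u<..<v} = {}"
  obtain m b where 1: "\<forall>r\<in>{u..v}. \<phi> r = m * r + b"
    using assms(1)[unfolded piecewise_affine_def, rule_format, of u v] uv by auto
  obtain m' b' where 2: "\<forall>r\<in>{u..v}. \<psi> r = m' * r + b'"
    using assms(2)[unfolded piecewise_affine_def, rule_format, of u v] uv by auto
  show "\<exists>m b. \<forall>r\<in>{u..v}. \<phi> r + \<psi> r = m * r + b"
    by (rule exI[of _ "m + m'"], rule exI[of _ "b + b'"]) (use 1 2 in \<open>auto simp: algebra_simps\<close>)
qed

lemma piecewise_affine_weaken:
  "piecewise_affine \<zeta> S \<phi> \<Longrightarrow> \<zeta> \<le> \<zeta>' \<Longrightarrow> piecewise_affine \<zeta>' S \<phi>"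
  unfolding piecewise_affine_def by (meson order_trans)

text \<open>Inside a gap of \<open>S\<close> the objective is affine, so one of the two ends of the
  gap is at least as good. To the right of all points of \<open>S\<close>, a bounded monotone affine
  function is constant, so the left end wins because \<kappa> is nonnegative.\<close>

lemma piecewise_affine_optimum:
  assumes pa: "piecewise_affine \<zeta> S \<phi>" and fin: "finite S"
    and mono: "\<And>u v. u \<le> v \<Longrightarrow> \<phi> u \<le> \<phi> v" and bd: "\<And>u. \<phi> u \<le> C"
    and z: "\<zeta> \<le> z" and q: "0 \<le> q" and \<kappa>: "0 \<le> \<kappa>"
  shows "\<exists>s\<in>insert \<zeta> S. \<zeta> \<le> s \<and> q * \<phi> z - \<kappa> * z \<le> q * \<phi> s - \<kappa> * s"
proof -
  define u where "u = Max {s \<in> insert \<zeta> S. s \<le> z}"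
  have fu: "finite {s \<in> insert \<zeta> S. s \<le> z}" using fin by simp
  have "u \<in> {s \<in> insert \<zeta> S. s \<le> z}" unfolding u_def by (rule Max_in[OF fu]) (use z in auto)
  then have u: "u \<in> insert \<zeta> S" "u \<le> z" by auto
  have \<zeta>u: "\<zeta> \<le> u" unfolding u_def by (rule Max_ge[OF fu]) (use z in simp)
  have gap: "s \<le> u" if "s \<in> S" "s \<le> z" for s
    unfolding u_def by (rule Max_ge[OF fu]) (use that in simp)
  show ?thesis
  proof (cases "u = z")
    case True
    then show ?thesis using u \<zeta>u by auto
  next
    case False
    then have uz: "u < z" using u by simp
    show ?thesis
    proof (cases "\<exists>s\<in>S. z \<le> s")
      case True
      define v where "v = Min {s \<in> S. z \<le> s}"
      have fv: "finite {s \<in> S. z \<le> s}" using fin by simp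
      have "v \<in> {s \<in> S. z \<le> s}" unfolding v_def by (rule Min_in[OF fv]) (use True in auto)
      then have v: "v \<in> S" "z \<le> v" by auto
      have gapv: "v \<le> s" if "s \<in> S" "z \<le> s" for s
        unfolding v_def by (rule Min_le[OF fv]) (use that in simp)
      have "S \<inter> {u<..<v} = {}" using gap gapv by (auto) (meson leD le_cases)
      moreover have uv: "u < v" using uz v by simp
      ultimately obtain m b where "\<forall>r\<in>{u..v}. \<phi> r = m * r + b"
        using pa[unfolded piecewise_affine_def] \<zeta>u by meson
      then have mb: "\<phi> r = m * r + b" if "u \<le> r" "r \<le> v" for r using that by auto
      show ?thesis
      proof (cases "q * m - \<kappa> \<ge> 0")
        case True
        then have "(q * m - \<kappa>) * z \<le> (q * m - \<kappa>) * v" using v by (intro mult_left_mono)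
        then have "q * \<phi> z - \<kappa> * z \<le> q * \<phi> v - \<kappa> * v"
          using mb[of z] mb[of v] u v by (simp add: algebra_simps)
        then show ?thesis using v \<zeta>u uv by (intro bexI[of _ v]) auto
      next
        case False
        then have "(q * m - \<kappa>) * z \<le> (q * m - \<kappa>) * u" using u by (intro mult_left_mono_neg) auto
        then have "q * \<phi> z - \<kappa> * z \<le> q * \<phi> u - \<kappa> * u"
          using mb[of z] mb[of u] u v by (simp add: algebra_simps)
        then show ?thesis using u \<zeta>u by blast
      qed
    next
      case False
      have aff: "\<exists>m b. \<forall>r\<in>{u..w}. \<phi> r = m * r + b" if "z < w" for w
      proof -
        have "S \<inter> {u<..<w} = {}" using gap False by (auto) (meson leD le_cases)
        then show ?thesis using pa[unfolded piecewise_affine_def] \<zeta>u uz that by (meson less_trans)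
      qed
      have "\<phi> z \<le> \<phi> u"
      proof (rule ccontr)
        assume h: "\<not> \<phi> z \<le> \<phi> u"
        define \<mu> where "\<mu> = (\<phi> z - \<phi> u) / (z - u)"
        have \<mu>: "0 < \<mu>" using h uz by (simp add: \<mu>_def)
        \<comment> \<open>At \<open>w\<close> a line through the value at \<open>u\<close> with
          slope \<mu> has risen above the bound \<open>C\<close>.\<close>
        define w where "w = z + 1 + (C - \<phi> u) / \<mu>"
        have "0 \<le> (C - \<phi> u) / \<mu>" using \<mu> bd[of u] by simp
        then have zw: "z < w" by (simp add: w_def)
        from aff[OF this] obtain m b where "\<forall>r\<in>{u..w}. \<phi> r = m * r + b" by blast
        then have mb: "\<phi> r = m * r + b" if "u \<le> r" "r \<le> w" for r using that by auto
        have "\<phi> z - \<phi> u = m * (z - u)" using mb[of z] mb[of u] uz zw by (simp add: algebra_simps)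
        then have m: "m = \<mu>" using uz by (simp add: \<mu>_def)
        have "\<phi> w - \<phi> u = \<mu> * (w - u)" using mb[of w] mb[of u] uz zw m by (simp add: algebra_simps)
        also have "\<dots> = \<mu> * (z + 1 - u) + (C - \<phi> u)" using \<mu> by (simp add: w_def field_simps)
        also have "\<dots> > C - \<phi> u" using \<mu> uz by simp
        finally show False using bd[of w] by simp
      qed
      then have "q * \<phi> z - \<kappa> * z \<le> q * \<phi> u - \<kappa> * u"
        using mult_left_mono[OF _ q] mult_left_mono[OF u(2) \<kappa>] by (metis diff_mono)
      then show ?thesis using u \<zeta>u by blast
    qed
  qed
qed

text \<open>\<open>w\<close> are the weights when the variable weight \<open>w\<^sub>i + \<alpha>\<close>, \<open>0 \<le> \<alpha> \<le> a\<close>, is smallest. The flag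
  \<open>f\<close> selects the regime \<open>0 < \<alpha>\<close>; otherwise \<open>\<alpha> = a = 0\<close>. The two have to be kept apart since a
  vertex stops counting when no weight is left behind it (\<open>act\<close>). With \<open>r = z - y\<close>, the condition
  \<open>\<Theta>\<^sub>L \<le> z\<close> at a sink with \<open>k\<close> vertices to its left becomes \<open>\<rho> k \<le> r\<close> and \<open>\<alpha> \<le> A k r\<close>, where
  \<open>A k\<close> is the minimum of the lines \<open>0, \<dots>, k\<close>. Line \<open>0\<close> is the constant \<open>a\<close>, line \<open>e + 1\<close> comes
  from edge \<open>e\<close>. The numbers \<open>R p\<close> are common breakpoints of all \<open>A k\<close>, and \<open>L k p\<close> is the
  line that attains \<open>A k\<close> between \<open>R p\<close> and \<open>R (p + 1)\<close>.\<close>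

locale side =
  fixes P :: path_network and w :: "nat \<Rightarrow> real" and i :: nat and a :: real and f :: bool
    and mm bb rho R :: "nat \<Rightarrow> real" and L :: "nat \<Rightarrow> nat \<Rightarrow> nat" and np :: nat
    and V :: "nat \<Rightarrow> real" and act :: "nat \<Rightarrow> bool"
  assumes P: "valid_network P" and w: "\<And>l. l \<le> len P \<Longrightarrow> 0 \<le> w l" and i: "i \<le> len P"
    and fa: "f \<Longrightarrow> 0 < a" "\<not> f \<Longrightarrow> a = 0"
    and V_eq: "\<And>l. l \<le> len P \<Longrightarrow> V l = wsum w 0 l"
    and act_iff: "\<And>l. act l \<longleftrightarrow> 0 < V l \<or> f \<and> i \<le> l"
    and line_0: "mm 0 = 0" "bb 0 = a"
    and line_Suc: "\<And>e. e < len P \<Longrightarrow>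
       mm (Suc e) = 0 \<and> bb (Suc e) = a \<and> (\<forall>l\<le>e. i \<le> l \<longrightarrow> \<not> act l) \<or>
       mm (Suc e) = cap P e \<and> (\<forall>\<beta>. \<beta> \<le> bb (Suc e) \<longleftrightarrow>
           (\<forall>l\<le>e. i \<le> l \<and> act l \<longrightarrow> \<beta> \<le> cap P e * pos P l - V l))"
    and rho: "\<And>k r. k \<le> len P \<Longrightarrow> rho k \<le> r \<longleftrightarrow> - pos P (len P) \<le> r \<and>
       (\<forall>e<k. \<forall>l\<le>e. act l \<longrightarrow> V l / cap P e - pos P l \<le> r)"
    and np: "0 < np" and R_0: "R 0 = - pos P (len P)"
    and R_Suc: "\<And>p. Suc p < np \<Longrightarrow> R p \<le> R (Suc p)"
    and L_line: "\<And>k p r. k \<le> len P \<Longrightarrow> p < np \<Longrightarrow> R p \<le> r \<Longrightarrow> (Suc p < np \<longrightarrow> r \<le> R (Suc p)) \<Longrightarrow>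
       mm (L k p) * r + bb (L k p) = rec_nat a (\<lambda>e v. min v (mm (Suc e) * r + bb (Suc e))) k"
begin

primrec A :: "nat \<Rightarrow> real \<Rightarrow> real" where
  "A 0 r = a"
| "A (Suc k) r = min (A k r) (mm (Suc k) * r + bb (Suc k))"

text \<open>The locale assumption on \<open>L\<close> comes before \<open>A\<close> can be defined
  and therefore spells out the recursion; this identifies the two.\<close>

lemma A_rec: "A k r = rec_nat a (\<lambda>e v. min v (mm (Suc e) * r + bb (Suc e))) k"
  by (induction k) simp_all

lemma L_A: "\<lbrakk>k \<le> len P; p < np; R p \<le> r; Suc p < np \<longrightarrow> r \<le> R (Suc p)\<rbrakk> \<Longrightarrow>
    mm (L k p) * r + bb (L k p) = A k r"
  unfolding A_rec by (rule L_line)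

lemma a_nonneg: "0 \<le> a" using fa by (cases f) auto

lemma cap_pos: "e < len P \<Longrightarrow> 0 < cap P e" using P by (simp add: valid_network_def)

lemma mm_nonneg: "e < len P \<Longrightarrow> 0 \<le> mm (Suc e)"
  using line_Suc[of e] cap_pos[of e] by auto

lemma A_le: "A k r \<le> a" by (induction k) auto

lemma A_mono: "k \<le> len P \<Longrightarrow> r \<le> r' \<Longrightarrow> A k r \<le> A k r'"
proof (induction k)
  case (Suc k)
  then have "mm (Suc k) * r \<le> mm (Suc k) * r'" by (intro mult_left_mono mm_nonneg) auto
  then show ?case using Suc by (auto simp: min_def)
qed simp

lemma A_antimono: "k \<le> k' \<Longrightarrow> A k' r \<le> A k r"
  by (induction k' rule: dec_induct) auto

text \<open>A minimum of affine functions. Concavity is used in three ways: to reach limits of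
  admissible weights, to leave an edge without losing value, and to stop a search at the first
  descent.\<close>

lemma A_concave:
  assumes "0 \<le> t" "t \<le> 1"
  shows "(1 - t) * A k r + t * A k r' \<le> A k ((1 - t) * r + t * r')"
proof (induction k)
  case 0
  then show ?case by (simp add: algebra_simps)
next
  case (Suc k)
  have 1: "(1 - t) * A (Suc k) r \<le> (1 - t) * A k r" "t * A (Suc k) r' \<le> t * A k r'"
    using assms by (intro mult_left_mono; simp)+
  have 2: "(1 - t) * A (Suc k) r \<le> (1 - t) * (mm (Suc k) * r + bb (Suc k))"
    "t * A (Suc k) r' \<le> t * (mm (Suc k) * r' + bb (Suc k))"
    using assms by (intro mult_left_mono; simp)+
  have "(1 - t) * (mm (Suc k) * r + bb (Suc k)) + t * (mm (Suc k) * r' + bb (Suc k))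
      = mm (Suc k) * ((1 - t) * r + t * r') + bb (Suc k)"
    by (simp add: algebra_simps)
  with Suc 1 2 show ?case unfolding A.simps(2)[of k "(1 - t) * r + t * r'"] by linarith
qed

text \<open>An edge without a relevant vertex has the constant line \<open>a\<close>. It imposes
  nothing on \<alpha> because \<alpha> is at most \<open>a\<close> anyway.\<close>

lemma le_A_iff:
  assumes "k \<le> len P" "\<alpha> \<le> a"
  shows "\<alpha> \<le> A k r \<longleftrightarrow>
    (\<forall>e<k. \<forall>l\<le>e. i \<le> l \<and> act l \<longrightarrow> \<alpha> \<le> cap P e * (r + pos P l) - V l)"
  using assms(1)
proof (induction k)
  case 0
  then show ?case using assms by simp
next
  case (Suc k)
  have "\<alpha> \<le> mm (Suc k) * r + bb (Suc k) \<longleftrightarrow>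
    (\<forall>l\<le>k. i \<le> l \<and> act l \<longrightarrow> \<alpha> \<le> cap P k * (r + pos P l) - V l)" (is "_ \<longleftrightarrow> ?R")
  proof -
    have eq: "(\<alpha> - cap P k * r \<le> cap P k * pos P l - V l) \<longleftrightarrow> \<alpha> \<le> cap P k * (r + pos P l) - V l" for l
      by (auto simp: algebra_simps)
    have "k < len P" using Suc.prems by simp
    from line_Suc[OF this] show ?thesis
    proof (elim disjE)
      assume h: "mm (Suc k) = cap P k \<and> (\<forall>\<beta>. \<beta> \<le> bb (Suc k) \<longleftrightarrow>
           (\<forall>l\<le>k. i \<le> l \<and> act l \<longrightarrow> \<beta> \<le> cap P k * pos P l - V l))"
      have "\<alpha> \<le> mm (Suc k) * r + bb (Suc k) \<longleftrightarrow> \<alpha> - cap P k * r \<le> bb (Suc k)"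
        unfolding h[THEN conjunct1] by linarith
      also have "\<dots> \<longleftrightarrow> ?R" unfolding h[THEN conjunct2, rule_format] eq ..
      finally show ?thesis .
    qed (use assms(2) in auto)
  qed
  then show ?case using Suc by (auto simp: less_Suc_eq)
qed

lemma rho_mono: "k \<le> k' \<Longrightarrow> k' \<le> len P \<Longrightarrow> rho k \<le> rho k'"
  using rho[of k' "rho k'"] rho[of k "rho k'"] by auto

lemma rho_ge: "k \<le> len P \<Longrightarrow> - pos P (len P) \<le> rho k"
  using rho[of k "rho k"] by auto

text \<open>\<open>rho k \<le> r\<close> says that the fixed weights alone meet all constraints, so
  the choice 0 for the variable weight passes the test of \<open>le_A_iff\<close>.\<close>

lemma A_nonneg:
  assumes k: "k \<le> len P" and r: "rho k \<le> r"
  shows "0 \<le> A k r"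
proof -
  have "0 \<le> cap P e * (r + pos P l) - V l" if "e < k" "l \<le> e" "act l" for e l
  proof -
    have "V l / cap P e - pos P l \<le> r" using rho[OF k] r that by auto
    then have "V l / cap P e \<le> r + pos P l" by simp
    then show ?thesis using cap_pos[of e] that k by (simp add: field_simps)
  qed
  then show ?thesis unfolding le_A_iff[OF k a_nonneg] by blast
qed

text \<open>A line that is not the constant \<open>a\<close> has a capacity as its slope, which is
  positive, so far to the right every line is above \<open>a\<close>.\<close>

lemma A_large: "k \<le> len P \<Longrightarrow> \<exists>r0. \<forall>r\<ge>r0. A k r = a"
proof (induction k)
  case (Suc k)
  then obtain r0 where r0: "\<forall>r\<ge>r0. A k r = a" by auto
  have "\<exists>r1. \<forall>r\<ge>r1. a \<le> mm (Suc k) * r + bb (Suc k)"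
  proof -
    have "k < len P" using Suc.prems by simp
    from line_Suc[OF this] show ?thesis
    proof (elim disjE)
      assume h: "mm (Suc k) = cap P k \<and> (\<forall>\<beta>. \<beta> \<le> bb (Suc k) \<longleftrightarrow>
           (\<forall>l\<le>k. i \<le> l \<and> act l \<longrightarrow> \<beta> \<le> cap P k * pos P l - V l))"
      have c: "0 < cap P k" using cap_pos Suc.prems by simp
      have "a \<le> mm (Suc k) * r + bb (Suc k)" if "(a - bb (Suc k)) / cap P k \<le> r" for r
        using that c h by (simp add: field_simps)
      then show ?thesis by blast
    qed auto
  qed
  then obtain r1 where r1: "\<forall>r\<ge>r1. a \<le> mm (Suc k) * r + bb (Suc k)" ..
  show ?case using r0 r1 by (intro exI[of _ "max r0 r1"]) (auto simp: min_def)
qed simp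

lemma R_mono: "p \<le> p' \<Longrightarrow> p' < np \<Longrightarrow> R p \<le> R p'"
proof (induction p' rule: dec_induct)
  case (step q)
  then show ?case using R_Suc[of q] by simp
qed simp

lemma A_piecewise_affine:
  assumes k: "k \<le> len P"
  shows "piecewise_affine (- pos P (len P)) (R ` {..<np}) (A k)"
  unfolding piecewise_affine_def
proof (intro allI impI)
  fix u v assume uv: "- pos P (len P) \<le> u" "u < v" "R ` {..<np} \<inter> {u<..<v} = {}"
  \<comment> \<open>The last breakpoint not beyond \<open>u\<close>. It exists because
    \<open>R 0\<close> is the left end of the domain, and its cell contains all of
    \<open>{u..v}\<close>.\<close>
  define p where "p = Max {p. p < np \<and> R p \<le> u}"
  have fin: "finite {p. p < np \<and> R p \<le> u}" by simp
  have "p \<in> {p. p < np \<and> R p \<le> u}" unfolding p_def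
  proof (rule Max_in[OF fin])
    have "0 \<in> {p. p < np \<and> R p \<le> u}" using np R_0 uv by simp
    then show "{p. p < np \<and> R p \<le> u} \<noteq> {}" by blast
  qed
  then have p: "p < np" "R p \<le> u" by auto
  have v: "v \<le> R (Suc p)" if "Suc p < np"
  proof -
    have "\<not> R (Suc p) \<le> u"
    proof
      assume "R (Suc p) \<le> u"
      then have "Suc p \<le> p" unfolding p_def by (intro Max_ge[OF fin]) (use that p_def in simp)
      then show False by simp
    qed
    then show ?thesis using uv(3) that by (metis (full_types) IntI emptyE greaterThanLessThan_iff
          imageI lessThan_iff not_le)
  qed
  have "A k r = mm (L k p) * r + bb (L k p)" if "r \<in> {u..v}" for r
    using that p v by (intro L_A[symmetric] k) auto
  then show "\<exists>m b. \<forall>r\<in>{u..v}. A k r = m * r + b" by blast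
qed

lemma V_nonneg: "l \<le> len P \<Longrightarrow> 0 \<le> V l"
  using w by (simp add: V_eq wsum_def) (rule sum_nonneg, auto)

lemma wsum_bump:
  assumes "l \<le> len P" "\<And>l'. l' \<le> l \<Longrightarrow> s l' = w l' + (if l' = i then \<alpha> else 0)"
  shows "wsum s 0 l = V l + (if i \<le> l then \<alpha> else 0)"
proof -
  have "wsum s 0 l = (\<Sum>t=0..l. w t + (if t = i then \<alpha> else 0))"
    unfolding wsum_def by (rule sum.cong) (use assms in auto)
  then show ?thesis using assms(1) by (simp add: sum.distrib V_eq wsum_def sum.delta)
qed

text \<open>The prefix sums before vertex \<open>i\<close> are constant and constrain only r; those
  from \<open>i\<close> on contain the variable weight once. Sorting the linear conditions
  accordingly separates \<open>rho\<close> from \<open>A\<close>.\<close>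

theorem Theta_L_le:
  assumes y: "y \<le> pos P (len P)"
    and k: "\<And>l. l \<le> len P \<Longrightarrow> pos P l < y \<longleftrightarrow> l < k" and kn: "k \<le> len P"
    and s: "\<And>l. l < k \<Longrightarrow> s l = w l + (if l = i then \<alpha> else 0)"
    and \<alpha>: "0 \<le> \<alpha>" "\<alpha> \<le> a" "f \<Longrightarrow> 0 < \<alpha>"
  shows "Theta_L P y s \<le> z \<longleftrightarrow> 0 \<le> z \<and> rho k \<le> z - y \<and> \<alpha> \<le> A k (z - y)"
proof -
  have W: "wsum s 0 l = V l + (if i \<le> l then \<alpha> else 0)" if "l < k" for l
    using that kn s by (intro wsum_bump) auto
  \<comment> \<open>This is where the regimes matter: a positive \<alpha> activates every vertex
    from \<open>i\<close> on, while outside the regime \<open>a = 0\<close> forces \<alpha> to be 0.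
    In neither case does activity depend on the value of \<alpha>.\<close>
  have pos: "0 < wsum s 0 l \<longleftrightarrow> act l" if "l < k" for l
    using W[OF that] V_nonneg[of l] that kn \<alpha> fa(2) by (cases f) (auto simp: act_iff)
  have "Theta_L P y s \<le> z \<longleftrightarrow> 0 \<le> z \<and>
     (\<forall>e<k. \<forall>l\<le>e. 0 < wsum s 0 l \<longrightarrow> wsum s 0 l \<le> cap P e * (z - y + pos P l))"
    by (rule Theta_L_le_iff[OF P y _ kn]) (rule k)
  also have "(\<forall>e<k. \<forall>l\<le>e. 0 < wsum s 0 l \<longrightarrow> wsum s 0 l \<le> cap P e * (z - y + pos P l)) \<longleftrightarrow>
     (\<forall>e<k. \<forall>l\<le>e. act l \<longrightarrow> V l / cap P e - pos P l \<le> z - y) \<and>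
     (\<forall>e<k. \<forall>l\<le>e. i \<le> l \<and> act l \<longrightarrow> \<alpha> \<le> cap P e * (z - y + pos P l) - V l)"
  proof -
    \<comment> \<open>As \<alpha> is nonnegative, the inequality for \<open>V l + \<alpha>\<close>
      implies the one for \<open>V l\<close>; so \<open>rho\<close> may range over all active
      vertices, including those from \<open>i\<close> on.\<close>
    have "(0 < wsum s 0 l \<longrightarrow> wsum s 0 l \<le> cap P e * (z - y + pos P l)) \<longleftrightarrow>
       (act l \<longrightarrow> V l / cap P e - pos P l \<le> z - y) \<and>
       (i \<le> l \<and> act l \<longrightarrow> \<alpha> \<le> cap P e * (z - y + pos P l) - V l)" if e: "e < k" "l \<le> e" for e l
    proof -
      have l: "l < k" using e by simp
      have c: "0 < cap P e" using cap_pos e kn by simp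
      have "V l / cap P e - pos P l \<le> z - y \<longleftrightarrow> V l \<le> cap P e * (z - y + pos P l)"
        using c by (simp add: field_simps)
      then show ?thesis unfolding pos[OF l] unfolding W[OF l] using \<alpha>(1) by auto
    qed
    then show ?thesis by blast
  qed
  \<comment> \<open>The remaining clause of \<open>rho\<close>, the left end of the domain, follows
    from \<open>0 \<le> z\<close> and the bound on \<open>y\<close>.\<close>
  finally show ?thesis
    unfolding rho[OF kn] le_A_iff[OF kn \<alpha>(2)] using y by auto
qed

text \<open>A quotient of a nonnegative weight by a capacity is nonnegative. With r = z - y this
  yields \<open>0 \<le> z\<close> at every sink \<open>y\<close> not to the left of the active
  vertex, so the sign condition on z comes for free as soon as something is active.\<close>

lemma active_imp_ge:
  assumes "k \<le> len P" "rho k \<le> r" "l < k" "act l"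
  shows "- pos P l \<le> r"
proof -
  have "V l / cap P l - pos P l \<le> r" using rho[OF assms(1)] assms by auto
  moreover have "0 \<le> V l / cap P l" using V_nonneg[of l] cap_pos[of l] assms by simp
  ultimately show ?thesis by linarith
qed

end

text \<open>The two coordinates satisfy r + r' = 2z - x_n, so each side carries half of the cost z;
  this is the origin of the factor 1/2. Breakpoints below \<open>rho k\<close> are replaced by
  \<open>rho k\<close>, the least admissible r.\<close>

lemma (in side) optimum_on_breakpoints:
  assumes k: "k \<le> len P" and q: "0 \<le> q"
    and best: "\<And>p. p < np \<Longrightarrow> q * A k (max (R p) (rho k)) - max (R p) (rho k) / 2 \<le> M"
    and r: "rho k \<le> r"
  shows "q * A k r - r / 2 \<le> M"
proof -
  have pa: "piecewise_affine (rho k) (R ` {..<np}) (A k)"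
    by (rule piecewise_affine_weaken[OF A_piecewise_affine[OF k] rho_ge[OF k]])
  obtain s where s: "s \<in> insert (rho k) (R ` {..<np})" "rho k \<le> s"
      "q * A k r - (1/2) * r \<le> q * A k s - (1/2) * s"
    using piecewise_affine_optimum[OF pa _ A_mono[OF k] A_le r q, of "1/2"] by auto
  have "\<exists>p<np. s = max (R p) (rho k)"
  proof (cases "s = rho k")
    case True
    then show ?thesis using np R_0 rho_ge[OF k] by (intro exI[of _ 0]) simp
  next
    case False
    then show ?thesis using s by auto
  qed
  then show ?thesis using best s(3) by force
qed

text \<open>The passage to the limit s = 0 for an affine function of s, in elementary form.\<close>

lemma le_of_segment:
  fixes p d U :: real
  assumes "\<And>s. 0 < s \<Longrightarrow> s < 1 \<Longrightarrow> p + s * d \<le> U"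
  shows "p \<le> U"
proof (rule ccontr)
  assume h: "\<not> p \<le> U"
  show False
  proof (cases "0 \<le> d")
    case True
    then show False using assms[of "1/2"] h by simp
  next
    case False
    \<comment> \<open>Small enough that the loss \<open>s * (- d)\<close> is at most half of the
      assumed excess of \<open>p\<close> over \<open>U\<close>.\<close>
    define s where "s = min (1/2) ((p - U) / (2 * (- d)))"
    have "0 < (p - U) / (2 * (- d))" using h False by (intro divide_pos_pos) auto
    then have "0 < s" by (simp add: s_def)
    moreover have "s \<le> 1 / 2" by (simp add: s_def)
    ultimately have s: "0 < s" "s < 1" by linarith+
    have "s \<le> (p - U) / (2 * (- d))" by (simp add: s_def)
    then have "s * (- d) \<le> (p - U) / 2" using False by (simp add: field_simps)
    then show False using assms[OF s] h by (simp add: field_simps)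
  qed
qed

section \<open>Combining both sides: candidates at vertices and inside edges\<close>

section \<open>Both sides of the sink\<close>

text \<open>\<open>P\<close> and \<open>Q\<close> are reflections of each other. The total weight \<open>\<alpha> + \<beta>\<close> contributes to the
  \<open>u\<close>-th term of the maximum with slope \<open>cq u\<close>. A sink at \<open>y\<close> with value \<open>z\<close> has coordinate
  \<open>r = z - y\<close> on the left side and \<open>r' = z + y - x\<^sub>n\<close> on the right side.\<close>

locale two_sided =
  A: side P wA iA a fA mA bA rhoA RA LA np VA actA +
  B: side Q wB iB b fB mB bB rhoB RB LB np VB actB
  for P wA iA a fA mA bA rhoA RA LA np VA actA Q wB iB b fB mB bB rhoB RB LB VB actB +
  fixes lo hi :: nat and x :: real and TT :: "nat set" and T :: nat and cf cq :: "nat \<Rightarrow> real"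
    and sA sB :: "real \<Rightarrow> real \<Rightarrow> scenario" and ok :: "real \<Rightarrow> real \<Rightarrow> bool"
  assumes len_Q: "len Q = len P"
    and pos_Q: "\<And>l. l \<le> len P \<Longrightarrow> pos Q l = pos P (len P) - pos P (len P - l)"
    and lohi: "iA \<le> lo" "lo \<le> hi" "hi + iB \<le> len P"
    and sA: "\<And>\<alpha> \<beta> l. l < len P - iB \<Longrightarrow> sA \<alpha> \<beta> l = wA l + (if l = iA then \<alpha> else 0)"
    and sB: "\<And>\<alpha> \<beta> l. l < len P - iA \<Longrightarrow> sB \<alpha> \<beta> l = wB l + (if l = iB then \<beta> else 0)"
    and ok: "\<And>\<alpha> \<beta>. ok \<alpha> \<beta> \<longleftrightarrow> 0 \<le> \<alpha> \<and> \<alpha> \<le> a \<and> (fA \<longrightarrow> 0 < \<alpha>) \<and> 0 \<le> \<beta> \<and> \<beta> \<le> b \<and> (fB \<longrightarrow> 0 < \<beta>)"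
    and lines: "\<And>u. u < T \<Longrightarrow> \<exists>t\<in>TT. \<forall>\<alpha> \<beta>. ok \<alpha> \<beta> \<longrightarrow> g_time P t x (sA \<alpha> \<beta>) = cf u + cq u * (\<alpha> + \<beta>)"
    and lines': "\<And>t. t \<in> TT \<Longrightarrow> \<exists>u<T. \<forall>\<alpha> \<beta>. ok \<alpha> \<beta> \<longrightarrow> g_time P t x (sA \<alpha> \<beta>) = cf u + cq u * (\<alpha> + \<beta>)"
    and cq: "\<And>u. u < T \<Longrightarrow> 0 \<le> cq u"
begin

abbreviation "n \<equiv> len P"
abbreviation "X \<equiv> pos P (len P)"

definition Th :: "real \<Rightarrow> real \<Rightarrow> real \<Rightarrow> real" where
  "Th y \<alpha> \<beta> = max (Theta_L P y (sA \<alpha> \<beta>)) (Theta_L Q (X - y) (sB \<alpha> \<beta>))"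

text \<open>Optimality is expressed through the set of all upper bounds, since a maximum need not
  exist.\<close>

definition upper_bound :: "real \<Rightarrow> bool" where
  "upper_bound U \<longleftrightarrow> (\<forall>\<alpha> \<beta> y. \<forall>t\<in>TT. ok \<alpha> \<beta> \<longrightarrow> pos P lo \<le> y \<longrightarrow> y \<le> pos P hi \<longrightarrow>
     g_time P t x (sA \<alpha> \<beta>) - Th y \<alpha> \<beta> \<le> U)"

text \<open>\<open>k\<close> and \<open>k'\<close> count the vertices strictly to the left and right
  of the sink: \<open>k\<close> and \<open>n - k\<close> at vertex \<open>k\<close>, but
  \<open>Suc k\<close> and \<open>n - k\<close> inside edge \<open>k\<close>. The bounds on them
  ensure that each side sees only its own variable weight.\<close>

definition place :: "real \<Rightarrow> nat \<Rightarrow> nat \<Rightarrow> bool" where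
  "place y k k' \<longleftrightarrow> pos P lo \<le> y \<and> y \<le> pos P hi \<and> k \<le> hi \<and> k' \<le> n - lo \<and>
     (\<forall>l\<le>n. pos P l < y \<longleftrightarrow> l < k) \<and> (\<forall>l\<le>n. pos Q l < X - y \<longleftrightarrow> l < k')"

text \<open>The least z that the fixed weights admit for a sink at vertex \<open>k\<close>: the two
  conditions with \<open>rhoA\<close> and \<open>rhoB\<close>, translated to the common coordinate
  z, together with \<open>0 \<le> z\<close>.\<close>

definition \<zeta> :: "nat \<Rightarrow> real" where
  "\<zeta> k = max 0 (max (rhoA k + pos P k) (rhoB (n - k) + (X - pos P k)))"

definition vertex_covered :: "nat \<Rightarrow> nat \<Rightarrow> real \<Rightarrow> bool" where
  "vertex_covered k u out \<longleftrightarrow>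
     (\<forall>z\<ge>\<zeta> k. cf u + cq u * (A.A k (z - pos P k) + B.A (n - k) (z - (X - pos P k))) - z \<le> out)"

definition edge_covered :: "nat \<Rightarrow> nat \<Rightarrow> real \<Rightarrow> bool" where
  "edge_covered k u out \<longleftrightarrow> (\<forall>y z. pos P k < y \<longrightarrow> y < pos P (Suc k) \<longrightarrow> 0 \<le> z \<longrightarrow>
     rhoA (Suc k) \<le> z - y \<longrightarrow> rhoB (n - k) \<le> z - (X - y) \<longrightarrow>
     cf u + cq u * (A.A (Suc k) (z - y) + B.A (n - k) (z - (X - y))) - z \<le> out)"

lemma X_ge: "l \<le> n \<Longrightarrow> pos P l \<le> X" and pos_nonneg: "l \<le> n \<Longrightarrow> 0 \<le> pos P l" and hi_n: "hi \<le> n"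
  using pos_le_iff[OF A.P, of l n] pos_le_iff[OF A.P, of 0 l] A.P lohi by (auto simp: valid_network_def)

lemma X_Q: "pos Q n = X"
  using pos_Q[of n] A.P by (simp add: valid_network_def)

lemma pos_Q_less: "l \<le> n \<Longrightarrow> pos Q l < X - y \<longleftrightarrow> y < pos P (n - l)"
  using pos_Q[of l] by auto

lemma place_vertex:
  assumes "lo \<le> k" "k \<le> hi"
  shows "place (pos P k) k (n - k)"
  unfolding place_def using assms lohi hi_n pos_le_iff[OF A.P] pos_less_iff[OF A.P] pos_Q_less
  by (auto simp del: mirror_simps)

lemma place_edge:
  assumes k: "lo \<le> k" "k < hi" and y: "pos P k < y" "y < pos P (Suc k)"
  shows "place y (Suc k) (n - k)"
proof -
  have 1: "pos P l < y \<longleftrightarrow> l < Suc k" if "l \<le> n" for l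
  proof
    assume "pos P l < y"
    then have "pos P l < pos P (Suc k)" using y by simp
    then show "l < Suc k" using that k hi_n pos_less_iff[OF A.P, of l "Suc k"] by simp
  next
    assume "l < Suc k"
    then have "pos P l \<le> pos P k" using that k hi_n pos_le_iff[OF A.P, of l k] by simp
    then show "pos P l < y" using y by simp
  qed
  have 2: "pos Q l < X - y \<longleftrightarrow> l < n - k" if "l \<le> n" for l
  proof -
    have "\<not> pos P (n - l) < y \<longleftrightarrow> y < pos P (n - l)"
    proof -
      have "pos P (n - l) \<le> pos P k \<or> pos P (Suc k) \<le> pos P (n - l)"
        using k hi_n pos_le_iff[OF A.P, of "n - l" k] pos_le_iff[OF A.P, of "Suc k" "n - l"] by auto
      then show ?thesis using y by auto
    qed
    then show ?thesis using pos_Q_less[OF that, of y] 1[of "n - l"] that by auto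
  qed
  have "pos P lo \<le> pos P k" "pos P (Suc k) \<le> pos P hi"
    using k hi_n pos_le_iff[OF A.P] by auto
  then show ?thesis unfolding place_def using 1 2 y k by auto
qed

lemma Th_le_iff:
  assumes pl: "place y k k'" and "ok \<alpha> \<beta>"
  shows "Th y \<alpha> \<beta> \<le> z \<longleftrightarrow> 0 \<le> z \<and> rhoA k \<le> z - y \<and> \<alpha> \<le> A.A k (z - y) \<and>
    rhoB k' \<le> z - (X - y) \<and> \<beta> \<le> B.A k' (z - (X - y))"
proof -
  note p = pl[unfolded place_def] and o = \<open>ok \<alpha> \<beta>\<close>[unfolded ok]
  \<comment> \<open>The sink lies between the two variable vertices, so the prefix used on the left
    does not reach the variable vertex of the right side, and vice versa.\<close>
  have kA: "k \<le> n - iB" and kB: "k' \<le> n - iA" using p lohi by auto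
  have y: "0 \<le> y" "y \<le> X"
    using p X_ge[OF hi_n] pos_nonneg[of lo] lohi hi_n by auto
  have "Theta_L P y (sA \<alpha> \<beta>) \<le> z \<longleftrightarrow> 0 \<le> z \<and> rhoA k \<le> z - y \<and> \<alpha> \<le> A.A k (z - y)"
    by (rule A.Theta_L_le) (use p o y kA sA in auto)
  moreover have "Theta_L Q (X - y) (sB \<alpha> \<beta>) \<le> z \<longleftrightarrow>
      0 \<le> z \<and> rhoB k' \<le> z - (X - y) \<and> \<beta> \<le> B.A k' (z - (X - y))"
    by (rule B.Theta_L_le) (use p o y kB sB len_Q X_Q in auto)
  ultimately show ?thesis by (auto simp: Th_def)
qed

text \<open>A weight \<open>\<alpha> = 0\<close> in the regime \<open>0 < \<alpha>\<close> is a limit of admissible ones: move towards a point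
  with large \<open>z\<close>, where the full weights \<open>a\<close> and \<open>b\<close> are admissible.\<close>

lemma sound:
  assumes U: "upper_bound U" and pl: "place y k k'" and z: "0 \<le> z"
    and r: "rhoA k \<le> z - y" "rhoB k' \<le> z - (X - y)" and u: "u < T"
  shows "cf u + cq u * (A.A k (z - y) + B.A k' (z - (X - y))) - z \<le> U"
proof -
  note p = pl[unfolded place_def]
  have kn: "k \<le> n" "k' \<le> n" using p hi_n by auto
  obtain r0 where r0: "\<And>r. r \<ge> r0 \<Longrightarrow> A.A k r = a" using A.A_large[OF kn(1)] by blast
  obtain r1 where r1: "\<And>r. r \<ge> r1 \<Longrightarrow> B.A k' r = b" using B.A_large[of k'] kn len_Q by auto
  \<comment> \<open>Far enough for both minima to have reached their full values \<open>a\<close>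
    and \<open>b\<close>; every proper step towards \<open>Z\<close> makes the weights strictly
    positive where the regime demands it.\<close>
  define Z where "Z = max z (max (r0 + y) (r1 + (X - y)))"
  have Z: "A.A k (Z - y) = a" "B.A k' (Z - (X - y)) = b" "z \<le> Z"
    using r0[of "Z - y"] r1[of "Z - (X - y)"] by (auto simp: Z_def)
  obtain t where t: "t \<in> TT" "\<And>\<alpha> \<beta>. ok \<alpha> \<beta> \<Longrightarrow> g_time P t x (sA \<alpha> \<beta>) = cf u + cq u * (\<alpha> + \<beta>)"
    using lines[OF u] by blast
  define \<alpha> \<beta> where "\<alpha> = A.A k (z - y)" and "\<beta> = B.A k' (z - (X - y))"
  have \<alpha>: "0 \<le> \<alpha>" "\<alpha> \<le> a" using A.A_nonneg[OF kn(1) r(1)] A.A_le by (auto simp: \<alpha>_def)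
  have \<beta>: "0 \<le> \<beta>" "\<beta> \<le> b" using B.A_nonneg[OF _ r(2)] kn len_Q B.A_le by (auto simp: \<beta>_def)
  show ?thesis unfolding \<alpha>_def[symmetric] \<beta>_def[symmetric]
  proof (rule le_of_segment)
    fix s :: real assume s: "0 < s" "s < 1"
    define \<alpha>' \<beta>' z' where "\<alpha>' = (1 - s) * \<alpha> + s * a" and "\<beta>' = (1 - s) * \<beta> + s * b"
      and "z' = (1 - s) * z + s * Z"
    have zz: "z \<le> z'"
    proof -
      have "s * z \<le> s * Z" using s Z by (intro mult_left_mono) auto
      then show ?thesis by (simp add: z'_def algebra_simps)
    qed
    have b1: "(1 - s) * \<alpha> \<le> (1 - s) * a" "(1 - s) * \<beta> \<le> (1 - s) * b"
      using s \<alpha> \<beta> by (intro mult_left_mono; simp)+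
    have b2: "\<alpha>' \<le> a" "\<beta>' \<le> b" using b1 by (auto simp: \<alpha>'_def \<beta>'_def algebra_simps)
    have b3: "0 \<le> (1 - s) * \<alpha>" "0 \<le> (1 - s) * \<beta>" "0 \<le> s * a" "0 \<le> s * b"
      using s \<alpha> \<beta> A.a_nonneg B.a_nonneg by auto
    have "fA \<Longrightarrow> 0 < s * a" "fB \<Longrightarrow> 0 < s * b" using s A.fa B.fa by auto
    then have o: "ok \<alpha>' \<beta>'" unfolding ok using b2 b3 by (auto simp: \<alpha>'_def \<beta>'_def)
    have e1: "(1 - s) * (z - y) + s * (Z - y) = z' - y"
      and e2: "(1 - s) * (z - (X - y)) + s * (Z - (X - y)) = z' - (X - y)"
      by (simp_all add: z'_def algebra_simps)
    have "\<alpha>' \<le> A.A k (z' - y)"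
      using A.A_concave[of s k "z - y" "Z - y"] s unfolding \<alpha>'_def \<alpha>_def Z e1 by simp
    moreover have "\<beta>' \<le> B.A k' (z' - (X - y))"
      using B.A_concave[of s k' "z - (X - y)" "Z - (X - y)"] s
      unfolding \<beta>'_def \<beta>_def Z e2 by simp
    ultimately have "Th y \<alpha>' \<beta>' \<le> z'"
      unfolding Th_le_iff[OF pl o] using z r zz by auto
    moreover have "g_time P t x (sA \<alpha>' \<beta>') - Th y \<alpha>' \<beta>' \<le> U"
      using U t(1) o p unfolding upper_bound_def by blast
    ultimately have "cf u + cq u * (\<alpha>' + \<beta>') - z' \<le> U" using t(2)[OF o] by simp
    then show "cf u + cq u * (\<alpha> + \<beta>) - z +
        s * (cq u * (a + b) - cq u * (\<alpha> + \<beta>) - Z + z) \<le> U"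
      by (simp add: \<alpha>'_def \<beta>'_def z'_def algebra_simps)
  qed
qed

text \<open>At a vertex y is fixed, so both sides become functions of z. Their sum is piecewise
  affine with the union of the two translated breakpoint sets, clipped at the least admissible
  z.\<close>

lemma vertex_coveredI:
  assumes k: "k \<le> n" and u: "u < T"
    and pA: "\<And>p. p < np \<Longrightarrow> let z = max (RA p + pos P k) (\<zeta> k) in
      cf u + cq u * (A.A k (z - pos P k) + B.A (n - k) (z - (X - pos P k))) - z \<le> out"
    and pB: "\<And>p. p < np \<Longrightarrow> let z = max (RB p + (X - pos P k)) (\<zeta> k) in
      cf u + cq u * (A.A k (z - pos P k) + B.A (n - k) (z - (X - pos P k))) - z \<le> out"
  shows "vertex_covered k u out"
  unfolding vertex_covered_def
proof (intro allI impI)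
  fix z assume z: "\<zeta> k \<le> z"
  define \<Phi> where "\<Phi> z = A.A k (z - pos P k) + B.A (n - k) (z - (X - pos P k))" for z
  let ?SA = "(\<lambda>s. s + pos P k) ` (RA ` {..<np})" and ?SB = "(\<lambda>s. s + (X - pos P k)) ` (RB ` {..<np})"
  have nk: "n - k \<le> len Q" by (simp add: len_Q)
  have 1: "piecewise_affine (\<zeta> k) ?SA (\<lambda>z. A.A k (z - pos P k))"
    by (rule piecewise_affine_weaken[OF piecewise_affine_shift[OF A.A_piecewise_affine[OF k]]])
      (use X_ge[OF k] in \<open>simp add: \<zeta>_def\<close>)
  have 2: "piecewise_affine (\<zeta> k) ?SB (\<lambda>z. B.A (n - k) (z - (X - pos P k)))"
    by (rule piecewise_affine_weaken[OF piecewise_affine_shift[OF B.A_piecewise_affine[OF nk]]])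
      (use pos_nonneg[OF k] X_Q in \<open>simp add: \<zeta>_def len_Q\<close>)
  have pa: "piecewise_affine (\<zeta> k) (?SA \<union> ?SB) \<Phi>"
    unfolding \<Phi>_def by (rule piecewise_affine_add[OF 1 2])
  have mono: "\<Phi> r \<le> \<Phi> r'" if "r \<le> r'" for r r'
    unfolding \<Phi>_def using that A.A_mono[OF k] B.A_mono[OF nk] by (intro add_mono) auto
  have bd: "\<Phi> r \<le> a + b" for r unfolding \<Phi>_def by (intro add_mono A.A_le B.A_le)
  obtain s where s: "s \<in> insert (\<zeta> k) (?SA \<union> ?SB)" "\<zeta> k \<le> s"
      "cq u * \<Phi> z - 1 * z \<le> cq u * \<Phi> s - 1 * s"
    using piecewise_affine_optimum[OF pa _ mono bd z cq[OF u], of 1] by auto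
  \<comment> \<open>The end point \<open>\<zeta> k\<close> itself is among the candidates:
    breakpoint 0 translates to a number at most 0 and is clipped.\<close>
  have 0: "\<zeta> k = max (RA 0 + pos P k) (\<zeta> k)"
    using A.R_0 X_ge[OF k] by (auto simp: \<zeta>_def)
  have "cf u + cq u * \<Phi> s - s \<le> out"
  proof -
    consider p where "p < np" "s = max (RA p + pos P k) (\<zeta> k)"
      | p where "p < np" "s = max (RB p + (X - pos P k)) (\<zeta> k)"
    proof -
      from s(1) consider "s = \<zeta> k" | p where "p < np" "s = RA p + pos P k"
        | p where "p < np" "s = RB p + (X - pos P k)" by auto
      then show ?thesis
      proof cases
        case 1
        then show ?thesis using that(1)[of 0] 0 A.np by simp
      next
        case (2 p)
        then show ?thesis using that(1)[of p] s(2) by (simp add: max_def)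
      next
        case (3 p)
        then show ?thesis using that(2)[of p] s(2) by (simp add: max_def)
      qed
    qed
    then show ?thesis using pA pB unfolding \<Phi>_def Let_def by cases auto
  qed
  then show "cf u + cq u * (A.A k (z - pos P k) + B.A (n - k) (z - (X - pos P k))) - z \<le> out"
    using s(3) unfolding \<Phi>_def by simp
qed

lemma vertex_coveredD:
  assumes "vertex_covered k u out" "k \<le> n" "0 \<le> z" "rhoA k \<le> z - pos P k" "rhoB (n - k) \<le> z - (X - pos P k)"
  shows "cf u + cq u * (A.A k (z - pos P k) + B.A (n - k) (z - (X - pos P k))) - z \<le> out"
  using assms unfolding vertex_covered_def \<zeta>_def by simp

text \<open>With z = (r + l + X)/2 and y = (l + X - r)/2 the coordinates \<open>r\<close> and
  \<open>l\<close> can be optimised independently. If the resulting y lies in the edge, it is a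
  candidate. Otherwise the segment from the given pair to the optimal one meets an end of the edge;
  by concavity the value has not dropped there, and the vertex at that end has been covered. At the
  crossing \<open>0 \<le> z\<close> is also required, which is why the case without active vertices
  is treated apart.\<close>

lemma edge_coveredI:
  assumes k: "lo \<le> k" "k < hi" and u: "u < T"
    and r: "rhoA (Suc k) \<le> r" "\<And>r'. rhoA (Suc k) \<le> r' \<Longrightarrow>
      cq u * A.A (Suc k) r' - r' / 2 \<le> cq u * A.A (Suc k) r - r / 2"
    and l: "rhoB (n - k) \<le> l" "\<And>r'. rhoB (n - k) \<le> r' \<Longrightarrow>
      cq u * B.A (n - k) r' - r' / 2 \<le> cq u * B.A (n - k) l - l / 2"
    and cand: "2 * pos P k < l + X - r \<Longrightarrow> l + X - r < 2 * pos P (Suc k) \<Longrightarrow> 0 \<le> r + l + X \<Longrightarrow>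
      cf u + cq u * (A.A (Suc k) r + B.A (n - k) l) - (r + l + X) / 2 \<le> out"
    and v: "vertex_covered k u out" "vertex_covered (Suc k) u out"
  shows "edge_covered k u out"
  unfolding edge_covered_def
proof (intro allI impI)
  fix y z assume y: "pos P k < y" "y < pos P (Suc k)" and z: "0 \<le> z"
    and rz: "rhoA (Suc k) \<le> z - y" and lz: "rhoB (n - k) \<le> z - (X - y)"
  have kn: "Suc k \<le> n" "k \<le> n" using k hi_n by auto
  have nk: "n - k \<le> len Q" "n - Suc k \<le> n - k" by (auto simp: len_Q)
  let ?val = "\<lambda>r l. cf u + cq u * (A.A (Suc k) r + B.A (n - k) l) - (r + l + X) / 2"
  have le: "?val (z - y) (z - (X - y)) \<le> ?val r l"
  proof -
    have "c + (a1 + b1) - (p + q + X) / 2 \<le> c + (a2 + b2) - (p' + q' + X) / 2"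
      if "a1 - p / 2 \<le> a2 - p' / 2" "b1 - q / 2 \<le> b2 - q' / 2" for a1 a2 b1 b2 p p' q q' c :: real
      using that by (simp add: field_simps)
    from this[OF r(2)[OF rz] l(2)[OF lz]] show ?thesis unfolding distrib_left .
  qed
  have goal: "?val (z - y) (z - (X - y)) \<le> out"
  proof (cases "(\<exists>l\<le>k. actA l) \<or> (\<exists>l<n - k. actB l)")
    case True
    \<comment> \<open>An active vertex lies on its side of every sink of the closed edge, so
      \<open>active_imp_ge\<close> bounds z from below by a distance.\<close>
    have zpos: "0 \<le> z'" if "pos P k \<le> y'" "y' \<le> pos P (Suc k)" "rhoA (Suc k) \<le> z' - y'"
      "rhoB (n - k) \<le> z' - (X - y')" for y' z'
      using True
    proof
      assume "\<exists>l\<le>k. actA l"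
      then obtain l where l: "l \<le> k" "actA l" by blast
      have "- pos P l \<le> z' - y'" by (rule A.active_imp_ge[OF kn(1) that(3)]) (use l in auto)
      moreover have "pos P l \<le> pos P k" using pos_le_iff[OF A.P] l kn by simp
      ultimately show ?thesis using that by linarith
    next
      assume "\<exists>l<n - k. actB l"
      then obtain l where l: "l < n - k" "actB l" by blast
      have "- pos Q l \<le> z' - (X - y')" by (rule B.active_imp_ge[OF nk(1) that(4)]) (use l in auto)
      moreover have "pos P (Suc k) \<le> pos P (n - l)" using pos_le_iff[OF A.P] l kn by auto
      ultimately show ?thesis using that pos_Q[of l] l by auto
    qed
    \<comment> \<open>The position described by the two separate optima, possibly outside the edge.
      The functions below parametrise the segment towards it.\<close>
    define y1 where "y1 = (l + X - r) / 2"
    define Y where "Y s = (1 - s) * y + s * y1" for s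
    define r1 where "r1 s = (1 - s) * (z - y) + s * r" for s
    define l1 where "l1 s = (1 - s) * (z - (X - y)) + s * l" for s
    define z1 where "z1 s = (r1 s + l1 s + X) / 2" for s
    have zr: "z1 s - Y s = r1 s" "z1 s - (X - Y s) = l1 s" for s
      unfolding z1_def Y_def r1_def l1_def y1_def by (simp_all add: field_simps)
    have seg: "?val (z - y) (z - (X - y)) \<le> ?val (r1 s) (l1 s) \<and> rhoA (Suc k) \<le> r1 s \<and> rhoB (n - k) \<le> l1 s"
      if s: "0 \<le> s" "s \<le> 1" for s
    proof -
      have "(1 - s) * A.A (Suc k) (z - y) + s * A.A (Suc k) r \<le> A.A (Suc k) (r1 s)"
        unfolding r1_def by (rule A.A_concave[OF s])
      moreover have "(1 - s) * B.A (n - k) (z - (X - y)) + s * B.A (n - k) l \<le> B.A (n - k) (l1 s)"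
        unfolding l1_def by (rule B.A_concave[OF s])
      ultimately have "cq u * (((1 - s) * A.A (Suc k) (z - y) + s * A.A (Suc k) r) +
          ((1 - s) * B.A (n - k) (z - (X - y)) + s * B.A (n - k) l))
          \<le> cq u * (A.A (Suc k) (r1 s) + B.A (n - k) (l1 s))"
        by (intro mult_left_mono add_mono cq[OF u])
      then have "(1 - s) * ?val (z - y) (z - (X - y)) + s * ?val r l \<le> ?val (r1 s) (l1 s)"
        by (simp add: r1_def l1_def field_simps)
      moreover have "s * ?val (z - y) (z - (X - y)) \<le> s * ?val r l"
        using le s by (intro mult_left_mono) auto
      moreover have "(1 - s) * ?val (z - y) (z - (X - y)) + s * ?val (z - y) (z - (X - y))
          = ?val (z - y) (z - (X - y))" by (simp add: algebra_simps)
      ultimately have "?val (z - y) (z - (X - y)) \<le> ?val (r1 s) (l1 s)" by linarith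
      moreover have "(1 - s) * rhoA (Suc k) \<le> (1 - s) * (z - y)" "s * rhoA (Suc k) \<le> s * r"
        "(1 - s) * rhoB (n - k) \<le> (1 - s) * (z - (X - y))" "s * rhoB (n - k) \<le> s * l"
        using s rz lz r l by (intro mult_left_mono; simp)+
      ultimately show ?thesis by (auto simp: r1_def l1_def algebra_simps)
    qed
    have fin: ?thesis if s: "0 \<le> s" "s \<le> 1" and j: "Y s = pos P j" "j = k \<or> j = Suc k" for s j
    proof -
      note sg = seg[OF s]
      have jj: "pos P k \<le> pos P j" "pos P j \<le> pos P (Suc k)" "j \<le> n" "j \<le> Suc k" "n - j \<le> n - k"
        using j(2) kn y by auto
      have zj: "0 \<le> z1 s"
        by (rule zpos[of "Y s"]) (use jj j sg zr[of s] in auto)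
      have "rhoA j \<le> rhoA (Suc k)" "rhoB (n - j) \<le> rhoB (n - k)"
        using jj kn nk by (auto intro: A.rho_mono B.rho_mono)
      then have "cf u + cq u * (A.A j (z1 s - pos P j) + B.A (n - j) (z1 s - (X - pos P j))) - z1 s \<le> out"
        using v j(2) jj zj sg zr[of s, unfolded j(1)] by (intro vertex_coveredD) auto
      then have "cf u + cq u * (A.A j (r1 s) + B.A (n - j) (l1 s)) - z1 s \<le> out"
        using zr[of s, unfolded j(1)] by simp
      \<comment> \<open>A sink at an end of the edge has no more vertices on either side than one
        inside, so passing to the vertex only drops lines from the minima.\<close>
      moreover have "cq u * (A.A (Suc k) (r1 s) + B.A (n - k) (l1 s)) \<le> cq u * (A.A j (r1 s) + B.A (n - j) (l1 s))"
        by (intro mult_left_mono add_mono A.A_antimono B.A_antimono cq[OF u]) (use jj in auto)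
      ultimately show ?thesis using sg by (simp add: z1_def)
    qed
    consider "y1 \<le> pos P k" | "pos P (Suc k) \<le> y1" | "pos P k < y1" "y1 < pos P (Suc k)" by linarith
    then show ?thesis
    proof cases
      case 1
      \<comment> \<open>The parameter at which the segment passes the left end of the edge.\<close>
      let ?s = "(y - pos P k) / (y - y1)"
      have *: "?s * (y - y1) = y - pos P k" using 1 y by simp
      have "Y s = y - s * (y - y1)" for s by (simp add: Y_def algebra_simps)
      from this[of ?s] have "Y ?s = pos P k" unfolding * by simp
      then show ?thesis by (intro fin[of ?s k]) (use 1 y in \<open>auto simp: divide_le_eq_1\<close>)
    next
      case 2
      let ?s = "(pos P (Suc k) - y) / (y1 - y)"
      have *: "?s * (y1 - y) = pos P (Suc k) - y" using 2 y by simp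
      have "Y s = y + s * (y1 - y)" for s by (simp add: Y_def algebra_simps)
      from this[of ?s] have "Y ?s = pos P (Suc k)" unfolding * by simp
      then show ?thesis by (intro fin[of ?s "Suc k"]) (use 2 y in \<open>auto simp: divide_le_eq_1\<close>)
    next
      case 3
      have "0 \<le> (r + l + X) / 2"
        by (rule zpos[of y1]) (use 3 r(1) l(1) in \<open>auto simp: y1_def field_simps\<close>)
      then have "?val r l \<le> out" using 3 by (intro cand) (auto simp: y1_def)
      then show ?thesis using le by simp
    qed
  next
    case False
    \<comment> \<open>In a regime with a positive variable weight its vertex would be active. So
      both weights are fixed at 0, and vertex \<open>k\<close> with z = 0 already achieves the
      intercept \<open>cf u\<close>, which nothing in the edge can exceed.\<close>
    have "iA \<le> k" "iB < n - k" using k lohi by auto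
    then have "\<not> fA" "\<not> fB" using False A.act_iff[of k] B.act_iff[of iB] by blast+
    then have ab: "a = 0" "b = 0" using A.fa B.fa by auto
    have rA: "rhoA k \<le> 0 - pos P k"
      unfolding A.rho[OF kn(2)] using False X_ge[OF kn(2)] by auto
    have rB: "rhoB (n - k) \<le> 0 - (X - pos P k)"
      unfolding B.rho[OF nk(1)] using False pos_nonneg[OF kn(2)] X_Q by (auto simp: len_Q)
    have "A.A k (0 - pos P k) = 0" "B.A (n - k) (0 - (X - pos P k)) = 0"
      using A.A_nonneg[OF kn(2) rA] B.A_nonneg[OF nk(1) rB] A.A_le B.A_le ab by (auto intro: antisym)
    then have "cf u \<le> out"
      using vertex_coveredD[OF v(1) kn(2) _ rA rB] by simp
    moreover have "cq u * (A.A (Suc k) (z - y) + B.A (n - k) (z - (X - y))) \<le> 0"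
      using A.A_le[of "Suc k" "z - y"] B.A_le[of "n - k" "z - (X - y)"] ab cq[OF u]
      by (intro mult_nonneg_nonpos) auto
    ultimately show ?thesis using z by simp
  qed
  then show "cf u + cq u * (A.A (Suc k) (z - y) + B.A (n - k) (z - (X - y))) - z \<le> out" by simp
qed

text \<open>For given weights and sink, take z to be the evacuation time itself. The weights then
  lie below the two minima, and as the slopes are nonnegative, replacing the weights by the minima
  only raises the value.\<close>

lemma complete:
  assumes v: "\<And>k u. lo \<le> k \<Longrightarrow> k \<le> hi \<Longrightarrow> u < T \<Longrightarrow> vertex_covered k u out"
    and e: "\<And>k u. lo \<le> k \<Longrightarrow> k < hi \<Longrightarrow> u < T \<Longrightarrow> edge_covered k u out"
  shows "upper_bound out"
  unfolding upper_bound_def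
proof (intro allI ballI impI)
  fix \<alpha> \<beta> y t assume t: "t \<in> TT" and o: "ok \<alpha> \<beta>" and y: "pos P lo \<le> y" "y \<le> pos P hi"
  obtain u where u: "u < T" "g_time P t x (sA \<alpha> \<beta>) = cf u + cq u * (\<alpha> + \<beta>)"
    using lines'[OF t] o by blast
  define z where "z = Th y \<alpha> \<beta>"
  \<comment> \<open>The last vertex in the range of sinks that is not to the right of
    \<open>y\<close>; the sink is this vertex or lies inside the edge that starts there.\<close>
  define k where "k = Max {k. k \<le> hi \<and> pos P k \<le> y}"
  have fin: "finite {k. k \<le> hi \<and> pos P k \<le> y}" by simp
  have "lo \<in> {k. k \<le> hi \<and> pos P k \<le> y}" using lohi y by simp
  then have k: "lo \<le> k" "k \<le> hi" "pos P k \<le> y"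
    using Max_ge[OF fin, of lo] Max_in[OF fin] unfolding k_def by blast+
  have next_k: "y < pos P (Suc k)" if "Suc k \<le> hi"
  proof (rule ccontr)
    assume "\<not> y < pos P (Suc k)"
    then have "Suc k \<le> k" unfolding k_def by (intro Max_ge[OF fin]) (use that k_def in simp)
    then show False by simp
  qed
  show "g_time P t x (sA \<alpha> \<beta>) - Th y \<alpha> \<beta> \<le> out"
  proof (cases "pos P k = y")
    case True
    have pl: "place y k (n - k)" using place_vertex[OF k(1,2)] True by simp
    have f: "0 \<le> z" "rhoA k \<le> z - y" "\<alpha> \<le> A.A k (z - y)" "rhoB (n - k) \<le> z - (X - y)"
      "\<beta> \<le> B.A (n - k) (z - (X - y))"
      using Th_le_iff[OF pl o, of z] by (auto simp: z_def)
    have "cf u + cq u * (A.A k (z - y) + B.A (n - k) (z - (X - y))) - z \<le> out"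
      using vertex_coveredD[OF v[OF k(1,2) u(1)], of z] f k hi_n True by simp
    moreover have "cq u * (\<alpha> + \<beta>) \<le> cq u * (A.A k (z - y) + B.A (n - k) (z - (X - y)))"
      using f cq[OF u(1)] by (intro mult_left_mono) auto
    ultimately show ?thesis using u by (simp add: z_def)
  next
    case False
    then have ky: "pos P k < y" using k by simp
    have kh: "k < hi" using k y ky by (cases "k = hi") auto
    have ky': "y < pos P (Suc k)" using next_k kh by simp
    have pl: "place y (Suc k) (n - k)" using place_edge[OF k(1) kh ky ky'] .
    have f: "0 \<le> z" "rhoA (Suc k) \<le> z - y" "\<alpha> \<le> A.A (Suc k) (z - y)" "rhoB (n - k) \<le> z - (X - y)"
      "\<beta> \<le> B.A (n - k) (z - (X - y))"
      using Th_le_iff[OF pl o, of z] by (auto simp: z_def)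
    have "cf u + cq u * (A.A (Suc k) (z - y) + B.A (n - k) (z - (X - y))) - z \<le> out"
      using e[OF k(1) kh u(1)] f ky ky' unfolding edge_covered_def by blast
    moreover have "cq u * (\<alpha> + \<beta>) \<le> cq u * (A.A (Suc k) (z - y) + B.A (n - k) (z - (X - y)))"
      using f cq[OF u(1)] by (intro mult_left_mono) auto
    ultimately show ?thesis using u by (simp add: z_def)
  qed
qed

end

section \<open>Prefix sums, lines and lower bounds of one side\<close>

section \<open>Programs for the tables of one side\<close>

abbreviation nv :: "string \<Rightarrow> nexp" where "nv a \<equiv> NRead a (NConst 0)"
abbreviation rv :: "string \<Rightarrow> rexp" where "rv a \<equiv> RRead a (NConst 0)"
abbreviation nsuc :: "nexp \<Rightarrow> nexp" where "nsuc e \<equiv> NPlus e (NConst 1)"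
abbreviation BOr :: "bexp \<Rightarrow> bexp \<Rightarrow> bexp" where "BOr p q \<equiv> BNot (BAnd (BNot p) (BNot q))"
abbreviation PWhen :: "bexp \<Rightarrow> prog \<Rightarrow> prog" where "PWhen b p \<equiv> PIf b p PSkip"

text \<open>Arrays that exist for each side carry a tag \<open>g\<close>. Their names start with a capital letter and
  all other names do not: \<open>X\<close> positions, \<open>C\<close> capacities, \<open>W\<close> weights and \<open>V\<close> their prefix sums,
  \<open>H\<close> and \<open>A\<close> the width of the variable weight (\<open>A\<close> in the current regime), \<open>I\<close> its vertex, \<open>F\<close> the regime,
  \<open>M\<close> and \<open>B\<close> slopes and intercepts of the lines, \<open>Q\<close> the bounds \<open>\<rho>\<close>, \<open>P\<close> and \<open>R\<close> the unsorted and sorted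
  breakpoints, \<open>L\<close> the table of minimal lines, \<open>Z\<close> and \<open>Y\<close> optimal points and their values.\<close>

definition prefix_prog :: "string \<Rightarrow> prog" where
  "prefix_prog g = PR (CHR ''V'' # g) (NConst 0) (RRead (CHR ''W'' # g) (NConst 0)) ;;
     PFor ''k'' ''n'' (PR (CHR ''V'' # g) (nsuc (nv ''k''))
       (RPlus (RRead (CHR ''V'' # g) (nv ''k'')) (RRead (CHR ''W'' # g) (nsuc (nv ''k'')))))"

definition act_exp :: "string \<Rightarrow> bexp" where
  "act_exp g = BOr (RLess (RConst 0) (RRead (CHR ''V'' # g) (nv ''l'')))
     (BAnd (NLess (NConst 0) (nv (CHR ''F'' # g))) (BNot (NLess (nv ''l'') (nv (CHR ''I'' # g)))))"

definition line_exp :: "string \<Rightarrow> rexp" where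
  "line_exp g = RMinus (RTimes (RRead (CHR ''C'' # g) (nv ''k'')) (RRead (CHR ''X'' # g) (nv ''l'')))
     (RRead (CHR ''V'' # g) (nv ''l''))"

text \<open>Slope 0 doubles as the mark that no relevant vertex has been met, since a genuine line
  has a positive capacity as its slope. The inner loop runs over all vertices under the guard l
  \<le> k: a bound varying with \<open>k\<close> would be written by the program, which the time
  estimate excludes.\<close>

definition lines_prog :: "string \<Rightarrow> prog" where
  "lines_prog g =
     PR (CHR ''M'' # g) (NConst 0) (RConst 0) ;; PR (CHR ''B'' # g) (NConst 0) (rv (CHR ''A'' # g)) ;;
     PFor ''k'' ''n''
       (PR (CHR ''M'' # g) (nsuc (nv ''k'')) (RConst 0) ;;
        PR (CHR ''B'' # g) (nsuc (nv ''k'')) (rv (CHR ''A'' # g)) ;;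
        PFor ''l'' ''n''
          (PWhen (BAnd (BAnd (NLess (nv ''l'') (nsuc (nv ''k''))) (BNot (NLess (nv ''l'') (nv (CHR ''I'' # g)))))
             (BAnd (act_exp g)
               (BOr (BNot (RLess (RConst 0) (RRead (CHR ''M'' # g) (nsuc (nv ''k'')))))
                    (RLess (line_exp g) (RRead (CHR ''B'' # g) (nsuc (nv ''k'')))))))
             (PR (CHR ''M'' # g) (nsuc (nv ''k'')) (RRead (CHR ''C'' # g) (nv ''k'')) ;;
              PR (CHR ''B'' # g) (nsuc (nv ''k'')) (line_exp g))))"

definition rho_exp :: "string \<Rightarrow> rexp" where
  "rho_exp g = RMinus (RDivide (RRead (CHR ''V'' # g) (nv ''l'')) (RRead (CHR ''C'' # g) (nv ''k'')))
     (RRead (CHR ''X'' # g) (nv ''l''))"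

definition rho_prog :: "string \<Rightarrow> prog" where
  "rho_prog g =
     PR (CHR ''Q'' # g) (NConst 0) (RMinus (RConst 0) (RRead (CHR ''X'' # g) (nv ''n''))) ;;
     PFor ''k'' ''n''
       (PR (CHR ''Q'' # g) (nsuc (nv ''k'')) (RRead (CHR ''Q'' # g) (nv ''k'')) ;;
        PFor ''l'' ''n''
          (PWhen (BAnd (BAnd (NLess (nv ''l'') (nsuc (nv ''k''))) (act_exp g))
               (RLess (RRead (CHR ''Q'' # g) (nsuc (nv ''k''))) (rho_exp g)))
             (PR (CHR ''Q'' # g) (nsuc (nv ''k'')) (rho_exp g))))"

lemma wr_prefix [simp]: "wrN (prefix_prog g) = {''k''}" "wrR (prefix_prog g) = {CHR ''V'' # g}"
  by (auto simp: prefix_prog_def)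

lemma wr_lines [simp]: "wrN (lines_prog g) = {''k'', ''l''}"
  "wrR (lines_prog g) = {CHR ''M'' # g, CHR ''B'' # g}"
  by (auto simp: lines_prog_def)

lemma wr_rho [simp]: "wrN (rho_prog g) = {''k'', ''l''}" "wrR (rho_prog g) = {CHR ''Q'' # g}"
  by (auto simp: rho_prog_def)

lemma prefix_prog:
  assumes "l \<le> fst m ''n'' 0"
  shows "snd (sem (prefix_prog g) m) (CHR ''V'' # g) l = wsum (snd m (CHR ''W'' # g)) 0 l"
proof -
  define m1 where "m1 = sem (PR (CHR ''V'' # g) (NConst 0) (RRead (CHR ''W'' # g) (NConst 0))) m"
  let ?p = "PR (CHR ''V'' # g) (nsuc (nv ''k''))
       (RPlus (RRead (CHR ''V'' # g) (nv ''k'')) (RRead (CHR ''W'' # g) (nsuc (nv ''k''))))"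
  let ?I = "\<lambda>k m'. \<forall>l\<le>k. snd m' (CHR ''V'' # g) l = wsum (snd m (CHR ''W'' # g)) 0 l"
  have "?I (fst m1 ''n'' 0) (sem (PFor ''k'' ''n'' ?p) m1)"
  proof (rule For_rule[where I="?I"])
    fix k and m' :: store
    assume k: "fst m' ''k'' 0 = k" and R: "\<And>a. a \<notin> wrR ?p \<Longrightarrow> snd m' a = snd m1 a" and I: "?I k m'"
    have "snd m' (CHR ''W'' # g) = snd m (CHR ''W'' # g)" using R[of "CHR ''W'' # g"] by (simp add: m1_def)
    then show "?I (Suc k) (nupd (sem ?p m') ''k'' 0 (Suc k))"
      using I k by (auto simp: le_Suc_eq wsum_def)
  qed (auto simp: m1_def wsum_def)
  then show ?thesis using assms by (simp add: prefix_prog_def m1_def)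
qed

text \<open>The intercept is a running minimum. It is described by the numbers below it, a form in
  which adding one more vertex just adds one more condition.\<close>

lemma lines_inner:
  fixes m :: store and g :: string
  defines "c \<equiv> snd m (CHR ''C'' # g)" and "x \<equiv> snd m (CHR ''X'' # g)" and "v \<equiv> snd m (CHR ''V'' # g)"
    and "i \<equiv> fst m (CHR ''I'' # g) 0" and "f \<equiv> 0 < fst m (CHR ''F'' # g) 0"
    and "k \<equiv> fst m ''k'' 0"
  defines "p \<equiv> PWhen (BAnd (BAnd (NLess (nv ''l'') (nsuc (nv ''k''))) (BNot (NLess (nv ''l'') (nv (CHR ''I'' # g)))))
             (BAnd (act_exp g)
               (BOr (BNot (RLess (RConst 0) (RRead (CHR ''M'' # g) (nsuc (nv ''k'')))))
                    (RLess (line_exp g) (RRead (CHR ''B'' # g) (nsuc (nv ''k'')))))))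
             (PR (CHR ''M'' # g) (nsuc (nv ''k'')) (RRead (CHR ''C'' # g) (nv ''k'')) ;;
              PR (CHR ''B'' # g) (nsuc (nv ''k'')) (line_exp g))"
  defines "m2 \<equiv> sem (PFor ''l'' ''n'' p) m"
  assumes c: "0 < c k" and kn: "k < fst m ''n'' 0"
    and M: "snd m (CHR ''M'' # g) (Suc k) = 0" "snd m (CHR ''B'' # g) (Suc k) = a"
  shows "snd m2 (CHR ''M'' # g) (Suc k) = 0 \<and> snd m2 (CHR ''B'' # g) (Suc k) = a \<and>
       (\<forall>l\<le>k. i \<le> l \<longrightarrow> \<not> (0 < v l \<or> f \<and> i \<le> l)) \<or>
     snd m2 (CHR ''M'' # g) (Suc k) = c k \<and> (\<forall>\<beta>. \<beta> \<le> snd m2 (CHR ''B'' # g) (Suc k) \<longleftrightarrow>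
        (\<forall>l\<le>k. i \<le> l \<and> (0 < v l \<or> f \<and> i \<le> l) \<longrightarrow> \<beta> \<le> c k * x l - v l))" (is ?G1)
   and "\<forall>e. e \<noteq> Suc k \<longrightarrow> snd m2 (CHR ''M'' # g) e = snd m (CHR ''M'' # g) e \<and>
        snd m2 (CHR ''B'' # g) e = snd m (CHR ''B'' # g) e" (is ?G2)
proof -
  define rel where "rel l \<longleftrightarrow> l \<le> k \<and> i \<le> l \<and> (0 < v l \<or> f \<and> i \<le> l)" for l
  let ?I = "\<lambda>j m'. (snd m' (CHR ''M'' # g) (Suc k) = 0 \<and> snd m' (CHR ''B'' # g) (Suc k) = a \<and>
         (\<forall>l<j. \<not> rel l) \<or>
       snd m' (CHR ''M'' # g) (Suc k) = c k \<and> (\<forall>\<beta>. \<beta> \<le> snd m' (CHR ''B'' # g) (Suc k) \<longleftrightarrow>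
         (\<forall>l<j. rel l \<longrightarrow> \<beta> \<le> c k * x l - v l))) \<and>
     (\<forall>e. e \<noteq> Suc k \<longrightarrow> snd m' (CHR ''M'' # g) e = snd m (CHR ''M'' # g) e \<and>
        snd m' (CHR ''B'' # g) e = snd m (CHR ''B'' # g) e)"
  have "?I (fst m ''n'' 0) (sem (PFor ''l'' ''n'' p) m)"
  proof (rule For_rule[where I="?I"])
    fix j and m' :: store
    assume l: "fst m' ''l'' 0 = j" and N: "\<And>a. a \<notin> insert ''l'' (wrN p) \<Longrightarrow> fst m' a = fst m a"
      and R: "\<And>a. a \<notin> wrR p \<Longrightarrow> snd m' a = snd m a" and I: "?I j m'"
    have [simp]: "fst m' ''l'' 0 = j" "fst m' ''k'' = fst m ''k''" "fst m' (CHR ''I'' # g) = fst m (CHR ''I'' # g)"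
      "fst m' (CHR ''F'' # g) = fst m (CHR ''F'' # g)"
      using l N by (auto simp: p_def)
    have [simp]: "snd m' (CHR ''C'' # g) = c" "snd m' (CHR ''X'' # g) = x" "snd m' (CHR ''V'' # g) = v"
      using R by (auto simp: p_def c_def x_def v_def)
    define cond where "cond \<longleftrightarrow> rel j \<and> (\<not> 0 < snd m' (CHR ''M'' # g) (Suc k) \<or>
       c k * x j - v j < snd m' (CHR ''B'' # g) (Suc k))"
    have sem: "sem p m' = (if cond then rupd (rupd m' (CHR ''M'' # g) (Suc k) (c k))
        (CHR ''B'' # g) (Suc k) (c k * x j - v j) else m')"
      by (auto simp: p_def cond_def rel_def act_exp_def line_exp_def k_def[symmetric] i_def f_def)
    show "?I (Suc j) (nupd (sem p m') ''l'' 0 (Suc j))"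
    proof (cases cond)
      case True
      then have rj: "rel j" by (simp add: cond_def)
      have "\<beta> \<le> c k * x j - v j \<longleftrightarrow> (\<forall>l<Suc j. rel l \<longrightarrow> \<beta> \<le> c k * x l - v l)" for \<beta>
      proof (cases "0 < snd m' (CHR ''M'' # g) (Suc k)")
        case T: True
        then have "c k * x j - v j < snd m' (CHR ''B'' # g) (Suc k)" using True cond_def by simp
        moreover have "\<beta> \<le> snd m' (CHR ''B'' # g) (Suc k) \<longleftrightarrow> (\<forall>l<j. rel l \<longrightarrow> \<beta> \<le> c k * x l - v l)"
          using I T by auto
        ultimately show ?thesis using rj by (auto simp: less_Suc_eq)
      next
        case False
        then have "\<forall>l<j. \<not> rel l" using I c by auto
        then show ?thesis using rj by (auto simp: less_Suc_eq)
      qed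
      then show ?thesis using I True unfolding sem by simp
    next
      case False
      show ?thesis
      proof (cases "rel j")
        case True
        then have c1: "0 < snd m' (CHR ''M'' # g) (Suc k)" "snd m' (CHR ''B'' # g) (Suc k) \<le> c k * x j - v j"
          using False by (auto simp: cond_def)
        then have I': "snd m' (CHR ''M'' # g) (Suc k) = c k"
          "\<And>\<beta>. \<beta> \<le> snd m' (CHR ''B'' # g) (Suc k) \<longleftrightarrow> (\<forall>l<j. rel l \<longrightarrow> \<beta> \<le> c k * x l - v l)"
          using I by auto
        have "\<beta> \<le> snd m' (CHR ''B'' # g) (Suc k) \<longleftrightarrow> (\<forall>l<Suc j. rel l \<longrightarrow> \<beta> \<le> c k * x l - v l)" for \<beta>
          using I'(2)[of \<beta>] c1 by (auto simp: less_Suc_eq)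
        then show ?thesis using I I'(1) False unfolding sem by simp
      next
        case nr: False
        then show ?thesis using I False unfolding sem by (simp add: less_Suc_eq)
      qed
    qed
  qed (use M in \<open>auto simp: p_def\<close>)
  then have *: "?I (fst m ''n'' 0) m2" unfolding m2_def .
  \<comment> \<open>The guard is part of \<open>rel\<close>, so running to \<open>n\<close> amounts
    to running up to \<open>k\<close>.\<close>
  have "(\<forall>l<fst m ''n'' 0. rel l \<longrightarrow> Pr l) \<longleftrightarrow> (\<forall>l\<le>k. i \<le> l \<and> (0 < v l \<or> f \<and> i \<le> l) \<longrightarrow> Pr l)" for Pr
    using kn unfolding rel_def by (meson le_less_trans)
  note eq = this this[of "\<lambda>_. False", simplified]
  show ?G1 using *[THEN conjunct1] unfolding eq by blast
  show ?G2 using * by blast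
qed

lemma lines_prog:
  fixes m :: store and g :: string
  defines "c \<equiv> snd m (CHR ''C'' # g)" and "x \<equiv> snd m (CHR ''X'' # g)" and "v \<equiv> snd m (CHR ''V'' # g)"
    and "i \<equiv> fst m (CHR ''I'' # g) 0" and "f \<equiv> 0 < fst m (CHR ''F'' # g) 0" and "a \<equiv> snd m (CHR ''A'' # g) 0"
  defines "m' \<equiv> sem (lines_prog g) m"
  assumes c: "\<And>e. e < fst m ''n'' 0 \<Longrightarrow> 0 < c e"
  shows "snd m' (CHR ''M'' # g) 0 = 0" "snd m' (CHR ''B'' # g) 0 = a"
    and "e < fst m ''n'' 0 \<Longrightarrow>
       snd m' (CHR ''M'' # g) (Suc e) = 0 \<and> snd m' (CHR ''B'' # g) (Suc e) = a \<and>
       (\<forall>l\<le>e. i \<le> l \<longrightarrow> \<not> (0 < v l \<or> f \<and> i \<le> l)) \<or>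
     snd m' (CHR ''M'' # g) (Suc e) = c e \<and> (\<forall>\<beta>. \<beta> \<le> snd m' (CHR ''B'' # g) (Suc e) \<longleftrightarrow>
        (\<forall>l\<le>e. i \<le> l \<and> (0 < v l \<or> f \<and> i \<le> l) \<longrightarrow> \<beta> \<le> c e * x l - v l))"
proof -
  let ?ok = "\<lambda>m' e. snd m' (CHR ''M'' # g) (Suc e) = 0 \<and> snd m' (CHR ''B'' # g) (Suc e) = a \<and>
       (\<forall>l\<le>e. i \<le> l \<longrightarrow> \<not> (0 < v l \<or> f \<and> i \<le> l)) \<or>
     snd m' (CHR ''M'' # g) (Suc e) = c e \<and> (\<forall>\<beta>. \<beta> \<le> snd m' (CHR ''B'' # g) (Suc e) \<longleftrightarrow>
        (\<forall>l\<le>e. i \<le> l \<and> (0 < v l \<or> f \<and> i \<le> l) \<longrightarrow> \<beta> \<le> c e * x l - v l))"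
  let ?p = "PWhen (BAnd (BAnd (NLess (nv ''l'') (nsuc (nv ''k''))) (BNot (NLess (nv ''l'') (nv (CHR ''I'' # g)))))
             (BAnd (act_exp g)
               (BOr (BNot (RLess (RConst 0) (RRead (CHR ''M'' # g) (nsuc (nv ''k'')))))
                    (RLess (line_exp g) (RRead (CHR ''B'' # g) (nsuc (nv ''k'')))))))
             (PR (CHR ''M'' # g) (nsuc (nv ''k'')) (RRead (CHR ''C'' # g) (nv ''k'')) ;;
              PR (CHR ''B'' # g) (nsuc (nv ''k'')) (line_exp g))"
  let ?b = "PR (CHR ''M'' # g) (nsuc (nv ''k'')) (RConst 0) ;;
        PR (CHR ''B'' # g) (nsuc (nv ''k'')) (rv (CHR ''A'' # g)) ;; PFor ''l'' ''n'' ?p"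
  define m1 where "m1 = sem (PR (CHR ''M'' # g) (NConst 0) (RConst 0) ;;
      PR (CHR ''B'' # g) (NConst 0) (rv (CHR ''A'' # g))) m"
  let ?I = "\<lambda>k m'. snd m' (CHR ''M'' # g) 0 = 0 \<and> snd m' (CHR ''B'' # g) 0 = a \<and> (\<forall>e<k. ?ok m' e)"
  have "?I (fst m1 ''n'' 0) (sem (PFor ''k'' ''n'' ?b) m1)"
  proof (rule For_rule[where I="?I"])
    fix k and m' :: store
    assume kn: "k < fst m1 ''n'' 0" and k: "fst m' ''k'' 0 = k"
      and N: "\<And>a. a \<notin> insert ''k'' (wrN ?b) \<Longrightarrow> fst m' a = fst m1 a"
      and R: "\<And>a. a \<notin> wrR ?b \<Longrightarrow> snd m' a = snd m1 a" and I: "?I k m'"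
    define m2 where "m2 = sem (PR (CHR ''M'' # g) (nsuc (nv ''k'')) (RConst 0) ;;
        PR (CHR ''B'' # g) (nsuc (nv ''k'')) (rv (CHR ''A'' # g))) m'"
    have eqs: "fst m2 ''k'' 0 = k" "snd m2 (CHR ''C'' # g) = c" "snd m2 (CHR ''X'' # g) = x"
      "snd m2 (CHR ''V'' # g) = v" "fst m2 (CHR ''I'' # g) 0 = i" "fst m2 (CHR ''F'' # g) = fst m (CHR ''F'' # g)"
      "fst m2 ''n'' = fst m ''n''"
      using k N R by (auto simp: m2_def m1_def c_def x_def v_def i_def)
    have s: "snd m2 (CHR ''M'' # g) (Suc k) = 0" "snd m2 (CHR ''B'' # g) (Suc k) = a"
      "\<And>e. e \<noteq> Suc k \<Longrightarrow> snd m2 (CHR ''M'' # g) e = snd m' (CHR ''M'' # g) e \<and>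
        snd m2 (CHR ''B'' # g) e = snd m' (CHR ''B'' # g) e"
      using k R by (auto simp: m2_def m1_def a_def)
    have kn': "k < fst m ''n'' 0" using kn by (simp add: m1_def)
    note inner = lines_inner[of m2 g, unfolded eqs, OF c[OF kn'] kn' s(1,2), folded f_def]
    show "?I (Suc k) (nupd (sem ?b m') ''k'' 0 (Suc k))"
    proof -
      have "sem ?b m' = sem (PFor ''l'' ''n'' ?p) m2" by (simp add: m2_def)
      then show ?thesis using I inner s(3) by (simp add: less_Suc_eq del: sem.simps act_exp_def)
    qed
  qed (auto simp: m1_def a_def)
  moreover have "sem (PFor ''k'' ''n'' ?b) m1 = m'" "fst m1 ''n'' = fst m ''n''"
    by (simp_all add: m'_def m1_def lines_prog_def)
  ultimately have *: "?I (fst m ''n'' 0) m'" by simp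
  show "snd m' (CHR ''M'' # g) 0 = 0" "snd m' (CHR ''B'' # g) 0 = a" using * by auto
  show "?ok m' e" if "e < fst m ''n'' 0" using * that by blast
qed

text \<open>Dual to the intercepts: a running maximum, described by the numbers above it. The start
  value is the one for the previous edge, so each round of the outer loop adds only the conditions
  of one edge.\<close>

lemma rho_inner:
  fixes m :: store and g :: string
  defines "c \<equiv> snd m (CHR ''C'' # g)" and "x \<equiv> snd m (CHR ''X'' # g)" and "v \<equiv> snd m (CHR ''V'' # g)"
    and "i \<equiv> fst m (CHR ''I'' # g) 0" and "f \<equiv> 0 < fst m (CHR ''F'' # g) 0"
    and "k \<equiv> fst m ''k'' 0"
  defines "p \<equiv> PWhen (BAnd (BAnd (NLess (nv ''l'') (nsuc (nv ''k''))) (act_exp g))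
               (RLess (RRead (CHR ''Q'' # g) (nsuc (nv ''k''))) (rho_exp g)))
             (PR (CHR ''Q'' # g) (nsuc (nv ''k'')) (rho_exp g))"
  defines "m2 \<equiv> sem (PFor ''l'' ''n'' p) m"
  assumes kn: "k < fst m ''n'' 0"
  shows "snd m2 (CHR ''Q'' # g) (Suc k) \<le> r \<longleftrightarrow> snd m (CHR ''Q'' # g) (Suc k) \<le> r \<and>
        (\<forall>l\<le>k. 0 < v l \<or> f \<and> i \<le> l \<longrightarrow> v l / c k - x l \<le> r)" (is ?G1)
   and "e \<noteq> Suc k \<Longrightarrow> snd m2 (CHR ''Q'' # g) e = snd m (CHR ''Q'' # g) e"
proof -
  define rel where "rel l \<longleftrightarrow> l \<le> k \<and> (0 < v l \<or> f \<and> i \<le> l)" for l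
  let ?I = "\<lambda>j m'. (\<forall>r. snd m' (CHR ''Q'' # g) (Suc k) \<le> r \<longleftrightarrow> snd m (CHR ''Q'' # g) (Suc k) \<le> r \<and>
       (\<forall>l<j. rel l \<longrightarrow> v l / c k - x l \<le> r)) \<and>
     (\<forall>e. e \<noteq> Suc k \<longrightarrow> snd m' (CHR ''Q'' # g) e = snd m (CHR ''Q'' # g) e)"
  have "?I (fst m ''n'' 0) (sem (PFor ''l'' ''n'' p) m)"
  proof (rule For_rule[where I="?I"])
    fix j and m' :: store
    assume l: "fst m' ''l'' 0 = j" and N: "\<And>a. a \<notin> insert ''l'' (wrN p) \<Longrightarrow> fst m' a = fst m a"
      and R: "\<And>a. a \<notin> wrR p \<Longrightarrow> snd m' a = snd m a" and I: "?I j m'"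
    have [simp]: "fst m' ''l'' 0 = j" "fst m' ''k'' = fst m ''k''" "fst m' (CHR ''I'' # g) = fst m (CHR ''I'' # g)"
      "fst m' (CHR ''F'' # g) = fst m (CHR ''F'' # g)"
      using l N by (auto simp: p_def)
    have [simp]: "snd m' (CHR ''C'' # g) = c" "snd m' (CHR ''X'' # g) = x" "snd m' (CHR ''V'' # g) = v"
      using R by (auto simp: p_def c_def x_def v_def)
    define cond where "cond \<longleftrightarrow> rel j \<and> snd m' (CHR ''Q'' # g) (Suc k) < v j / c k - x j"
    have sem: "sem p m' = (if cond then rupd m' (CHR ''Q'' # g) (Suc k) (v j / c k - x j) else m')"
      by (auto simp: p_def cond_def rel_def act_exp_def rho_exp_def k_def[symmetric] i_def f_def)
    have I': "\<And>r. snd m' (CHR ''Q'' # g) (Suc k) \<le> r \<longleftrightarrow> snd m (CHR ''Q'' # g) (Suc k) \<le> r \<and>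
       (\<forall>l<j. rel l \<longrightarrow> v l / c k - x l \<le> r)" using I by blast
    show "?I (Suc j) (nupd (sem p m') ''l'' 0 (Suc j))"
    proof (cases cond)
      case True
      have "v j / c k - x j \<le> r \<longleftrightarrow> snd m (CHR ''Q'' # g) (Suc k) \<le> r \<and>
         (\<forall>l<Suc j. rel l \<longrightarrow> v l / c k - x l \<le> r)" for r
        using I'[of r] True by (auto simp: cond_def less_Suc_eq)
      then show ?thesis using I True unfolding sem by simp
    next
      case False
      have "snd m' (CHR ''Q'' # g) (Suc k) \<le> r \<longleftrightarrow> snd m (CHR ''Q'' # g) (Suc k) \<le> r \<and>
         (\<forall>l<Suc j. rel l \<longrightarrow> v l / c k - x l \<le> r)" for r
        using I'[of r] False by (auto simp: cond_def less_Suc_eq)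
      then show ?thesis using I False unfolding sem by simp
    qed
  qed (auto simp: p_def)
  then have *: "?I (fst m ''n'' 0) m2" unfolding m2_def .
  have "(\<forall>l<fst m ''n'' 0. rel l \<longrightarrow> v l / c k - x l \<le> r) \<longleftrightarrow>
      (\<forall>l\<le>k. 0 < v l \<or> f \<and> i \<le> l \<longrightarrow> v l / c k - x l \<le> r)"
    using kn unfolding rel_def by (meson le_less_trans)
  then show ?G1 using * by simp
  show "e \<noteq> Suc k \<Longrightarrow> snd m2 (CHR ''Q'' # g) e = snd m (CHR ''Q'' # g) e" using * by blast
qed

lemma rho_prog:
  fixes m :: store and g :: string
  defines "c \<equiv> snd m (CHR ''C'' # g)" and "x \<equiv> snd m (CHR ''X'' # g)" and "v \<equiv> snd m (CHR ''V'' # g)"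
    and "i \<equiv> fst m (CHR ''I'' # g) 0" and "f \<equiv> 0 < fst m (CHR ''F'' # g) 0"
    and "n \<equiv> fst m ''n'' 0"
  defines "m' \<equiv> sem (rho_prog g) m"
  assumes "k \<le> n"
  shows "snd m' (CHR ''Q'' # g) k \<le> r \<longleftrightarrow> - x n \<le> r \<and>
     (\<forall>e<k. \<forall>l\<le>e. 0 < v l \<or> f \<and> i \<le> l \<longrightarrow> v l / c e - x l \<le> r)"
proof -
  let ?ok = "\<lambda>m' k. \<forall>r. snd m' (CHR ''Q'' # g) k \<le> r \<longleftrightarrow> - x n \<le> r \<and>
     (\<forall>e<k. \<forall>l\<le>e. 0 < v l \<or> f \<and> i \<le> l \<longrightarrow> v l / c e - x l \<le> r)"
  let ?p = "PWhen (BAnd (BAnd (NLess (nv ''l'') (nsuc (nv ''k''))) (act_exp g))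
               (RLess (RRead (CHR ''Q'' # g) (nsuc (nv ''k''))) (rho_exp g)))
             (PR (CHR ''Q'' # g) (nsuc (nv ''k'')) (rho_exp g))"
  let ?b = "PR (CHR ''Q'' # g) (nsuc (nv ''k'')) (RRead (CHR ''Q'' # g) (nv ''k'')) ;; PFor ''l'' ''n'' ?p"
  define m1 where "m1 = sem (PR (CHR ''Q'' # g) (NConst 0) (RMinus (RConst 0) (RRead (CHR ''X'' # g) (nv ''n'')))) m"
  let ?I = "\<lambda>k m'. \<forall>e\<le>k. ?ok m' e"
  have "?I (fst m1 ''n'' 0) (sem (PFor ''k'' ''n'' ?b) m1)"
  proof (rule For_rule[where I="?I"])
    fix k and m' :: store
    assume kn: "k < fst m1 ''n'' 0" and k: "fst m' ''k'' 0 = k"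
      and N: "\<And>a. a \<notin> insert ''k'' (wrN ?b) \<Longrightarrow> fst m' a = fst m1 a"
      and R: "\<And>a. a \<notin> wrR ?b \<Longrightarrow> snd m' a = snd m1 a" and I: "?I k m'"
    define m2 where "m2 = sem (PR (CHR ''Q'' # g) (nsuc (nv ''k'')) (RRead (CHR ''Q'' # g) (nv ''k''))) m'"
    have eqs: "fst m2 ''k'' 0 = k" "snd m2 (CHR ''C'' # g) = c" "snd m2 (CHR ''X'' # g) = x"
      "snd m2 (CHR ''V'' # g) = v" "fst m2 (CHR ''I'' # g) 0 = i" "fst m2 (CHR ''F'' # g) = fst m (CHR ''F'' # g)"
      "fst m2 ''n'' = fst m ''n''"
      using k N R by (auto simp: m2_def m1_def c_def x_def v_def i_def)
    have s: "snd m2 (CHR ''Q'' # g) (Suc k) = snd m' (CHR ''Q'' # g) k"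
      "\<And>e. e \<noteq> Suc k \<Longrightarrow> snd m2 (CHR ''Q'' # g) e = snd m' (CHR ''Q'' # g) e"
      using k R by (auto simp: m2_def)
    have kn': "k < fst m ''n'' 0" using kn by (simp add: m1_def)
    note inner = rho_inner[where m=m2 and g=g, unfolded eqs, OF kn', folded f_def]
    let ?m3 = "sem (PFor ''l'' ''n'' ?p) m2"
    have m3: "sem ?b m' = ?m3" by (simp add: m2_def)
    have "?ok ?m3 e" if "e \<le> Suc k" for e
    proof (cases "e = Suc k")
      case True
      have Ik: "?ok m' k" using I by blast
      show ?thesis unfolding True inner(1) s(1) using Ik by (auto simp: less_Suc_eq)
    next
      case False
      then show ?thesis using I that unfolding inner(2)[OF False] s(2)[OF False] by auto
    qed
    then show "?I (Suc k) (nupd (sem ?b m') ''k'' 0 (Suc k))" unfolding m3 snd_nupd by blast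
  qed (auto simp: m1_def n_def x_def)
  moreover have "sem (PFor ''k'' ''n'' ?b) m1 = m'" "fst m1 ''n'' 0 = n"
    by (simp_all add: m'_def m1_def rho_prog_def n_def)
  ultimately have "?I n m'" by simp
  then show ?thesis using assms by blast
qed

section \<open>Common breakpoints of all prefix minima, and their sorting\<close>

subsection \<open>Breakpoints\<close>

text \<open>The abscissa where lines \<open>l + 1\<close> and \<open>k + 1\<close> meet. Its value
  matters only after a strict comparison of the slopes, so the division by zero for parallel lines
  has no effect.\<close>

definition cross_exp :: "string \<Rightarrow> rexp" where
  "cross_exp g = RDivide (RMinus (RRead (CHR ''B'' # g) (nsuc (nv ''l''))) (RRead (CHR ''B'' # g) (nsuc (nv ''k''))))
     (RMinus (RRead (CHR ''M'' # g) (nsuc (nv ''k''))) (RRead (CHR ''M'' # g) (nsuc (nv ''l''))))"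

definition points_body :: "string \<Rightarrow> prog" where
  "points_body g = PWhen (NLess (nv ''l'') (nv ''k''))
    (PWhen (BAnd (RLess (RRead (CHR ''M'' # g) (nsuc (nv ''k''))) (RRead (CHR ''M'' # g) (nsuc (nv ''l''))))
              (RLess (RRead (CHR ''P'' # g) (nv ''k'')) (cross_exp g)))
       (PR (CHR ''P'' # g) (nv ''k'') (cross_exp g)) ;;
     PWhen (BAnd (RLess (RRead (CHR ''M'' # g) (nsuc (nv ''l''))) (RRead (CHR ''M'' # g) (nsuc (nv ''k''))))
              (RLess (cross_exp g) (RRead (CHR ''P'' # g) (NPlus (nv ''n'') (nv ''k'')))))
       (PR (CHR ''P'' # g) (NPlus (nv ''n'') (nv ''k'')) (cross_exp g)))"

definition points_prog :: "string \<Rightarrow> prog" where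
  "points_prog g = PFor ''k'' ''n''
     (PR (CHR ''P'' # g) (nv ''k'') (RMinus (RConst 0) (RRead (CHR ''X'' # g) (nv ''n''))) ;;
      PR (CHR ''P'' # g) (NPlus (nv ''n'') (nv ''k''))
        (RDivide (RMinus (RRead (CHR ''B'' # g) (NConst 0)) (RRead (CHR ''B'' # g) (nsuc (nv ''k''))))
          (RRead (CHR ''M'' # g) (nsuc (nv ''k'')))) ;;
      PFor ''l'' ''n'' (points_body g))"

definition sort_body :: "string \<Rightarrow> prog" where
  "sort_body g = PWhen (BAnd (RLess (RRead (CHR ''R'' # g) (nv ''p'')) (RRead (CHR ''P'' # g) (nv ''q'')))
        (BOr (BNot (RLess (RRead (CHR ''R'' # g) (nv ''p'')) (RRead (CHR ''R'' # g) (nsuc (nv ''p'')))))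
             (RLess (RRead (CHR ''P'' # g) (nv ''q'')) (RRead (CHR ''R'' # g) (nsuc (nv ''p''))))))
     (PR (CHR ''R'' # g) (nsuc (nv ''p'')) (RRead (CHR ''P'' # g) (nv ''q'')))"

text \<open>Each round selects the smallest value strictly above the previous one. Equal values are
  thereby merged, values left of the domain are skipped, and when nothing larger is left the last
  value is repeated. The test that \<open>R\<close> has not yet increased recognises the start value
  of a round. Quadratic time is affordable here.\<close>

definition sort_prog :: "string \<Rightarrow> prog" where
  "sort_prog g = PR (CHR ''R'' # g) (NConst 0) (RMinus (RConst 0) (RRead (CHR ''X'' # g) (nv ''n''))) ;;
     PFor ''p'' ''nn'' (PR (CHR ''R'' # g) (nsuc (nv ''p'')) (RRead (CHR ''R'' # g) (nv ''p'')) ;;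
       PFor ''q'' ''nn'' (sort_body g))"

lemma wr_points [simp]: "wrN (points_prog g) = {''k'', ''l''}" "wrR (points_prog g) = {CHR ''P'' # g}"
  by (auto simp: points_prog_def points_body_def)

lemma wr_sort [simp]: "wrN (sort_prog g) = {''p'', ''q''}" "wrR (sort_prog g) = {CHR ''R'' # g}"
  by (auto simp: sort_prog_def sort_body_def)

text \<open>Line \<open>k + 1\<close> lies below all lines \<open>0, \<dots>, k\<close> exactly on an interval. Its end points, unless they
  are to the left of the domain, are \<open>lo\<close> and \<open>hi\<close>.\<close>

definition enters :: "(nat \<Rightarrow> real) \<Rightarrow> (nat \<Rightarrow> real) \<Rightarrow> real \<Rightarrow> nat \<Rightarrow> nat \<Rightarrow> real \<Rightarrow> real \<Rightarrow> bool" where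
  "enters mm bb x0 k j lo hi \<longleftrightarrow>
     (\<forall>w. (\<forall>l\<le>j. mm (Suc k) * w + bb (Suc k) < mm l * w + bb l) \<longrightarrow>
        (lo < w \<or> lo \<le> x0) \<and> (0 < mm (Suc k) \<longrightarrow> w < hi)) \<and>
     (\<forall>r l. l \<le> j \<longrightarrow> lo \<le> r \<longrightarrow> mm (Suc k) < mm l \<longrightarrow> mm (Suc k) * r + bb (Suc k) \<le> mm l * r + bb l) \<and>
     (\<forall>r l. l \<le> j \<longrightarrow> r \<le> hi \<longrightarrow> mm l < mm (Suc k) \<longrightarrow> mm (Suc k) * r + bb (Suc k) \<le> mm l * r + bb l)"

lemma enters_0:
  assumes "mm 0 = 0" "0 \<le> mm (Suc k)"
  shows "enters mm bb x0 k 0 x0 ((bb 0 - bb (Suc k)) / mm (Suc k))"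
  using assms by (auto simp: enters_def field_simps)

text \<open>A steeper old line is above the new one to the right of their crossing and so raises the
  left end; a flatter one lowers the right end. A parallel line moves neither end, since it either
  rules out the interval altogether or never matters.\<close>

lemma enters_Suc:
  assumes e: "enters mm bb x0 k j lo hi"
  defines "cr \<equiv> (bb (Suc j) - bb (Suc k)) / (mm (Suc k) - mm (Suc j))"
  shows "enters mm bb x0 k (Suc j) (if mm (Suc k) < mm (Suc j) \<and> lo < cr then cr else lo)
     (if mm (Suc j) < mm (Suc k) \<and> cr < hi then cr else hi)"
proof -
  have 1: "mm (Suc k) * w + bb (Suc k) < mm (Suc j) * w + bb (Suc j) \<longleftrightarrow> cr < w"
    "mm (Suc k) * w + bb (Suc k) \<le> mm (Suc j) * w + bb (Suc j) \<longleftrightarrow> cr \<le> w"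
    if "mm (Suc k) < mm (Suc j)" for w using that by (simp_all add: cr_def field_simps)
  have 2: "mm (Suc k) * w + bb (Suc k) < mm (Suc j) * w + bb (Suc j) \<longleftrightarrow> w < cr"
    "mm (Suc k) * w + bb (Suc k) \<le> mm (Suc j) * w + bb (Suc j) \<longleftrightarrow> w \<le> cr"
    if "mm (Suc j) < mm (Suc k)" for w using that by (simp_all add: cr_def field_simps)
  show ?thesis
    using e 1 2 unfolding enters_def le_Suc_eq by (auto split: if_splits)
qed

lemma points_inner:
  fixes m :: store and g :: string
  defines "mm \<equiv> snd m (CHR ''M'' # g)" and "bb \<equiv> snd m (CHR ''B'' # g)"
    and "k \<equiv> fst m ''k'' 0" and "n \<equiv> fst m ''n'' 0"
  defines "m2 \<equiv> sem (PFor ''l'' ''n'' (points_body g)) m"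
  assumes kn: "k < n"
    and e: "enters mm bb x0 k 0 (snd m (CHR ''P'' # g) k) (snd m (CHR ''P'' # g) (n + k))"
  shows "enters mm bb x0 k k (snd m2 (CHR ''P'' # g) k) (snd m2 (CHR ''P'' # g) (n + k))"
   and "e \<noteq> k \<Longrightarrow> e \<noteq> n + k \<Longrightarrow> snd m2 (CHR ''P'' # g) e = snd m (CHR ''P'' # g) e"
proof -
  let ?p = "points_body g"
  \<comment> \<open>Only the old lines up to \<open>k\<close> take part; the remaining rounds of the
    loop are idle, hence \<open>min j k\<close>.\<close>
  let ?I = "\<lambda>j m'. enters mm bb x0 k (min j k) (snd m' (CHR ''P'' # g) k) (snd m' (CHR ''P'' # g) (n + k)) \<and>
     (\<forall>e. e \<noteq> k \<longrightarrow> e \<noteq> n + k \<longrightarrow> snd m' (CHR ''P'' # g) e = snd m (CHR ''P'' # g) e)"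
  have "?I (fst m ''n'' 0) (sem (PFor ''l'' ''n'' ?p) m)"
  proof (rule For_rule[where I="?I"])
    fix j and m' :: store
    assume l: "fst m' ''l'' 0 = j" and N: "\<And>a. a \<notin> insert ''l'' (wrN ?p) \<Longrightarrow> fst m' a = fst m a"
      and R: "\<And>a. a \<notin> wrR ?p \<Longrightarrow> snd m' a = snd m a" and I: "?I j m'"
    have [simp]: "fst m' ''l'' 0 = j" "fst m' ''k'' 0 = k" "fst m' ''n'' 0 = n"
      using l N by (auto simp: points_body_def k_def n_def)
    have [simp]: "snd m' (CHR ''M'' # g) = mm" "snd m' (CHR ''B'' # g) = bb"
      using R by (auto simp: points_body_def mm_def bb_def)
    define cr where "cr = (bb (Suc j) - bb (Suc k)) / (mm (Suc k) - mm (Suc j))"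
    let ?lo = "snd m' (CHR ''P'' # g) k" and ?hi = "snd m' (CHR ''P'' # g) (n + k)"
    let ?m = "sem ?p m'"
    have ne: "k \<noteq> n + k" using kn by simp
    have s: "snd ?m (CHR ''P'' # g) k = (if j < k \<and> mm (Suc k) < mm (Suc j) \<and> ?lo < cr then cr else ?lo)"
      "snd ?m (CHR ''P'' # g) (n + k) = (if j < k \<and> mm (Suc j) < mm (Suc k) \<and> cr < ?hi then cr else ?hi)"
      "e \<noteq> k \<Longrightarrow> e \<noteq> n + k \<Longrightarrow> snd ?m (CHR ''P'' # g) e = snd m' (CHR ''P'' # g) e" for e
      using ne by (auto simp: points_body_def cross_exp_def cr_def)
    have "enters mm bb x0 k (min (Suc j) k) (snd ?m (CHR ''P'' # g) k) (snd ?m (CHR ''P'' # g) (n + k))"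
    proof (cases "j < k")
      case True
      then show ?thesis using enters_Suc[of mm bb x0 k j ?lo ?hi] I unfolding s cr_def by (simp add: min_def)
    next
      case False
      then show ?thesis using I unfolding s by (simp add: min_def split: if_splits)
    qed
    then show "?I (Suc j) (nupd ?m ''l'' 0 (Suc j))" using I s(3) by simp
  qed (use e in \<open>auto simp: points_body_def\<close>)
  then have *: "?I n m2" unfolding m2_def n_def .
  then show "enters mm bb x0 k k (snd m2 (CHR ''P'' # g) k) (snd m2 (CHR ''P'' # g) (n + k))"
    using kn by (simp add: min_def)
  show "e \<noteq> k \<Longrightarrow> e \<noteq> n + k \<Longrightarrow> snd m2 (CHR ''P'' # g) e = snd m (CHR ''P'' # g) e" using * by blast
qed

lemma points_prog:
  fixes m :: store and g :: string
  defines "mm \<equiv> snd m (CHR ''M'' # g)" and "bb \<equiv> snd m (CHR ''B'' # g)" and "n \<equiv> fst m ''n'' 0"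
  defines "m2 \<equiv> sem (points_prog g) m"
  assumes mm: "mm 0 = 0" "\<And>k. k < n \<Longrightarrow> 0 \<le> mm (Suc k)" and k: "k < n"
  shows "enters mm bb (- snd m (CHR ''X'' # g) n) k k (snd m2 (CHR ''P'' # g) k) (snd m2 (CHR ''P'' # g) (n + k))"
proof -
  let ?x0 = "- snd m (CHR ''X'' # g) n"
  let ?i = "PR (CHR ''P'' # g) (nv ''k'') (RMinus (RConst 0) (RRead (CHR ''X'' # g) (nv ''n''))) ;;
      PR (CHR ''P'' # g) (NPlus (nv ''n'') (nv ''k''))
        (RDivide (RMinus (RRead (CHR ''B'' # g) (NConst 0)) (RRead (CHR ''B'' # g) (nsuc (nv ''k''))))
          (RRead (CHR ''M'' # g) (nsuc (nv ''k''))))"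
  let ?b = "PR (CHR ''P'' # g) (nv ''k'') (RMinus (RConst 0) (RRead (CHR ''X'' # g) (nv ''n''))) ;;
      PR (CHR ''P'' # g) (NPlus (nv ''n'') (nv ''k''))
        (RDivide (RMinus (RRead (CHR ''B'' # g) (NConst 0)) (RRead (CHR ''B'' # g) (nsuc (nv ''k''))))
          (RRead (CHR ''M'' # g) (nsuc (nv ''k'')))) ;; PFor ''l'' ''n'' (points_body g)"
  let ?I = "\<lambda>k m'. \<forall>e<k. enters mm bb ?x0 e e (snd m' (CHR ''P'' # g) e) (snd m' (CHR ''P'' # g) (n + e))"
  have "?I (fst m ''n'' 0) (sem (PFor ''k'' ''n'' ?b) m)"
  proof (rule For_rule[where I="?I"])
    fix k and m' :: store
    assume kn: "k < fst m ''n'' 0" and k: "fst m' ''k'' 0 = k"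
      and N: "\<And>a. a \<notin> insert ''k'' (wrN ?b) \<Longrightarrow> fst m' a = fst m a"
      and R: "\<And>a. a \<notin> wrR ?b \<Longrightarrow> snd m' a = snd m a" and I: "?I k m'"
    have kn': "k < n" using kn by (simp add: n_def)
    define m1 where "m1 = sem ?i m'"
    have eqs: "fst m1 ''k'' 0 = k" "snd m1 (CHR ''M'' # g) = mm" "snd m1 (CHR ''B'' # g) = bb" "fst m1 ''n'' 0 = n"
      using k N R by (auto simp: m1_def points_body_def mm_def bb_def n_def)
    have mn: "fst m' ''n'' 0 = n" "snd m' (CHR ''X'' # g) = snd m (CHR ''X'' # g)"
      "snd m' (CHR ''M'' # g) = mm" "snd m' (CHR ''B'' # g) = bb"
      using N R by (auto simp: points_body_def n_def mm_def bb_def)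
    have s: "snd m1 (CHR ''P'' # g) k = ?x0" "snd m1 (CHR ''P'' # g) (n + k) = (bb 0 - bb (Suc k)) / mm (Suc k)"
      "\<And>e. e \<noteq> k \<Longrightarrow> e \<noteq> n + k \<Longrightarrow> snd m1 (CHR ''P'' # g) e = snd m' (CHR ''P'' # g) e"
      using k kn' mn by (auto simp: m1_def)
    have e0: "enters mm bb ?x0 k 0 (snd m1 (CHR ''P'' # g) k) (snd m1 (CHR ''P'' # g) (n + k))"
      unfolding s(1,2) by (rule enters_0) (use mm kn' in auto)
    note inner = points_inner[of m1 g ?x0, unfolded eqs, OF kn' e0]
    have m3: "sem ?b m' = sem (PFor ''l'' ''n'' (points_body g)) m1" by (simp add: m1_def)
    let ?m3 = "sem (PFor ''l'' ''n'' (points_body g)) m1"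
    have "enters mm bb ?x0 e e (snd ?m3 (CHR ''P'' # g) e) (snd ?m3 (CHR ''P'' # g) (n + e))" if "e < Suc k" for e
    proof (cases "e = k")
      case True
      then show ?thesis using inner(1) by simp
    next
      case False
      then have ek: "e < k" using that by simp
      have "snd ?m3 (CHR ''P'' # g) e = snd m' (CHR ''P'' # g) e"
        "snd ?m3 (CHR ''P'' # g) (n + e) = snd m' (CHR ''P'' # g) (n + e)"
        using inner(2)[of e] inner(2)[of "n + e"] s(3)[of e] s(3)[of "n + e"] ek kn' by simp_all
      then show ?thesis using I ek by simp
    qed
    then show "?I (Suc k) (nupd (sem ?b m') ''k'' 0 (Suc k))" unfolding m3 snd_nupd by blast
  qed (auto simp: points_body_def)
  then show ?thesis using k unfolding m2_def points_prog_def n_def by blast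
qed

lemma sort_inner:
  fixes m :: store and g :: string
  defines "P \<equiv> snd m (CHR ''P'' # g)" and "p \<equiv> fst m ''p'' 0" and "nn \<equiv> fst m ''nn'' 0"
  defines "m2 \<equiv> sem (PFor ''q'' ''nn'' (sort_body g)) m"
  defines "s \<equiv> snd m (CHR ''R'' # g) p" and "t \<equiv> snd m2 (CHR ''R'' # g) (Suc p)"
  assumes e: "snd m (CHR ''R'' # g) (Suc p) = s"
  shows "t = s \<and> (\<forall>q<nn. \<not> s < P q) \<or> s < t \<and> (\<exists>q<nn. t = P q) \<and> (\<forall>q<nn. s < P q \<longrightarrow> t \<le> P q)"
   and "e \<noteq> Suc p \<Longrightarrow> snd m2 (CHR ''R'' # g) e = snd m (CHR ''R'' # g) e"
proof -
  let ?p = "sort_body g"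
  let ?I = "\<lambda>j m'. let t = snd m' (CHR ''R'' # g) (Suc p) in
     (t = s \<and> (\<forall>q<j. \<not> s < P q) \<or> s < t \<and> (\<exists>q<nn. t = P q) \<and> (\<forall>q<j. s < P q \<longrightarrow> t \<le> P q)) \<and>
     (\<forall>e. e \<noteq> Suc p \<longrightarrow> snd m' (CHR ''R'' # g) e = snd m (CHR ''R'' # g) e)"
  have "?I (fst m ''nn'' 0) (sem (PFor ''q'' ''nn'' ?p) m)"
  proof (rule For_rule[where I="?I"])
    fix j and m' :: store
    assume jn: "j < fst m ''nn'' 0" and l: "fst m' ''q'' 0 = j" and N: "\<And>a. a \<notin> insert ''q'' (wrN ?p) \<Longrightarrow> fst m' a = fst m a"
      and R: "\<And>a. a \<notin> wrR ?p \<Longrightarrow> snd m' a = snd m a" and I: "?I j m'"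
    have [simp]: "fst m' ''q'' 0 = j" "fst m' ''p'' 0 = p"
      using l N by (auto simp: sort_body_def p_def)
    have [simp]: "snd m' (CHR ''P'' # g) = P"
      using R by (auto simp: sort_body_def P_def)
    let ?t = "snd m' (CHR ''R'' # g) (Suc p)"
    have sR: "snd m' (CHR ''R'' # g) p = s" using I by (simp add: Let_def s_def)
    have sem: "sem ?p m' = (if s < P j \<and> (\<not> s < ?t \<or> P j < ?t) then rupd m' (CHR ''R'' # g) (Suc p) (P j) else m')"
      by (auto simp: sort_body_def sR)
    show "?I (Suc j) (nupd (sem ?p m') ''q'' 0 (Suc j))"
      using I jn unfolding sem Let_def
      by (auto simp: less_Suc_eq nn_def)
  qed (use e in \<open>auto simp: sort_body_def Let_def\<close>)
  then have *: "?I nn m2" unfolding m2_def nn_def .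
  then show "t = s \<and> (\<forall>q<nn. \<not> s < P q) \<or> s < t \<and> (\<exists>q<nn. t = P q) \<and> (\<forall>q<nn. s < P q \<longrightarrow> t \<le> P q)"
    unfolding Let_def t_def by blast
  show "e \<noteq> Suc p \<Longrightarrow> snd m2 (CHR ''R'' # g) e = snd m (CHR ''R'' # g) e" using * by (simp add: Let_def)
qed

text \<open>Every step either finds nothing larger or strictly reduces the number of values still
  above the current one, so none can be left after \<open>nn\<close> steps.\<close>

lemma sorted_exhausts:
  fixes S P :: "nat \<Rightarrow> real"
  assumes step: "\<And>p. p < nn \<Longrightarrow> S (Suc p) = S p \<and> (\<forall>q<nn. \<not> S p < P q) \<or>
      S p < S (Suc p) \<and> (\<exists>q<nn. S (Suc p) = P q) \<and> (\<forall>q<nn. S p < P q \<longrightarrow> S (Suc p) \<le> P q)"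
    and q: "q < nn"
  shows "P q \<le> S nn"
proof -
  have "p \<le> nn \<Longrightarrow> card {q. q < nn \<and> S p < P q} \<le> nn - p" for p
  proof (induction p)
    case 0
    have "card {q. q < nn \<and> S 0 < P q} \<le> card {..<nn}" by (rule card_mono) auto
    then show ?case by simp
  next
    case (Suc p)
    then have IH: "card {q. q < nn \<and> S p < P q} \<le> nn - p" by simp
    from step[of p] Suc.prems have "S (Suc p) = S p \<and> (\<forall>q<nn. \<not> S p < P q) \<or>
        S p < S (Suc p) \<and> (\<exists>q<nn. S (Suc p) = P q)" by auto
    then show ?case
    proof
      assume "S (Suc p) = S p \<and> (\<forall>q<nn. \<not> S p < P q)"
      then have "{q. q < nn \<and> S (Suc p) < P q} = {}" by auto
      then show ?thesis by (simp only: card.empty)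
    next
      assume h: "S p < S (Suc p) \<and> (\<exists>q<nn. S (Suc p) = P q)"
      then obtain q where q: "q < nn" "S (Suc p) = P q" by blast
      have "{q. q < nn \<and> S (Suc p) < P q} \<subset> {q. q < nn \<and> S p < P q}"
      proof (rule psubsetI)
        show "{q. q < nn \<and> S (Suc p) < P q} \<subseteq> {q. q < nn \<and> S p < P q}" using h by auto
        have "q \<in> {q. q < nn \<and> S p < P q}" "q \<notin> {q. q < nn \<and> S (Suc p) < P q}" using q h by auto
        then show "{q. q < nn \<and> S (Suc p) < P q} \<noteq> {q. q < nn \<and> S p < P q}" by blast
      qed
      then have "card {q. q < nn \<and> S (Suc p) < P q} < card {q. q < nn \<and> S p < P q}"
        by (intro psubset_card_mono) auto
      then show ?thesis using IH by linarith
    qed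
  qed
  from this[of nn] have "{q. q < nn \<and> S nn < P q} = {}" by simp
  then show ?thesis using q by (metis (mono_tags, lifting) empty_Collect_eq not_le)
qed

lemma sort_prog:
  fixes m :: store and g :: string
  defines "P \<equiv> snd m (CHR ''P'' # g)" and "nn \<equiv> fst m ''nn'' 0"
  defines "S \<equiv> snd (sem (sort_prog g) m) (CHR ''R'' # g)"
  shows "S 0 = - snd m (CHR ''X'' # g) (fst m ''n'' 0)"
    and "p < nn \<Longrightarrow> S p \<le> S (Suc p)"
    and "p < nn \<Longrightarrow> q < nn \<Longrightarrow> \<not> (S p < P q \<and> P q < S (Suc p))"
    and "q < nn \<Longrightarrow> P q \<le> S nn"
proof -
  let ?i = "PR (CHR ''R'' # g) (nsuc (nv ''p'')) (RRead (CHR ''R'' # g) (nv ''p''))"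
  let ?b = "?i ;; PFor ''q'' ''nn'' (sort_body g)"
  let ?x0 = "- snd m (CHR ''X'' # g) (fst m ''n'' 0)"
  let ?ok = "\<lambda>S p. S (Suc p) = S p \<and> (\<forall>q<nn. \<not> S p < P q) \<or>
      S p < S (Suc p) \<and> (\<exists>q<nn. S (Suc p) = P q) \<and> (\<forall>q<nn. S p < P q \<longrightarrow> S (Suc p) \<le> P q)"
  define m1 where "m1 = sem (PR (CHR ''R'' # g) (NConst 0) (RMinus (RConst 0) (RRead (CHR ''X'' # g) (nv ''n'')))) m"
  let ?I = "\<lambda>k m'. snd m' (CHR ''R'' # g) 0 = ?x0 \<and> (\<forall>p<k. ?ok (snd m' (CHR ''R'' # g)) p)"
  have "?I (fst m1 ''nn'' 0) (sem (PFor ''p'' ''nn'' ?b) m1)"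
  proof (rule For_rule[where I="?I"])
    fix p and m' :: store
    assume k: "fst m' ''p'' 0 = p"
      and N: "\<And>a. a \<notin> insert ''p'' (wrN ?b) \<Longrightarrow> fst m' a = fst m1 a"
      and R: "\<And>a. a \<notin> wrR ?b \<Longrightarrow> snd m' a = snd m1 a" and I: "?I p m'"
    define m2 where "m2 = sem ?i m'"
    have eqs: "fst m2 ''p'' 0 = p" "snd m2 (CHR ''P'' # g) = P" "fst m2 ''nn'' 0 = nn"
      using k N R by (auto simp: m2_def m1_def sort_body_def P_def nn_def)
    have s: "snd m2 (CHR ''R'' # g) (Suc p) = snd m2 (CHR ''R'' # g) p"
      "\<And>e. e \<noteq> Suc p \<Longrightarrow> snd m2 (CHR ''R'' # g) e = snd m' (CHR ''R'' # g) e"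
      using k by (auto simp: m2_def)
    note inner = sort_inner[of m2 g, unfolded eqs, OF s(1)]
    let ?m3 = "sem (PFor ''q'' ''nn'' (sort_body g)) m2"
    have m3: "sem ?b m' = ?m3" by (simp add: m2_def)
    have o: "snd ?m3 (CHR ''R'' # g) e = snd m' (CHR ''R'' # g) e" if "e \<noteq> Suc p" for e
      using inner(2)[OF that] s(2)[OF that] by simp
    have "?ok (snd ?m3 (CHR ''R'' # g)) e" if "e < Suc p" for e
    proof (cases "e = p")
      case True
      have "snd m2 (CHR ''R'' # g) p = snd ?m3 (CHR ''R'' # g) p" using inner(2)[of p] by simp
      then show ?thesis using inner(1) unfolding True by simp
    next
      case False
      then have "snd ?m3 (CHR ''R'' # g) e = snd m' (CHR ''R'' # g) e"
        "snd ?m3 (CHR ''R'' # g) (Suc e) = snd m' (CHR ''R'' # g) (Suc e)" using o that by auto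
      then show ?thesis using I False that by simp
    qed
    then show "?I (Suc p) (nupd (sem ?b m') ''p'' 0 (Suc p))" unfolding m3 snd_nupd using o[of 0] I by simp
  qed (auto simp: m1_def sort_body_def)
  moreover have "sem (PFor ''p'' ''nn'' ?b) m1 = sem (sort_prog g) m" "fst m1 ''nn'' 0 = nn"
    by (simp_all add: m1_def sort_prog_def nn_def)
  ultimately have *: "S 0 = ?x0" "\<And>p. p < nn \<Longrightarrow> ?ok S p" unfolding S_def by auto
  show "S 0 = ?x0" by (rule *)
  show "p < nn \<Longrightarrow> S p \<le> S (Suc p)" using *(2)[of p] by auto
  show "p < nn \<Longrightarrow> q < nn \<Longrightarrow> \<not> (S p < P q \<and> P q < S (Suc p))" using *(2)[of p] by fastforce
  show "q < nn \<Longrightarrow> P q \<le> S nn" by (intro sorted_exhausts[where S=S and P=P and nn=nn and q=q] *(2))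
qed

section \<open>Deciding by a comparison at one point which line is minimal on a whole cell\<close>

subsection \<open>The table of minimal lines\<close>

text \<open>To the right of \<open>R p\<close> and up to the next breakpoint, a line is below another one if it is smaller
  at \<open>R p\<close> or, in case of equality, has the smaller slope.\<close>

primrec min_line :: "(nat \<Rightarrow> real) \<Rightarrow> (nat \<Rightarrow> real) \<Rightarrow> real \<Rightarrow> nat \<Rightarrow> nat" where
  "min_line mm bb s 0 = 0"
| "min_line mm bb s (Suc k) = (let l = min_line mm bb s k in
     if mm (Suc k) * s + bb (Suc k) < mm l * s + bb l \<or>
       \<not> mm l * s + bb l < mm (Suc k) * s + bb (Suc k) \<and> mm (Suc k) < mm l
     then Suc k else l)"

text \<open>The set where a new line is strictly below the old minimum is an interval whose ends,
  within the domain, are breakpoints, so it cannot begin or end inside a cell. On each cell the new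
  line is therefore either minimal throughout or nowhere strictly below, and the left end of the
  cell with the slope as tie-break tells which.\<close>

lemma min_line_correct:
  fixes mm bb R P :: "nat \<Rightarrow> real"
  defines "env \<equiv> \<lambda>k r. rec_nat (bb 0) (\<lambda>e v. min v (mm (Suc e) * r + bb (Suc e))) k"
  assumes mm: "mm 0 = 0" "\<And>k. k < n \<Longrightarrow> 0 \<le> mm (Suc k)"
    and ent: "\<And>k. k < n \<Longrightarrow> enters mm bb (R 0) k k (P k) (P (n + k))"
    and R: "\<And>p. p < 2 * n \<Longrightarrow> R p \<le> R (Suc p)"
    and gap: "\<And>p q. p < 2 * n \<Longrightarrow> q < 2 * n \<Longrightarrow> \<not> (R p < P q \<and> P q < R (Suc p))"
    and last: "\<And>q. q < 2 * n \<Longrightarrow> P q \<le> R (2 * n)"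
    and p: "p \<le> 2 * n"
  shows "k \<le> n \<Longrightarrow> R p \<le> r \<Longrightarrow> (p < 2 * n \<longrightarrow> r \<le> R (Suc p)) \<Longrightarrow>
    mm (min_line mm bb (R p) k) * r + bb (min_line mm bb (R p) k) = env k r"
proof (induction k arbitrary: r)
  case 0
  then show ?case by (simp add: env_def mm)
next
  case (Suc k)
  have kn: "k < n" using Suc.prems by simp
  let ?J = "\<lambda>r. R p \<le> r \<and> (p < 2 * n \<longrightarrow> r \<le> R (Suc p))"
  let ?l = "min_line mm bb (R p) k"
  let ?new = "\<lambda>r. mm (Suc k) * r + bb (Suc k)"
  have IH: "mm ?l * r + bb ?l = env k r" if "?J r" for r using Suc.IH[of r] that kn by simp
  have JR: "?J (R p)" using R by simp
  have below: "env k r \<le> mm l * r + bb l" if "l \<le> k" for l r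
    using that
  proof (induction k)
    case 0
    then show ?case by (simp add: env_def mm)
  next
    case (Suc k)
    then show ?case by (auto simp: env_def le_Suc_eq min_le_iff_disj)
  qed
  have above: "v \<le> env k r" if "\<And>l. l \<le> k \<Longrightarrow> v \<le> mm l * r + bb l" for v r
    using that
  proof (induction k)
    case 0
    then show ?case using 0[of 0] by (simp add: env_def mm)
  next
    case (Suc k)
    then show ?case by (auto simp: env_def)
  qed
  \<comment> \<open>Strictly below at one point of the closed cell implies minimal on all of
    it.\<close>
  have dich: "?new r \<le> env k r" if w: "?J w" "?new w < env k w" and r: "?J r" for w r
  proof -
    have strict: "?new w < mm l * w + bb l" if "l \<le> k" for l using below[OF that, of w] w by simp
    have e: "P k < w \<or> P k \<le> R 0" "0 < mm (Suc k) \<Longrightarrow> w < P (n + k)"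
      "\<And>r l. l \<le> k \<Longrightarrow> P k \<le> r \<Longrightarrow> mm (Suc k) < mm l \<Longrightarrow> ?new r \<le> mm l * r + bb l"
      "\<And>r l. l \<le> k \<Longrightarrow> r \<le> P (n + k) \<Longrightarrow> mm l < mm (Suc k) \<Longrightarrow> ?new r \<le> mm l * r + bb l"
      using ent[OF kn] strict unfolding enters_def by blast+
    have R0: "q \<le> 2 * n \<Longrightarrow> R 0 \<le> R q" for q
    proof (induction q)
      case (Suc q)
      then show ?case using R[of q] by simp
    qed simp
    have lo: "P k \<le> R p"
    proof (cases "p < 2 * n")
      case True
      then show ?thesis using e(1) R0[of p] gap[of p k] w(1) kn by fastforce
    next
      case False
      then show ?thesis using last[of k] p kn by simp
    qed
    \<comment> \<open>A right end before \<open>r\<close> but after \<open>w\<close> would be a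
      breakpoint inside the cell. In the last cell no breakpoint lies to the right at all, which
      contradicts \<open>w < P (n + k)\<close>.\<close>
    have hi: "r \<le> P (n + k)" if "0 < mm (Suc k)"
    proof (cases "p < 2 * n")
      case True
      then show ?thesis using e(2)[OF that] gap[of p "n + k"] w(1) kn r by fastforce
    next
      case False
      then show ?thesis using e(2)[OF that] last[of "n + k"] p kn w(1) by simp
    qed
    show ?thesis
    proof (rule above)
      fix l assume l: "l \<le> k"
      have mml: "0 \<le> mm l" using mm l kn by (cases l) auto
      consider "mm (Suc k) < mm l" | "mm l < mm (Suc k)" | "mm l = mm (Suc k)" by linarith
      then show "?new r \<le> mm l * r + bb l"
      proof cases
        case 1
        then show ?thesis using e(3)[OF l _ 1, of r] lo r by simp
      next
        case 2
        then show ?thesis using e(4)[OF l _ 2, of r] hi mml by simp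
      next
        case 3
        then show ?thesis using strict[OF l] by simp
      qed
    qed
  qed
  have env: "env (Suc k) r = min (env k r) (?new r)" by (simp add: env_def)
  have J: "?J r" using Suc.prems by simp
  have lin: "?new r - ?new (R p) = mm (Suc k) * (r - R p)"
    "(mm ?l * r + bb ?l) - (mm ?l * R p + bb ?l) = mm ?l * (r - R p)" by (simp_all add: algebra_simps)
  consider "?new (R p) < mm ?l * R p + bb ?l"
    | "?new (R p) = mm ?l * R p + bb ?l" "mm (Suc k) < mm ?l"
    | "?new (R p) = mm ?l * R p + bb ?l" "\<not> mm (Suc k) < mm ?l"
    | "mm ?l * R p + bb ?l < ?new (R p)" by linarith
  then show ?case
  proof cases
    case 1
    then have "?new r \<le> env k r" using dich[OF JR _ J] IH[OF JR] by simp
    then show ?thesis using 1 env by (simp add: Let_def min_def)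
  next
    case 2
    have "mm (Suc k) * (r - R p) \<le> mm ?l * (r - R p)" using 2 J by (intro mult_right_mono) auto
    then have "?new r \<le> env k r" using lin 2(1) IH[OF J] by linarith
    then show ?thesis using 2 env by (simp add: Let_def min_def)
  next
    case 3
    have "mm ?l * (r - R p) \<le> mm (Suc k) * (r - R p)" using 3 J by (intro mult_right_mono) auto
    then have "env k r \<le> ?new r" using lin 3(1) IH[OF J] by linarith
    then show ?thesis using 3 env IH[OF J] by (simp add: Let_def min_def)
  next
    case 4
    \<comment> \<open>The contrapositive of \<open>dich\<close>: a line above the minimum at the
      left end is nowhere strictly below it in the cell.\<close>
    then have "\<not> ?new (R p) \<le> env k (R p)" using IH[OF JR] by simp
    then have "env k r \<le> ?new r" using dich[OF J _ JR] by force
    then show ?thesis using 4 env IH[OF J] by (simp add: Let_def min_def)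
  qed
qed

text \<open>The rows of the table follow one another in one array. Row starts are read from
  \<open>bs\<close>, where they have been accumulated by addition, because the machine does not
  multiply naturals.\<close>

definition table_body :: "string \<Rightarrow> prog" where
  "table_body g =
    (let l = NRead (CHR ''L'' # g) (NPlus (NRead ''bs'' (nv ''k'')) (nv ''p''));
         line = (\<lambda>e. RPlus (RTimes (RRead (CHR ''M'' # g) e) (RRead (CHR ''R'' # g) (nv ''p'')))
                       (RRead (CHR ''B'' # g) e));
         t = NPlus (NRead ''bs'' (nsuc (nv ''k''))) (nv ''p'')
     in PIf (BOr (RLess (line (nsuc (nv ''k''))) (line l))
               (BAnd (BNot (RLess (line l) (line (nsuc (nv ''k'')))))
                 (RLess (RRead (CHR ''M'' # g) (nsuc (nv ''k''))) (RRead (CHR ''M'' # g) l))))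
          (PN (CHR ''L'' # g) t (nsuc (nv ''k''))) (PN (CHR ''L'' # g) t l))"

definition table_prog :: "string \<Rightarrow> prog" where
  "table_prog g = PFor ''p'' ''np'' (PN (CHR ''L'' # g) (nv ''p'') (NConst 0)) ;;
     PFor ''k'' ''n'' (PFor ''p'' ''np'' (table_body g))"

lemma wr_table [simp]: "wrN (table_prog g) = {''k'', ''p'', CHR ''L'' # g}" "wrR (table_prog g) = {}"
  by (auto simp: table_prog_def table_body_def Let_def)

lemma row_less:
  fixes p p' np :: nat
  assumes "k < k'" "p < np"
  shows "k * np + p < k' * np + p'"
proof -
  have "k * np + p < Suc k * np" using assms by simp
  also have "\<dots> \<le> k' * np" using assms by (intro mult_le_mono1) simp
  finally show ?thesis by simp
qed

lemma table_prog:
  fixes m :: store and g :: string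
  defines "mm \<equiv> snd m (CHR ''M'' # g)" and "bb \<equiv> snd m (CHR ''B'' # g)" and "R \<equiv> snd m (CHR ''R'' # g)"
    and "n \<equiv> fst m ''n'' 0" and "np \<equiv> fst m ''np'' 0"
  assumes bs: "\<And>k. k \<le> n \<Longrightarrow> fst m ''bs'' k = k * np" and "k \<le> n" "p < np"
  shows "fst (sem (table_prog g) m) (CHR ''L'' # g) (k * np + p) = min_line mm bb (R p) k"
proof -
  let ?rows = "\<lambda>k m'. \<forall>k'<k. \<forall>p<np. fst m' (CHR ''L'' # g) (k' * np + p) = min_line mm bb (R p) k'"
  define m1 where "m1 = sem (PFor ''p'' ''np'' (PN (CHR ''L'' # g) (nv ''p'') (NConst 0))) m"
  let ?I0 = "\<lambda>j m'. \<forall>p<j. fst m' (CHR ''L'' # g) p = 0"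
  have "?I0 (fst m ''np'' 0) m1" unfolding m1_def
    by (rule For_rule[where I="?I0"]) (auto simp: less_Suc_eq)
  then have 1: "?rows 1 m1" by (simp add: np_def)
  let ?b = "PFor ''p'' ''np'' (table_body g)"
  let ?I = "\<lambda>k m'. ?rows (Suc k) m'"
  have f1: "fst m1 a = fst m a" if "a \<noteq> ''p''" "a \<noteq> CHR ''L'' # g" for a
    unfolding m1_def by (rule sem_frame) (use that in auto)
  have s1: "snd m1 = snd m" unfolding m1_def by (rule ext, rule sem_frame) simp
  have "?I (fst m1 ''n'' 0) (sem (PFor ''k'' ''n'' ?b) m1)"
  proof (rule For_rule[where I="?I"])
    fix k and m' :: store
    assume kn: "k < fst m1 ''n'' 0" and k: "fst m' ''k'' 0 = k"
      and N: "\<And>a. a \<notin> insert ''k'' (wrN ?b) \<Longrightarrow> fst m' a = fst m1 a"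
      and R: "\<And>a. a \<notin> wrR ?b \<Longrightarrow> snd m' a = snd m1 a" and I: "?I k m'"
    have kn': "k < n" using kn f1[of "''n''"] by (simp add: n_def)
    have eqs: "fst m' ''np'' = fst m ''np''" "fst m' ''bs'' = fst m ''bs''"
      using N[of "''np''"] N[of "''bs''"] f1 by (auto simp: table_body_def Let_def)
    have eqs2: "snd m' (CHR ''M'' # g) = mm" "snd m' (CHR ''B'' # g) = bb" "snd m' (CHR ''R'' # g) = R"
      using R s1 by (auto simp: table_body_def Let_def mm_def bb_def R_def)
    let ?J = "\<lambda>j m3. ?rows (Suc k) m3 \<and>
      (\<forall>p<j. fst m3 (CHR ''L'' # g) (Suc k * np + p) = min_line mm bb (R p) (Suc k))"
    have "?J (fst m' ''np'' 0) (sem ?b m')"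
    proof (rule For_rule[where I="?J"])
      fix j and m3 :: store
      assume jn: "j < fst m' ''np'' 0" and j: "fst m3 ''p'' 0 = j"
        and N3: "\<And>a. a \<notin> insert ''p'' (wrN (table_body g)) \<Longrightarrow> fst m3 a = fst m' a"
        and R3: "\<And>a. a \<notin> wrR (table_body g) \<Longrightarrow> snd m3 a = snd m' a" and J: "?J j m3"
      have jnp: "j < np" using jn eqs by (simp add: np_def)
      have [simp]: "fst m3 ''p'' 0 = j" "fst m3 ''k'' 0 = k" "fst m3 ''bs'' k = k * np"
          "fst m3 ''bs'' (Suc k) = Suc k * np"
        using j k N3[of "''k''"] N3[of "''bs''"] eqs bs[of k] bs[of "Suc k"] kn'
        by (auto simp: table_body_def Let_def)
      have [simp]: "snd m3 (CHR ''M'' # g) = mm" "snd m3 (CHR ''B'' # g) = bb" "snd m3 (CHR ''R'' # g) = R"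
        using R3 eqs2 by (auto simp: table_body_def Let_def)
      have L: "fst m3 (CHR ''L'' # g) (k * np + j) = min_line mm bb (R j) k" using J jnp by simp
      have sem: "sem (table_body g) m3 = nupd m3 (CHR ''L'' # g) (Suc k * np + j) (min_line mm bb (R j) (Suc k))"
        using L by (simp add: table_body_def Let_def)
      have ne: "k' * np + p \<noteq> Suc k * np + j" if "k' < Suc k" "p < np" for k' p
        using row_less[OF that, of j] by simp
      show "?J (Suc j) (nupd (sem (table_body g) m3) ''p'' 0 (Suc j))"
        unfolding sem using J ne by (auto simp: less_Suc_eq simp del: min_line.simps mult_Suc)
    qed (use I in \<open>auto simp: table_body_def Let_def\<close>)
    then have "?rows (Suc (Suc k)) (sem ?b m')"
      using eqs by (auto simp: less_Suc_eq np_def simp del: min_line.simps mult_Suc sem.simps)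
    then show "?I (Suc k) (nupd (sem ?b m') ''k'' 0 (Suc k))" by (simp del: min_line.simps mult_Suc sem.simps)
  qed (use 1 in \<open>auto simp: table_body_def Let_def\<close>)
  moreover have "fst m1 ''n'' 0 = n" using f1[of "''n''"] by (simp add: n_def)
  moreover have "sem (PFor ''k'' ''n'' ?b) m1 = sem (table_prog g) m" by (simp add: m1_def table_prog_def)
  ultimately show ?thesis using assms(6,7,8) by (metis less_Suc_eq_le)
qed

definition side_prog :: "string \<Rightarrow> prog" where
  "side_prog g = prefix_prog g ;; lines_prog g ;; rho_prog g ;; points_prog g ;; sort_prog g ;; table_prog g"

lemma wr_side [simp]:
  "wrN (side_prog g) = {''k'', ''l'', ''p'', ''q'', CHR ''L'' # g}"
  "wrR (side_prog g) = {CHR ''V'' # g, CHR ''M'' # g, CHR ''B'' # g, CHR ''Q'' # g, CHR ''P'' # g, CHR ''R'' # g}"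
  by (auto simp: side_prog_def)

definition store_net :: "store \<Rightarrow> string \<Rightarrow> path_network \<Rightarrow> bool" where
  "store_net m g P \<longleftrightarrow> valid_network P \<and> fst m ''n'' 0 = len P \<and>
     (\<forall>l\<le>len P. snd m (CHR ''X'' # g) l = pos P l) \<and> (\<forall>e<len P. snd m (CHR ''C'' # g) e = cap P e)"

definition store_sizes :: "store \<Rightarrow> bool" where
  "store_sizes m \<longleftrightarrow> (let n = fst m ''n'' 0 in fst m ''nn'' 0 = 2 * n \<and> fst m ''np'' 0 = Suc (2 * n) \<and>
     (\<forall>k\<le>n. fst m ''bs'' k = k * Suc (2 * n)))"

theorem side_prog:
  fixes m :: store and g :: string
  defines "w \<equiv> snd m (CHR ''W'' # g)" and "i \<equiv> fst m (CHR ''I'' # g) 0"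
    and "f \<equiv> 0 < fst m (CHR ''F'' # g) 0" and "a \<equiv> snd m (CHR ''A'' # g) 0"
  defines "m' \<equiv> sem (side_prog g) m"
  defines "v \<equiv> snd m' (CHR ''V'' # g)"
  assumes net: "store_net m g P" and sz: "store_sizes m"
    and w: "\<And>l. l \<le> len P \<Longrightarrow> 0 \<le> w l" and i: "i \<le> len P" and f: "f \<Longrightarrow> 0 < a" "\<not> f \<Longrightarrow> a = 0"
  shows "side P w i a f (snd m' (CHR ''M'' # g)) (snd m' (CHR ''B'' # g)) (snd m' (CHR ''Q'' # g))
    (snd m' (CHR ''R'' # g)) (\<lambda>k p. fst m' (CHR ''L'' # g) (k * Suc (2 * len P) + p)) (Suc (2 * len P))
    v (\<lambda>l. 0 < v l \<or> f \<and> i \<le> l)"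
proof -
  have P: "valid_network P" and n: "fst m ''n'' 0 = len P"
    and X: "\<And>l. l \<le> len P \<Longrightarrow> snd m (CHR ''X'' # g) l = pos P l"
    and C: "\<And>e. e < len P \<Longrightarrow> snd m (CHR ''C'' # g) e = cap P e"
    using net by (auto simp: store_net_def)
  have cp: "0 < cap P e" if "e < len P" for e using P that by (simp add: valid_network_def)
  define m1 where "m1 = sem (prefix_prog g) m"
  define m2 where "m2 = sem (lines_prog g) m1"
  define m3 where "m3 = sem (rho_prog g) m2"
  define m4 where "m4 = sem (points_prog g) m3"
  define m5 where "m5 = sem (sort_prog g) m4"
  have m': "m' = sem (table_prog g) m5"
    by (simp add: m'_def side_prog_def m1_def m2_def m3_def m4_def m5_def)
  note fr = m1_def m2_def m3_def m4_def m5_def m' sem_frame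
  have N: "fst m1 ''n'' 0 = len P" "fst m2 ''n'' 0 = len P" "fst m3 ''n'' 0 = len P" "fst m4 ''n'' 0 = len P"
    "fst m5 ''n'' 0 = len P" "fst m4 ''nn'' 0 = 2 * len P" "fst m5 ''np'' 0 = Suc (2 * len P)"
    "fst m5 ''bs'' = fst m ''bs''"
    using sz n by (simp_all add: fr store_sizes_def Let_def)
  have V: "snd m1 (CHR ''V'' # g) = v" "snd m2 (CHR ''V'' # g) = v" by (simp_all add: v_def fr)
  have IF: "fst m1 (CHR ''I'' # g) 0 = i" "fst m2 (CHR ''I'' # g) 0 = i"
     "(0 < fst m1 (CHR ''F'' # g) 0) = f" "(0 < fst m2 (CHR ''F'' # g) 0) = f" "snd m1 (CHR ''A'' # g) 0 = a"
    by (simp_all add: fr i_def f_def a_def)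
  have CX: "snd m1 (CHR ''C'' # g) = snd m (CHR ''C'' # g)" "snd m1 (CHR ''X'' # g) = snd m (CHR ''X'' # g)"
    "snd m2 (CHR ''C'' # g) = snd m (CHR ''C'' # g)" "snd m2 (CHR ''X'' # g) = snd m (CHR ''X'' # g)"
    "snd m3 (CHR ''X'' # g) = snd m (CHR ''X'' # g)" "snd m4 (CHR ''X'' # g) = snd m (CHR ''X'' # g)"
    by (simp_all add: fr)
  define mm bb R Pt where "mm = snd m' (CHR ''M'' # g)" and "bb = snd m' (CHR ''B'' # g)"
    and "R = snd m' (CHR ''R'' # g)" and "Pt = snd m4 (CHR ''P'' # g)"
  have MB: "snd m2 (CHR ''M'' # g) = mm" "snd m2 (CHR ''B'' # g) = bb" "snd m3 (CHR ''M'' # g) = mm"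
    "snd m3 (CHR ''B'' # g) = bb" "snd m5 (CHR ''M'' # g) = mm" "snd m5 (CHR ''B'' # g) = bb"
    "snd m5 (CHR ''R'' # g) = R"
    by (simp_all add: mm_def bb_def R_def fr)
  have Q: "snd m3 (CHR ''Q'' # g) = snd m' (CHR ''Q'' # g)" by (simp add: fr)
  have lines0: "mm 0 = 0" "bb 0 = a"
    using lines_prog(1,2)[of m1 g, folded m2_def] C cp unfolding N IF V CX MB by auto
  have lines: "mm (Suc e) = 0 \<and> bb (Suc e) = a \<and> (\<forall>l\<le>e. i \<le> l \<longrightarrow> \<not> (0 < v l \<or> f \<and> i \<le> l)) \<or>
     mm (Suc e) = cap P e \<and> (\<forall>\<beta>. \<beta> \<le> bb (Suc e) \<longleftrightarrow>
        (\<forall>l\<le>e. i \<le> l \<and> (0 < v l \<or> f \<and> i \<le> l) \<longrightarrow> \<beta> \<le> cap P e * pos P l - v l))" if e: "e < len P" for e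
    using lines_prog(3)[of m1 g e, folded m2_def] C cp e X unfolding N IF V CX MB by auto
  have mm0: "0 \<le> mm (Suc k)" if "k < len P" for k using lines[OF that] cp[OF that] by auto
  have rho: "snd m' (CHR ''Q'' # g) k \<le> r \<longleftrightarrow> - pos P (len P) \<le> r \<and>
     (\<forall>e<k. \<forall>l\<le>e. 0 < v l \<or> f \<and> i \<le> l \<longrightarrow> v l / cap P e - pos P l \<le> r)" if k: "k \<le> len P" for k r
    using rho_prog[of k m2 g r, folded m3_def] k X C unfolding N IF V CX Q by (auto simp: X)
  have R0: "R 0 = - pos P (len P)"
    using sort_prog(1)[of g m4, folded m5_def] X unfolding MB CX N by simp
  have ent: "enters mm bb (R 0) k k (Pt k) (Pt (len P + k))" if "k < len P" for k
    using points_prog[of m3 g k, folded m4_def] lines0 mm0 that X unfolding N MB CX R0 Pt_def by simp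
  have srt: "p < 2 * len P \<Longrightarrow> R p \<le> R (Suc p)"
    "p < 2 * len P \<Longrightarrow> q < 2 * len P \<Longrightarrow> \<not> (R p < Pt q \<and> Pt q < R (Suc p))"
    "q < 2 * len P \<Longrightarrow> Pt q \<le> R (2 * len P)" for p q
    using sort_prog(2-4)[where m=m4 and g=g, folded m5_def] unfolding MB N Pt_def by blast+
  have bs: "fst m5 ''bs'' k = k * Suc (2 * len P)" if "k \<le> len P" for k
    using sz n that unfolding N by (simp add: store_sizes_def Let_def)
  have L: "fst m' (CHR ''L'' # g) (k * Suc (2 * len P) + p) = min_line mm bb (R p) k"
    if "k \<le> len P" "p < Suc (2 * len P)" for k p
    using table_prog[of m5 k p g, folded m'] bs that unfolding N MB by blast
  show ?thesis
  proof
    show "\<And>l. l \<le> len P \<Longrightarrow> v l = wsum w 0 l"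
      using prefix_prog[of _ m g, folded m1_def] n unfolding V w_def by simp
    fix k p r assume kp: "k \<le> len P" "p < Suc (2 * len P)" "snd m' (CHR ''R'' # g) p \<le> r"
      "Suc p < Suc (2 * len P) \<longrightarrow> r \<le> snd m' (CHR ''R'' # g) (Suc p)"
    show "snd m' (CHR ''M'' # g) (fst m' (CHR ''L'' # g) (k * Suc (2 * len P) + p)) * r +
       snd m' (CHR ''B'' # g) (fst m' (CHR ''L'' # g) (k * Suc (2 * len P) + p)) =
       rec_nat a (\<lambda>e v. min v (snd m' (CHR ''M'' # g) (Suc e) * r + snd m' (CHR ''B'' # g) (Suc e))) k"
      unfolding L[OF kp(1,2)] mm_def[symmetric] bb_def[symmetric] lines0(2)[symmetric]
      by (rule min_line_correct[of mm "len P" bb R Pt])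
        (use kp lines0 mm0 ent srt in \<open>auto simp: R_def[symmetric]\<close>)
  qed (use P w i f lines0 lines rho R0 srt in \<open>auto simp: mm_def bb_def R_def\<close>)
qed

section \<open>Evaluating the minima at sorted points and optimising for all slopes in one
  scan\<close>

section \<open>Programs for the optimization\<close>

text \<open>A merge of the sorted points \<open>z\<close> with the sorted breakpoints: each round
  advances either the cell or the point. Values are added to \<open>y\<close>, so that one call per
  side yields the sum of both sides.\<close>

definition eval_body :: "string \<Rightarrow> prog" where
  "eval_body g =
    (let r = RMinus (RRead ''z'' (nv ''q'')) (rv ''of'');
         l = NRead (CHR ''L'' # g) (NPlus (NRead ''bs'' (nv ''r'')) (nv ''p''))
     in PWhen (NLess (nv ''q'') (nv ''np''))
       (PIf (BAnd (NLess (nsuc (nv ''p'')) (nv ''np'')) (BNot (RLess r (RRead (CHR ''R'' # g) (nsuc (nv ''p''))))))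
         (PN ''p'' (NConst 0) (nsuc (nv ''p'')))
         (PR ''y'' (nv ''q'') (RPlus (RRead ''y'' (nv ''q''))
            (RPlus (RTimes (RRead (CHR ''M'' # g) l) r) (RRead (CHR ''B'' # g) l))) ;;
          PN ''q'' (NConst 0) (nsuc (nv ''q'')))))"

definition eval_prog :: "string \<Rightarrow> prog" where
  "eval_prog g = PN ''p'' (NConst 0) (NConst 0) ;; PN ''q'' (NConst 0) (NConst 0) ;;
     PFor ''s'' ''ns'' (eval_body g)"

lemma wr_eval [simp]: "wrN (eval_prog g) = {''p'', ''q'', ''s''}" "wrR (eval_prog g) = {''y''}"
  by (auto simp: eval_prog_def eval_body_def Let_def)

lemma eval_prog:
  fixes m :: store and g :: string and Av :: "real \<Rightarrow> real"
  defines "np \<equiv> fst m ''np'' 0" and "d \<equiv> snd m ''of'' 0" and "z \<equiv> snd m ''z''" and "R \<equiv> snd m (CHR ''R'' # g)"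
  defines "l \<equiv> \<lambda>p. fst m (CHR ''L'' # g) (fst m ''bs'' (fst m ''r'' 0) + p)"
  assumes np: "0 < np" and ns: "2 * np \<le> fst m ''ns'' 0"
    and E: "\<And>p r. p < np \<Longrightarrow> R p \<le> r \<Longrightarrow> (Suc p < np \<longrightarrow> r \<le> R (Suc p)) \<Longrightarrow>
       snd m (CHR ''M'' # g) (l p) * r + snd m (CHR ''B'' # g) (l p) = Av r"
    and z0: "\<And>q. q < np \<Longrightarrow> R 0 \<le> z q - d"
    and zs: "\<And>q q'. q \<le> q' \<Longrightarrow> q' < np \<Longrightarrow> z q \<le> z q'"
    and q: "q < np"
  shows "snd (sem (eval_prog g) m) ''y'' q = snd m ''y'' q + Av (z q - d)"
proof -
  define m1 where "m1 = sem (PN ''p'' (NConst 0) (NConst 0) ;; PN ''q'' (NConst 0) (NConst 0)) m"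
  let ?p = "eval_body g"
  \<comment> \<open>While points remain, \<open>s \<le> p + q\<close> holds; with both pointers
    below \<open>np\<close> this fails after \<open>2 * np\<close> rounds, so by then all points
    have been served.\<close>
  let ?I = "\<lambda>s m'. let p = fst m' ''p'' 0; q = fst m' ''q'' 0 in p < np \<and> q \<le> np \<and> (q < np \<longrightarrow> s \<le> p + q) \<and>
     (\<forall>q'. q \<le> q' \<longrightarrow> q' < np \<longrightarrow> R p \<le> z q' - d) \<and>
     (\<forall>q'. snd m' ''y'' q' = (if q' < q then snd m ''y'' q' + Av (z q' - d) else snd m ''y'' q'))"
  have "?I (fst m1 ''ns'' 0) (sem (PFor ''s'' ''ns'' ?p) m1)"
  proof (rule For_rule[where I="?I"])
    fix s and m' :: store
    assume N: "\<And>a. a \<notin> insert ''s'' (wrN ?p) \<Longrightarrow> fst m' a = fst m1 a"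
      and S: "\<And>a. a \<notin> wrR ?p \<Longrightarrow> snd m' a = snd m1 a" and I: "?I s m'"
    define p q where "p = fst m' ''p'' 0" and "q = fst m' ''q'' 0"
    have I': "p < np" "q \<le> np" "q < np \<longrightarrow> s \<le> p + q"
      "\<forall>q'. q \<le> q' \<longrightarrow> q' < np \<longrightarrow> R p \<le> z q' - d"
      "\<forall>q'. snd m' ''y'' q' = (if q' < q then snd m ''y'' q' + Av (z q' - d) else snd m ''y'' q')"
      using I by (auto simp: Let_def p_def q_def)
    have [simp]: "fst m' ''p'' 0 = p" "fst m' ''q'' 0 = q" by (simp_all add: p_def q_def)
    have [simp]: "fst m' ''np'' 0 = np" "fst m' (CHR ''L'' # g) (fst m' ''bs'' (fst m' ''r'' 0) + p) = l p"
      using N by (auto simp: eval_body_def Let_def m1_def np_def l_def)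
    have [simp]: "snd m' ''z'' = z" "snd m' ''of'' 0 = d" "snd m' (CHR ''R'' # g) = R"
      "snd m' (CHR ''M'' # g) = snd m (CHR ''M'' # g)" "snd m' (CHR ''B'' # g) = snd m (CHR ''B'' # g)"
      using S by (auto simp: eval_body_def Let_def m1_def z_def d_def R_def)
    show "?I (Suc s) (nupd (sem ?p m') ''s'' 0 (Suc s))"
    proof (cases "q < np")
      case False
      then have "sem ?p m' = m'" by (simp add: eval_body_def Let_def)
      then show ?thesis using I' False by (simp add: Let_def)
    next
      case True
      show ?thesis
      proof (cases "Suc p < np \<and> R (Suc p) \<le> z q - d")
        case T: True
        then have sem: "sem ?p m' = nupd m' ''p'' 0 (Suc p)"
          using True by (simp add: eval_body_def Let_def not_less)
        have "R (Suc p) \<le> z q' - d" if "q \<le> q'" "q' < np" for q'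
          using zs[OF that] T by linarith
        then show ?thesis using I' T True unfolding sem by (simp add: Let_def)
      next
        case F: False
        have v: "snd m (CHR ''M'' # g) (l p) * (z q - d) + snd m (CHR ''B'' # g) (l p) = Av (z q - d)"
          by (rule E) (use I' F True in auto)
        have sem: "sem ?p m' = nupd (rupd m' ''y'' q (snd m ''y'' q + Av (z q - d))) ''q'' 0 (Suc q)"
          using True F I'(5) by (auto simp: eval_body_def Let_def not_less v)
        show ?thesis using I' True unfolding sem by (simp add: Let_def less_Suc_eq)
      qed
    qed
  qed (use np z0 in \<open>auto simp: m1_def eval_body_def Let_def\<close>)
  then have "?I (fst m ''ns'' 0) (sem (eval_prog g) m)" by (simp add: m1_def eval_prog_def)
  then show ?thesis using ns q by (auto simp: Let_def split: if_splits)
qed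

definition best_body :: "string \<Rightarrow> prog" where
  "best_body g =
    (let v = (\<lambda>p. RMinus (RTimes (RRead ''cq'' (nv ''u'')) (RRead ''y'' p)) (RTimes (rv ''ka'') (RRead ''z'' p)))
     in PWhen (NLess (nv ''u'') (nv ''t''))
       (PIf (BAnd (NLess (nsuc (nv ''p'')) (nv ''np'')) (BNot (RLess (v (nsuc (nv ''p''))) (v (nv ''p'')))))
         (PN ''p'' (NConst 0) (nsuc (nv ''p'')))
         (PR (CHR ''Y'' # g) (nv ''u'') (RRead ''y'' (nv ''p'')) ;;
          PR (CHR ''Z'' # g) (nv ''u'') (RRead ''z'' (nv ''p'')) ;;
          PN ''u'' (NConst 0) (nsuc (nv ''u'')))))"

definition best_prog :: "string \<Rightarrow> prog" where
  "best_prog g = PN ''p'' (NConst 0) (NConst 0) ;; PN ''u'' (NConst 0) (NConst 0) ;;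
     PFor ''s'' ''ns'' (best_body g)"

lemma wr_best [simp]: "wrN (best_prog g) = {''p'', ''u'', ''s''}"
  "wrR (best_prog g) = {CHR ''Y'' # g, CHR ''Z'' # g}"
  by (auto simp: best_prog_def best_body_def Let_def)

text \<open>The optimal point moves to the right as the slope increases, so one pointer suffices for all
  slopes.\<close>

lemma best_prog:
  fixes m :: store and g :: string
  defines "np \<equiv> fst m ''np'' 0" and "t \<equiv> fst m ''t'' 0" and "z \<equiv> snd m ''z''" and "y \<equiv> snd m ''y''"
    and "m2 \<equiv> sem (best_prog g) m"
  defines "val \<equiv> \<lambda>u p. snd m ''cq'' u * y p - snd m ''ka'' 0 * z p"
  assumes np: "0 < np" and ns: "np + t \<le> fst m ''ns'' 0"
    and y: "\<And>p p'. p \<le> p' \<Longrightarrow> p' < np \<Longrightarrow> y p \<le> y p'"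
    and cq: "\<And>u u'. u \<le> u' \<Longrightarrow> u' < t \<Longrightarrow> snd m ''cq'' u \<le> snd m ''cq'' u'"
    and qc: "\<And>u p p'. u < t \<Longrightarrow> Suc p \<le> p' \<Longrightarrow> p' < np \<Longrightarrow> val u (Suc p) < val u p \<Longrightarrow> val u p' \<le> val u p"
    and u: "u < t"
  shows "\<exists>p<np. snd m2 (CHR ''Y'' # g) u = y p \<and> snd m2 (CHR ''Z'' # g) u = z p \<and>
    (\<forall>p'<np. val u p' \<le> val u p)"
proof -
  define m1 where "m1 = sem (PN ''p'' (NConst 0) (NConst 0) ;; PN ''u'' (NConst 0) (NConst 0)) m"
  let ?p = "best_body g"
  let ?ok = "\<lambda>m' u. \<exists>p<np. snd m' (CHR ''Y'' # g) u = y p \<and> snd m' (CHR ''Z'' # g) u = z p \<and>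
    (\<forall>p'<np. val u p' \<le> val u p)"
  let ?I = "\<lambda>s m'. let p = fst m' ''p'' 0; u = fst m' ''u'' 0 in p < np \<and> u \<le> t \<and> (u < t \<longrightarrow> s \<le> p + u) \<and>
     (\<forall>u' p'. u \<le> u' \<longrightarrow> u' < t \<longrightarrow> p' \<le> p \<longrightarrow> val u' p' \<le> val u' p) \<and> (\<forall>u'<u. ?ok m' u')"
  have "?I (fst m1 ''ns'' 0) (sem (PFor ''s'' ''ns'' ?p) m1)"
  proof (rule For_rule[where I="?I"])
    fix s and m' :: store
    assume N: "\<And>a. a \<notin> insert ''s'' (wrN ?p) \<Longrightarrow> fst m' a = fst m1 a"
      and S: "\<And>a. a \<notin> wrR ?p \<Longrightarrow> snd m' a = snd m1 a" and I: "?I s m'"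
    define p u where "p = fst m' ''p'' 0" and "u = fst m' ''u'' 0"
    have I': "p < np" "u \<le> t" "u < t \<longrightarrow> s \<le> p + u"
      "\<And>u' p'. u \<le> u' \<Longrightarrow> u' < t \<Longrightarrow> p' \<le> p \<Longrightarrow> val u' p' \<le> val u' p" "\<forall>u'<u. ?ok m' u'"
      using I by (auto simp: Let_def p_def u_def)
    have [simp]: "fst m' ''p'' 0 = p" "fst m' ''u'' 0 = u" by (simp_all add: p_def u_def)
    have [simp]: "fst m' ''np'' 0 = np" "fst m' ''t'' 0 = t"
      using N by (auto simp: best_body_def Let_def m1_def np_def t_def)
    have [simp]: "snd m' ''z'' = z" "snd m' ''y'' = y" "snd m' ''cq'' = snd m ''cq''" "snd m' ''ka'' = snd m ''ka''"
      using S by (auto simp: best_body_def Let_def m1_def z_def y_def)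
    show "?I (Suc s) (nupd (sem ?p m') ''s'' 0 (Suc s))"
    proof (cases "u < t")
      case False
      then have "sem ?p m' = m'" by (simp add: best_body_def Let_def)
      then show ?thesis using I' False by (simp add: Let_def)
    next
      case True
      show ?thesis
      proof (cases "Suc p < np \<and> \<not> val u (Suc p) < val u p")
        case T: True
        then have sem: "sem ?p m' = nupd m' ''p'' 0 (Suc p)"
          using True by (simp add: best_body_def Let_def val_def)
        have "val u' p' \<le> val u' (Suc p)" if u': "u \<le> u'" "u' < t" "p' \<le> Suc p" for u' p'
        proof -
          \<comment> \<open>Changing the slope from that of \<open>u\<close> to that of
            \<open>u'\<close> changes the gain of the step from \<open>p\<close> to
            \<open>Suc p\<close> by exactly this product. A step that does not hurt at slope
            \<open>u\<close> therefore does not hurt at any later slope.\<close>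
          have "0 \<le> (snd m ''cq'' u' - snd m ''cq'' u) * (y (Suc p) - y p)"
            using cq[OF u'(1,2)] y[of p "Suc p"] T by (intro mult_nonneg_nonneg) auto
          then have "val u' p \<le> val u' (Suc p)" using T by (simp add: val_def algebra_simps)
          then show ?thesis using I'(4)[OF u'(1,2), of p'] u'(3) by (cases "p' = Suc p") auto
        qed
        then show ?thesis using I' T True unfolding sem by (simp add: Let_def)
      next
        case F: False
        \<comment> \<open>Points already passed are no better by the invariant; later ones are
          excluded by \<open>qc\<close>, since the next step would strictly lose or there is
          none.\<close>
        have best: "val u p' \<le> val u p" if "p' < np" for p'
        proof (cases "p' \<le> p")
          case True
          then show ?thesis using I'(4)[of u p'] \<open>u < t\<close> by simp
        next
          case False
          then show ?thesis using F that by (intro qc[OF True, of p p']) auto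
        qed
        have sem: "sem ?p m' = nupd (rupd (rupd m' (CHR ''Y'' # g) u (y p)) (CHR ''Z'' # g) u (z p)) ''u'' 0 (Suc u)"
          using True F by (auto simp: best_body_def Let_def val_def)
        have "?ok (nupd (sem ?p m') ''s'' 0 (Suc s)) u'" if "u' < Suc u" for u'
        proof (cases "u' = u")
          case True
          then show ?thesis using best I'(1) unfolding sem by (auto intro: exI[of _ p])
        next
          case False
          then show ?thesis using I'(5) that unfolding sem by (simp add: less_Suc_eq)
        qed
        then show ?thesis using I' True unfolding sem by (simp add: Let_def)
      qed
    qed
  qed (use np in \<open>auto simp: m1_def best_body_def Let_def\<close>)
  then have "?I (fst m ''ns'' 0) m2" by (simp add: m1_def best_prog_def m2_def)
  then have *: "fst m2 ''u'' 0 = t \<Longrightarrow> ?ok m2 u" "fst m2 ''u'' 0 \<le> t" "fst m2 ''p'' 0 < np"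
    "fst m2 ''u'' 0 < t \<longrightarrow> fst m ''ns'' 0 \<le> fst m2 ''p'' 0 + fst m2 ''u'' 0"
    using u by (auto simp: Let_def)
  \<comment> \<open>Otherwise the sum of the two pointers, which is less than \<open>np + t\<close>,
    would be at least the number of rounds.\<close>
  then have "fst m2 ''u'' 0 = t" using ns by linarith
  then show ?thesis by (rule *(1))
qed

text \<open>\<open>sh\<close> translates breakpoints into the coordinate of the search and
  \<open>ze\<close> clips them at its least admissible value. Clipping keeps the points sorted and
  makes each of them admissible.\<close>

definition chain_prog :: "string \<Rightarrow> prog" where
  "chain_prog g = PFor ''p'' ''np''
     (PR ''z'' (nv ''p'') (RPlus (RRead (CHR ''R'' # g) (nv ''p'')) (rv ''sh'')) ;;
      PWhen (RLess (RRead ''z'' (nv ''p'')) (rv ''ze'')) (PR ''z'' (nv ''p'') (rv ''ze'')) ;;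
      PR ''y'' (nv ''p'') (RConst 0))"

lemma wr_chain [simp]: "wrN (chain_prog g) = {''p''}" "wrR (chain_prog g) = {''z'', ''y''}"
  by (auto simp: chain_prog_def)

lemma chain_prog:
  fixes m :: store and g :: string
  defines "m2 \<equiv> sem (chain_prog g) m"
  assumes "p < fst m ''np'' 0"
  shows "snd m2 ''z'' p = max (snd m (CHR ''R'' # g) p + snd m ''sh'' 0) (snd m ''ze'' 0)"
    and "snd m2 ''y'' p = 0"
proof -
  let ?b = "PR ''z'' (nv ''p'') (RPlus (RRead (CHR ''R'' # g) (nv ''p'')) (rv ''sh'')) ;;
      PWhen (RLess (RRead ''z'' (nv ''p'')) (rv ''ze'')) (PR ''z'' (nv ''p'') (rv ''ze'')) ;;
      PR ''y'' (nv ''p'') (RConst 0)"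
  let ?I = "\<lambda>k m'. \<forall>p<k. snd m' ''z'' p = max (snd m (CHR ''R'' # g) p + snd m ''sh'' 0) (snd m ''ze'' 0) \<and>
     snd m' ''y'' p = 0"
  have "?I (fst m ''np'' 0) (sem (PFor ''p'' ''np'' ?b) m)"
  proof (rule For_rule[where I="?I"])
    fix k and m' :: store
    assume k: "fst m' ''p'' 0 = k" and R: "\<And>a. a \<notin> wrR ?b \<Longrightarrow> snd m' a = snd m a" and I: "?I k m'"
    have [simp]: "snd m' (CHR ''R'' # g) = snd m (CHR ''R'' # g)" "snd m' ''sh'' = snd m ''sh''"
      "snd m' ''ze'' = snd m ''ze''" using R by auto
    show "?I (Suc k) (nupd (sem ?b m') ''p'' 0 (Suc k))"
      using I k by (auto simp: less_Suc_eq max_def)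
  qed auto
  then show "snd m2 ''z'' p = max (snd m (CHR ''R'' # g) p + snd m ''sh'' 0) (snd m ''ze'' 0)"
    "snd m2 ''y'' p = 0"
    using assms unfolding m2_def chain_prog_def by blast+
qed

subsection \<open>Maintaining the maximum of the candidates\<close>

text \<open>\<open>out\<close> is the maximum of the candidates so far and \<open>o\<close> tells whether there were any; \<open>S\<close> are the
  candidates seen between \<open>m\<close> and \<open>m'\<close>.\<close>

definition improves :: "store \<Rightarrow> store \<Rightarrow> real set \<Rightarrow> bool" where
  "improves m m' S \<longleftrightarrow>
     (0 < fst m ''o'' 0 \<longrightarrow> 0 < fst m' ''o'' 0 \<and> snd m ''out'' 0 \<le> snd m' ''out'' 0) \<and>
     (\<forall>v\<in>S. 0 < fst m' ''o'' 0 \<and> v \<le> snd m' ''out'' 0) \<and>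
     (\<forall>U. (0 < fst m ''o'' 0 \<longrightarrow> snd m ''out'' 0 \<le> U) \<longrightarrow> (\<forall>v\<in>S. v \<le> U) \<longrightarrow>
        0 < fst m' ''o'' 0 \<longrightarrow> snd m' ''out'' 0 \<le> U)"

lemma improves_refl: "fst m' ''o'' 0 = fst m ''o'' 0 \<Longrightarrow> snd m' ''out'' 0 = snd m ''out'' 0 \<Longrightarrow> improves m m' {}"
  by (simp add: improves_def)

lemma improves_trans:
  assumes 1: "improves m m1 S" and 2: "improves m1 m2 S'"
  shows "improves m m2 (S \<union> S')"
  unfolding improves_def
proof (intro conjI ballI allI impI)
  note 1 = 1[unfolded improves_def] and 2 = 2[unfolded improves_def]
  show "0 < fst m2 ''o'' 0" "snd m ''out'' 0 \<le> snd m2 ''out'' 0" if "0 < fst m ''o'' 0"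
    using that 1 2 by auto
  show "0 < fst m2 ''o'' 0" "v \<le> snd m2 ''out'' 0" if "v \<in> S \<union> S'" for v
    using that 1 2 by force+
  fix U assume U: "0 < fst m ''o'' 0 \<longrightarrow> snd m ''out'' 0 \<le> U" "\<forall>v\<in>S \<union> S'. v \<le> U" "0 < fst m2 ''o'' 0"
  then have "0 < fst m1 ''o'' 0 \<longrightarrow> snd m1 ''out'' 0 \<le> U" using 1 by simp
  then show "snd m2 ''out'' 0 \<le> U" using 2 U by simp
qed

lemma improves_cong:
  assumes "improves m m' S" "fst m1 ''o'' 0 = fst m ''o'' 0" "snd m1 ''out'' 0 = snd m ''out'' 0"
    "fst m2 ''o'' 0 = fst m' ''o'' 0" "snd m2 ''out'' 0 = snd m' ''out'' 0"
  shows "improves m1 m2 S"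
  using assms by (simp add: improves_def)

definition upd_prog :: "rexp \<Rightarrow> prog" where
  "upd_prog e = PWhen (BOr (BNot (NLess (NConst 0) (nv ''o''))) (RLess (rv ''out'') e))
     (PR ''out'' (NConst 0) e ;; PN ''o'' (NConst 0) (NConst 1))"

lemma wr_upd [simp]: "wrN (upd_prog e) = {''o''}" "wrR (upd_prog e) = {''out''}"
  by (auto simp: upd_prog_def)

lemma upd_prog: "improves m (sem (upd_prog e) m) {rval e m}"
  by (auto simp: improves_def upd_prog_def)

text \<open>The loop runs to \<open>n\<close> with a guard: \<open>t\<close> is computed by the
  program itself and so cannot serve as a loop bound.\<close>

lemma upd_loop:
  fixes m :: store and b :: bexp and e :: rexp
  defines "p \<equiv> PWhen (BAnd (NLess (nv ''u'') (nv ''t'')) b) (upd_prog e)"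
  assumes t: "fst m ''t'' 0 \<le> fst m ''n'' 0"
    and b: "\<And>m' u. (\<forall>a. a \<noteq> ''u'' \<longrightarrow> a \<noteq> ''o'' \<longrightarrow> fst m' a = fst m a) \<Longrightarrow> (\<forall>a. a \<noteq> ''out'' \<longrightarrow> snd m' a = snd m a) \<Longrightarrow>
       fst m' ''u'' 0 = u \<Longrightarrow> bval b m' = bb u \<and> rval e m' = ee u"
  shows "improves m (sem (PFor ''u'' ''n'' p) m) {ee u | u. u < fst m ''t'' 0 \<and> bb u}"
proof -
  let ?I = "\<lambda>j m'. improves m m' {ee u | u. u < j \<and> u < fst m ''t'' 0 \<and> bb u}"
  have "?I (fst m ''n'' 0) (sem (PFor ''u'' ''n'' p) m)"
  proof (rule For_rule[where I="?I"])
    fix j and m' :: store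
    assume j: "fst m' ''u'' 0 = j" and N: "\<And>a. a \<notin> insert ''u'' (wrN p) \<Longrightarrow> fst m' a = fst m a"
      and R: "\<And>a. a \<notin> wrR p \<Longrightarrow> snd m' a = snd m a" and I: "?I j m'"
    have be: "bval b m' = bb j" "rval e m' = ee j"
      using b[of m' j] N R j by (auto simp: p_def)
    have tt: "fst m' ''t'' = fst m ''t''" using N by (simp add: p_def)
    let ?S = "if j < fst m ''t'' 0 \<and> bb j then {ee j} else {}"
    have "improves m' (sem p m') ?S"
    proof (cases "j < fst m ''t'' 0 \<and> bb j")
      case True
      then have "sem p m' = sem (upd_prog e) m'" using be tt j by (simp add: p_def)
      then show ?thesis using upd_prog[of m' e] be True by simp
    next
      case False
      then have "sem p m' = m'" using be tt j by (auto simp: p_def)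
      moreover have "?S = {}" using False by auto
      ultimately show ?thesis using improves_refl[of m' m'] by simp
    qed
    from improves_trans[OF I this]
    have "improves m (sem p m') ({ee u | u. u < j \<and> u < fst m ''t'' 0 \<and> bb u} \<union> ?S)" .
    also have "{ee u | u. u < j \<and> u < fst m ''t'' 0 \<and> bb u} \<union> ?S = {ee u | u. u < Suc j \<and> u < fst m ''t'' 0 \<and> bb u}"
      by (auto simp: less_Suc_eq)
    finally show "?I (Suc j) (nupd (sem p m') ''u'' 0 (Suc j))"
      by (rule improves_cong) auto
  qed (auto simp: p_def improves_def)
  moreover have "{ee u | u. u < fst m ''n'' 0 \<and> u < fst m ''t'' 0 \<and> bb u} = {ee u | u. u < fst m ''t'' 0 \<and> bb u}"
    using t by auto
  ultimately show ?thesis by simp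
qed

text \<open>If the value at \<open>c\<close> exceeded that at \<open>a\<close>, the chord over
  \<open>{a..c}\<close> would lie at or above the value at \<open>a\<close>, and a concave function
  would too, contradicting the drop at \<open>b\<close>.\<close>

lemma concave_descent:
  fixes \<Phi> :: "real \<Rightarrow> real"
  assumes conc: "\<And>t r r'. 0 \<le> t \<Longrightarrow> t \<le> 1 \<Longrightarrow> (1 - t) * \<Phi> r + t * \<Phi> r' \<le> \<Phi> ((1 - t) * r + t * r')"
    and q: "0 \<le> q" and ab: "a \<le> b" "b \<le> c" and less: "q * \<Phi> b - \<kappa> * b < q * \<Phi> a - \<kappa> * a"
  shows "q * \<Phi> c - \<kappa> * c \<le> q * \<Phi> a - \<kappa> * a"
proof (rule ccontr)
  assume h: "\<not> q * \<Phi> c - \<kappa> * c \<le> q * \<Phi> a - \<kappa> * a"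
  have ac: "a < c" using ab less by (cases "a = b") auto
  \<comment> \<open>The weight that writes \<open>b\<close> as a convex combination of
    \<open>a\<close> and \<open>c\<close>.\<close>
  define t where "t = (b - a) / (c - a)"
  have t: "0 \<le> t" "t \<le> 1" using ab ac by (auto simp: t_def divide_le_eq_1)
  have "t * (c - a) = b - a" using ac by (simp add: t_def)
  then have b: "(1 - t) * a + t * c = b" by (simp add: algebra_simps)
  have "q * ((1 - t) * \<Phi> a + t * \<Phi> c) \<le> q * \<Phi> b"
    using conc[OF t, of a c] q unfolding b by (intro mult_left_mono)
  moreover have "\<kappa> * ((1 - t) * a + t * c) = \<kappa> * b" unfolding b ..
  ultimately have "(1 - t) * (q * \<Phi> a - \<kappa> * a) + t * (q * \<Phi> c - \<kappa> * c) \<le> q * \<Phi> b - \<kappa> * b"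
    by (simp add: algebra_simps)
  moreover have "t * (q * \<Phi> a - \<kappa> * a) \<le> t * (q * \<Phi> c - \<kappa> * c)"
    using h t by (intro mult_left_mono) auto
  ultimately have "q * \<Phi> a - \<kappa> * a \<le> q * \<Phi> b - \<kappa> * b" by (simp add: algebra_simps)
  then show False using less by simp
qed

definition store_slopes :: "store \<Rightarrow> bool" where
  "store_slopes m \<longleftrightarrow> (\<forall>u' < fst m ''t'' 0. 0 \<le> snd m ''cq'' u' \<and> (\<forall>u\<le>u'. snd m ''cq'' u \<le> snd m ''cq'' u')) \<and>
     fst m ''np'' 0 + fst m ''t'' 0 \<le> fst m ''ns'' 0 \<and> fst m ''t'' 0 \<le> fst m ''n'' 0"

lemma best_concave:
  fixes m :: store and g :: string and \<Phi> :: "real \<Rightarrow> real"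
  defines "z \<equiv> snd m ''z''" and "np \<equiv> fst m ''np'' 0" and "m2 \<equiv> sem (best_prog g) m"
  assumes sl: "store_slopes m" and np: "0 < np"
    and z: "\<And>p p'. p \<le> p' \<Longrightarrow> p' < np \<Longrightarrow> z p \<le> z p'"
    and y: "\<And>p. p < np \<Longrightarrow> snd m ''y'' p = \<Phi> (z p)"
    and mono: "\<And>r r'. r \<le> r' \<Longrightarrow> \<Phi> r \<le> \<Phi> r'"
    and conc: "\<And>t r r'. 0 \<le> t \<Longrightarrow> t \<le> 1 \<Longrightarrow> (1 - t) * \<Phi> r + t * \<Phi> r' \<le> \<Phi> ((1 - t) * r + t * r')"
    and u: "u < fst m ''t'' 0"
  shows "\<exists>p<np. snd m2 (CHR ''Y'' # g) u = \<Phi> (z p) \<and> snd m2 (CHR ''Z'' # g) u = z p \<and>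
    (\<forall>p'<np. snd m ''cq'' u * \<Phi> (z p') - snd m ''ka'' 0 * z p' \<le> snd m ''cq'' u * \<Phi> (z p) - snd m ''ka'' 0 * z p)"
proof -
  have "\<exists>p<np. snd m2 (CHR ''Y'' # g) u = snd m ''y'' p \<and> snd m2 (CHR ''Z'' # g) u = z p \<and>
    (\<forall>p'<np. snd m ''cq'' u * snd m ''y'' p' - snd m ''ka'' 0 * z p' \<le> snd m ''cq'' u * snd m ''y'' p - snd m ''ka'' 0 * z p)"
    unfolding np_def z_def m2_def
  proof (rule best_prog)
    show "0 < fst m ''np'' 0" "fst m ''np'' 0 + fst m ''t'' 0 \<le> fst m ''ns'' 0" "u < fst m ''t'' 0"
      using np sl u by (auto simp: np_def store_slopes_def)
    show "snd m ''cq'' u \<le> snd m ''cq'' u'" if "u \<le> u'" "u' < fst m ''t'' 0" for u u'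
      using sl that by (auto simp: store_slopes_def)
    show "snd m ''y'' p \<le> snd m ''y'' p'" if "p \<le> p'" "p' < fst m ''np'' 0" for p p'
      using that y z mono by (simp add: np_def)
    fix u p p'
    assume h: "u < fst m ''t'' 0" "Suc p \<le> p'" "p' < fst m ''np'' 0"
      "snd m ''cq'' u * snd m ''y'' (Suc p) - snd m ''ka'' 0 * snd m ''z'' (Suc p)
       < snd m ''cq'' u * snd m ''y'' p - snd m ''ka'' 0 * snd m ''z'' p"
    have "0 \<le> snd m ''cq'' u" using sl h by (auto simp: store_slopes_def)
    then show "snd m ''cq'' u * snd m ''y'' p' - snd m ''ka'' 0 * snd m ''z'' p'
       \<le> snd m ''cq'' u * snd m ''y'' p - snd m ''ka'' 0 * snd m ''z'' p"
      using concave_descent[OF conc, of "snd m ''cq'' u" "z p" "z (Suc p)" "z p'" "snd m ''ka'' 0"] h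
        z[of p "Suc p"] z[of "Suc p" p'] y by (simp add: np_def z_def)
  qed
  then show ?thesis using y by auto
qed

definition (in side) side_stored :: "store \<Rightarrow> string \<Rightarrow> bool" where
  "side_stored m g \<longleftrightarrow> snd m (CHR ''M'' # g) = mm \<and> snd m (CHR ''B'' # g) = bb \<and> snd m (CHR ''Q'' # g) = rho \<and>
     snd m (CHR ''R'' # g) = R \<and> (\<forall>k\<le>len P. \<forall>p<np. fst m (CHR ''L'' # g) (fst m ''bs'' k + p) = L k p) \<and>
     fst m ''np'' 0 = np \<and> 2 * np \<le> fst m ''ns'' 0"

lemma (in side) eval_A:
  assumes st: "side_stored m g" and k: "fst m ''r'' 0 = k" "k \<le> len P"
    and z0: "\<And>q. q < np \<Longrightarrow> - pos P (len P) \<le> snd m ''z'' q - snd m ''of'' 0"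
    and zs: "\<And>q q'. q \<le> q' \<Longrightarrow> q' < np \<Longrightarrow> snd m ''z'' q \<le> snd m ''z'' q'"
    and q: "q < np"
  shows "snd (sem (eval_prog g) m) ''y'' q = snd m ''y'' q + A k (snd m ''z'' q - snd m ''of'' 0)"
proof (rule eval_prog)
  fix p r assume "p < fst m ''np'' 0" "snd m (CHR ''R'' # g) p \<le> r"
    "Suc p < fst m ''np'' 0 \<longrightarrow> r \<le> snd m (CHR ''R'' # g) (Suc p)"
  then show "snd m (CHR ''M'' # g) (fst m (CHR ''L'' # g) (fst m ''bs'' (fst m ''r'' 0) + p)) * r +
      snd m (CHR ''B'' # g) (fst m (CHR ''L'' # g) (fst m ''bs'' (fst m ''r'' 0) + p)) = A k r"
    using st k L_A[of k p r] by (simp add: side_stored_def)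
qed (use st np R_0 z0 zs q in \<open>auto simp: side_stored_def\<close>)

definition edge_pass :: "string \<Rightarrow> nexp \<Rightarrow> prog" where
  "edge_pass g e = PN ''r'' (NConst 0) e ;; PR ''ze'' (NConst 0) (RRead (CHR ''Q'' # g) (nv ''r'')) ;;
     chain_prog g ;; eval_prog g ;; best_prog g"

lemma wr_edge_pass [simp]: "wrN (edge_pass g e) = {''p'', ''q'', ''u'', ''s'', ''r''}"
  "wrR (edge_pass g e) = {''ze'', ''z'', ''y'', CHR ''Y'' # g, CHR ''Z'' # g}"
  by (auto simp: edge_pass_def)

lemma (in side) edge_pass:
  fixes m :: store and g :: string and e :: nexp
  defines "m' \<equiv> sem (edge_pass g e) m"
  assumes st: "side_stored m g" and sl: "store_slopes m" and k: "nval e m = k" "k \<le> len P"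
    and c: "snd m ''sh'' 0 = 0" "snd m ''of'' 0 = 0" "snd m ''ka'' 0 = 1 / 2" and u: "u < fst m ''t'' 0"
  obtains r where "rho k \<le> r" "snd m' (CHR ''Z'' # g) u = r" "snd m' (CHR ''Y'' # g) u = A k r"
    "\<And>r'. rho k \<le> r' \<Longrightarrow> snd m ''cq'' u * A k r' - r' / 2 \<le> snd m ''cq'' u * A k r - r / 2"
proof -
  define m1 where "m1 = sem (PN ''r'' (NConst 0) e ;; PR ''ze'' (NConst 0) (RRead (CHR ''Q'' # g) (nv ''r''))) m"
  define m2 where "m2 = sem (chain_prog g) m1"
  define m3 where "m3 = sem (eval_prog g) m2"
  have m': "m' = sem (best_prog g) m3" by (simp add: m'_def edge_pass_def m1_def m2_def m3_def)
  note fr = m2_def m3_def sem_frame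
  have N1: "fst m1 a = fst m a" if "a \<noteq> ''r''" for a using that by (simp add: m1_def)
  have R1: "snd m1 a = snd m a" if "a \<noteq> ''ze''" for a using that by (simp add: m1_def)
  have v1: "snd m1 ''ze'' 0 = rho k" "fst m1 ''r'' 0 = k" "snd m1 ''sh'' 0 = 0"
    using st k c by (simp_all add: m1_def side_stored_def)
  have np': "fst m ''np'' 0 = np" "fst m1 ''np'' 0 = np" using st N1 by (simp_all add: side_stored_def)
  have z: "snd m2 ''z'' p = max (R p) (rho k)" "snd m2 ''y'' p = 0" if "p < np" for p
    using chain_prog[of p m1 g] that st R1 np' v1 by (simp_all add: m2_def side_stored_def)
  have zs: "snd m2 ''z'' p \<le> snd m2 ''z'' p'" if "p \<le> p'" "p' < np" for p p'
    using that R_mono[OF that] z by (simp add: max.coboundedI1 max.mono)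
  have st2: "side_stored m2 g" using st N1 R1 by (simp add: side_stored_def fr)
  have of2: "snd m2 ''of'' 0 = 0" "fst m2 ''r'' 0 = k" using c R1 v1 by (simp_all add: fr)
  have y3: "snd m3 ''y'' p = A k (snd m2 ''z'' p)" if "p < np" for p
    using eval_A[OF st2 of2(2) k(2), of p] zs z that rho_ge[OF k(2)] of2
    by (simp add: m3_def max.coboundedI2 le_max_iff_disj)
  have sl3: "store_slopes m3" using sl N1 R1 by (simp add: store_slopes_def fr)
  have z3: "snd m3 ''z'' = snd m2 ''z''" "fst m3 ''np'' 0 = np" "snd m3 ''cq'' = snd m ''cq''"
    "snd m3 ''ka'' 0 = 1 / 2" "fst m3 ''t'' = fst m ''t''" using np' N1 R1 c by (simp_all add: fr)
  obtain p where p: "p < np" "snd m' (CHR ''Y'' # g) u = A k (snd m2 ''z'' p)"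
      "snd m' (CHR ''Z'' # g) u = snd m2 ''z'' p"
      "\<And>p'. p' < np \<Longrightarrow> snd m ''cq'' u * A k (snd m2 ''z'' p') - 1 / 2 * snd m2 ''z'' p'
         \<le> snd m ''cq'' u * A k (snd m2 ''z'' p) - 1 / 2 * snd m2 ''z'' p"
    using best_concave[of m3 "A k" u g, folded m', unfolded z3, OF sl3 np zs y3 A_mono[OF k(2)] A_concave u] by blast
  have q: "0 \<le> snd m ''cq'' u" using sl u by (auto simp: store_slopes_def)
  show ?thesis
  proof (rule that[of "snd m2 ''z'' p"])
    show "rho k \<le> snd m2 ''z'' p" using z p(1) by simp
    show "snd m ''cq'' u * A k r' - r' / 2 \<le> snd m ''cq'' u * A k (snd m2 ''z'' p) - snd m2 ''z'' p / 2"
      if "rho k \<le> r'" for r'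
      by (rule optimum_on_breakpoints[OF k(2) q _ that]) (use p(4) z in force)
  qed (use p in simp_all)
qed

text \<open>Candidates come from the breakpoints of one side only, so they are already sorted; a
  second pass for the other side replaces merging the two lists. The guard \<open>0 < 1\<close> is
  always true and merely gives the update the shape expected by \<open>upd_loop\<close>.\<close>

definition vertex_pass :: "string \<Rightarrow> nexp \<Rightarrow> prog" where
  "vertex_pass g e = PR ''sh'' (NConst 0) (RRead (CHR ''X'' # g) e) ;; chain_prog g ;;
     PN ''r'' (NConst 0) (nv ''k'') ;; PR ''of'' (NConst 0) (RRead ''XA'' (nv ''k'')) ;; eval_prog ''A'' ;;
     PN ''r'' (NConst 0) (NMinus (nv ''n'') (nv ''k'')) ;;
     PR ''of'' (NConst 0) (RRead ''XB'' (NMinus (nv ''n'') (nv ''k''))) ;; eval_prog ''B'' ;;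
     best_prog g ;;
     PFor ''u'' ''n'' (PWhen (BAnd (NLess (nv ''u'') (nv ''t'')) (NLess (NConst 0) (NConst 1)))
       (upd_prog (RMinus (RPlus (RRead ''cf'' (nv ''u''))
          (RTimes (RRead ''cq'' (nv ''u'')) (RRead (CHR ''Y'' # g) (nv ''u'')))) (RRead (CHR ''Z'' # g) (nv ''u'')))))"

definition vertex_prog :: prog where
  "vertex_prog = PR ''ze'' (NConst 0) (RConst 0) ;;
     PWhen (RLess (rv ''ze'') (RPlus (RRead ''QA'' (nv ''k'')) (RRead ''XA'' (nv ''k''))))
       (PR ''ze'' (NConst 0) (RPlus (RRead ''QA'' (nv ''k'')) (RRead ''XA'' (nv ''k'')))) ;;
     PWhen (RLess (rv ''ze'') (RPlus (RRead ''QB'' (NMinus (nv ''n'') (nv ''k''))) (RRead ''XB'' (NMinus (nv ''n'') (nv ''k'')))))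
       (PR ''ze'' (NConst 0) (RPlus (RRead ''QB'' (NMinus (nv ''n'') (nv ''k''))) (RRead ''XB'' (NMinus (nv ''n'') (nv ''k''))))) ;;
     PR ''ka'' (NConst 0) (RConst 1) ;;
     vertex_pass ''A'' (nv ''k'') ;; vertex_pass ''B'' (NMinus (nv ''n'') (nv ''k''))"

text \<open>The guard checks, for the doubled quantities 2y = l + X - r and 2z = r + l + X, that the
  separate optima describe a point inside the open edge and a nonnegative bound.\<close>

definition edge_upd :: prog where
  "edge_upd = (let r = RRead ''ZA'' (nv ''u''); l = RRead ''ZB'' (nv ''u''); X = RRead ''XA'' (nv ''n'');
       xk = RRead ''XA'' (nv ''k''); xk' = RRead ''XA'' (nsuc (nv ''k'')) in
     PFor ''u'' ''n'' (PWhen (BAnd (NLess (nv ''u'') (nv ''t''))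
         (BAnd (BAnd (RLess (RPlus xk xk) (RMinus (RPlus l X) r)) (RLess (RMinus (RPlus l X) r) (RPlus xk' xk')))
            (BNot (RLess (RPlus (RPlus r l) X) (RConst 0)))))
       (upd_prog (RMinus (RPlus (RRead ''cf'' (nv ''u''))
          (RTimes (RRead ''cq'' (nv ''u'')) (RPlus (RRead ''YA'' (nv ''u'')) (RRead ''YB'' (nv ''u'')))))
          (RDivide (RPlus (RPlus r l) X) (RConst 2))))))"

definition edge_prog :: prog where
  "edge_prog = PR ''ka'' (NConst 0) (RDivide (RConst 1) (RConst 2)) ;; PR ''sh'' (NConst 0) (RConst 0) ;;
     PR ''of'' (NConst 0) (RConst 0) ;; edge_pass ''A'' (nsuc (nv ''k'')) ;;
     edge_pass ''B'' (NMinus (nv ''n'') (nv ''k'')) ;; edge_upd"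

definition main_prog :: prog where
  "main_prog = PFor ''k'' ''n1''
     (PWhen (BAnd (BNot (NLess (nv ''k'') (nv ''lo''))) (BNot (NLess (nv ''hi'') (nv ''k'')))) vertex_prog ;;
      PWhen (BAnd (BNot (NLess (nv ''k'') (nv ''lo''))) (NLess (nv ''k'') (nv ''hi''))) edge_prog)"

lemma wr_vertex_pass [simp]: "wrN (vertex_pass g e) = {''p'', ''q'', ''u'', ''s'', ''r'', ''o''}"
  "wrR (vertex_pass g e) = {''sh'', ''of'', ''z'', ''y'', CHR ''Y'' # g, CHR ''Z'' # g, ''out''}"
  by (auto simp: vertex_pass_def)

lemma wr_vertex [simp]: "wrN vertex_prog = {''p'', ''q'', ''u'', ''s'', ''r'', ''o''}"
  "wrR vertex_prog = {''ze'', ''ka'', ''sh'', ''of'', ''z'', ''y'', ''YA'', ''ZA'', ''YB'', ''ZB'', ''out''}"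
  by (auto simp: vertex_prog_def)

lemma wr_edge_upd [simp]: "wrN edge_upd = {''u'', ''o''}" "wrR edge_upd = {''out''}"
  by (auto simp: edge_upd_def Let_def)

lemma wr_edge [simp]: "wrN edge_prog = {''p'', ''q'', ''u'', ''s'', ''r'', ''o''}"
  "wrR edge_prog = {''ze'', ''ka'', ''sh'', ''of'', ''z'', ''y'', ''YA'', ''ZA'', ''YB'', ''ZB'', ''out''}"
  by (auto simp: edge_prog_def)

lemma wr_main [simp]: "wrN main_prog = {''p'', ''q'', ''u'', ''s'', ''r'', ''o'', ''k''}"
  "wrR main_prog = {''ze'', ''ka'', ''sh'', ''of'', ''z'', ''y'', ''YA'', ''ZA'', ''YB'', ''ZB'', ''out''}"
  by (auto simp: main_prog_def)

locale stored = two_sided +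
  fixes m0 :: store
  assumes stA: "A.side_stored m0 ''A''" and stB: "B.side_stored m0 ''B''"
    and netA: "store_net m0 ''A'' P" and netB: "store_net m0 ''B'' Q" and sl: "store_slopes m0"
    and T: "T = fst m0 ''t'' 0" "cf = snd m0 ''cf''" "cq = snd m0 ''cq''"
    and n1: "fst m0 ''n1'' 0 = Suc (len P)" and lohi0: "fst m0 ''lo'' 0 = lo" "fst m0 ''hi'' 0 = hi"
begin

text \<open>All tables lie outside the arrays written by \<open>main_prog\<close>, so facts about
  them are established once for \<open>m0\<close> and transferred.\<close>

definition same :: "store \<Rightarrow> bool" where
  "same m \<longleftrightarrow> (\<forall>a. a \<notin> wrN main_prog \<longrightarrow> fst m a = fst m0 a) \<and> (\<forall>a. a \<notin> wrR main_prog \<longrightarrow> snd m a = snd m0 a)"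

lemma same_sem:
  assumes "same m" and N: "wrN p \<subseteq> wrN main_prog" and R: "wrR p \<subseteq> wrR main_prog"
  shows "same (sem p m)"
  unfolding same_def
proof (intro conjI allI impI)
  show "fst (sem p m) a = fst m0 a" if "a \<notin> wrN main_prog" for a
    using sem_frame(1)[OF contra_subsetD[OF N that], of m] assms(1) that unfolding same_def by metis
  show "snd (sem p m) a = snd m0 a" if "a \<notin> wrR main_prog" for a
    using sem_frame(2)[OF contra_subsetD[OF R that], of m] assms(1) that unfolding same_def by metis
qed

lemma same_stored:
  assumes "same m"
  shows "A.side_stored m ''A''" "B.side_stored m ''B''" "store_slopes m"
    "fst m ''t'' 0 = T" "snd m ''cq'' = cq" "snd m ''cf'' = cf" "fst m ''np'' 0 = np" "fst m ''n'' 0 = n"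
    "fst m ''lo'' 0 = lo" "fst m ''hi'' 0 = hi" "fst m ''n1'' 0 = Suc n"
    "l \<le> n \<Longrightarrow> snd m ''XA'' l = pos P l" "l \<le> n \<Longrightarrow> snd m ''XB'' l = pos Q l"
    "snd m ''QA'' = rhoA" "snd m ''QB'' = rhoB" "snd m ''RA'' = RA" "snd m ''RB'' = RB"
  using assms stA stB sl T lohi0 n1 netA netB len_Q
  unfolding same_def A.side_stored_def B.side_stored_def store_slopes_def store_net_def by simp_all

abbreviation "vval k u z \<equiv> cf u + cq u * (A.A k (z - pos P k) + B.A (n - k) (z - (X - pos P k))) - z"

text \<open>\<open>S\<close> contains one candidate per slope. Each is the value at an admissible z,
  which bounds the result from above, and each dominates the values at all breakpoints of the side,
  which bounds it from below.\<close>

lemma vertex_pass: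
  assumes sm: "same m" and k: "fst m ''k'' 0 = k" "lo \<le> k" "k \<le> hi"
    and c: "snd m ''ze'' 0 = \<zeta> k" "snd m ''ka'' 0 = 1"
    and g: "g = ''A'' \<and> nval e m = k \<and> R = RA \<and> d = pos P k \<or> g = ''B'' \<and> nval e m = n - k \<and> R = RB \<and> d = X - pos P k"
  shows "\<exists>S. improves m (sem (vertex_pass g e) m) S \<and> (\<forall>v\<in>S. \<exists>u<T. \<exists>z\<ge>\<zeta> k. v = vval k u z) \<and>
    (\<forall>u<T. \<forall>p<np. \<exists>v\<in>S. vval k u (max (R p + d) (\<zeta> k)) \<le> v)"
proof -
  note s = same_stored[OF sm]
  have kn: "k \<le> n" using k hi_n by simp
  have nk: "n - k \<le> len Q" "n - k \<le> n" by (simp_all add: len_Q)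
  have posB: "pos Q (n - k) = X - pos P k" using pos_Q[of "n - k"] kn by simp
  have gR: "snd m (CHR ''R'' # g) = R" "snd m (CHR ''X'' # g) (nval e m) = d"
    using g s kn nk posB by auto
  have Rm: "R p \<le> R p'" if "p \<le> p'" "p' < np" for p p' using g A.R_mono[OF that] B.R_mono[OF that] by auto
  define m1 where "m1 = sem (PR ''sh'' (NConst 0) (RRead (CHR ''X'' # g) e)) m"
  define m2 where "m2 = sem (chain_prog g) m1"
  define m3 where "m3 = sem (PN ''r'' (NConst 0) (nv ''k'') ;; PR ''of'' (NConst 0) (RRead ''XA'' (nv ''k''))) m2"
  define m4 where "m4 = sem (eval_prog ''A'') m3"
  define m5 where "m5 = sem (PN ''r'' (NConst 0) (NMinus (nv ''n'') (nv ''k'')) ;;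
     PR ''of'' (NConst 0) (RRead ''XB'' (NMinus (nv ''n'') (nv ''k'')))) m4"
  define m6 where "m6 = sem (eval_prog ''B'') m5"
  define m7 where "m7 = sem (best_prog g) m6"
  let ?e = "RMinus (RPlus (RRead ''cf'' (nv ''u''))
          (RTimes (RRead ''cq'' (nv ''u'')) (RRead (CHR ''Y'' # g) (nv ''u'')))) (RRead (CHR ''Z'' # g) (nv ''u''))"
  let ?l = "PFor ''u'' ''n'' (PWhen (BAnd (NLess (nv ''u'') (nv ''t'')) (NLess (NConst 0) (NConst 1))) (upd_prog ?e))"
  have m': "sem (vertex_pass g e) m = sem ?l m7"
    by (simp add: vertex_pass_def m1_def m2_def m3_def m4_def m5_def m6_def m7_def del: sem.simps(6))
  have sm1: "same m1" unfolding m1_def by (rule same_sem[OF sm]) auto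
  have sm2: "same m2" unfolding m2_def by (rule same_sem[OF sm1]) auto
  have sm3: "same m3" unfolding m3_def by (rule same_sem[OF sm2]) auto
  have sm4: "same m4" unfolding m4_def by (rule same_sem[OF sm3]) auto
  have sm5: "same m5" unfolding m5_def by (rule same_sem[OF sm4]) auto
  have sm6: "same m6" unfolding m6_def by (rule same_sem[OF sm5]) auto
  have sm7: "same m7" unfolding m7_def by (rule same_sem[OF sm6]) (use g in auto)
  define z where "z p = max (R p + d) (\<zeta> k)" for p
  have k2: "fst m2 ''k'' 0 = k" "fst m3 ''k'' 0 = k" "fst m4 ''k'' 0 = k"
    using k by (simp_all add: m1_def m2_def m3_def m4_def sem_frame)
  have zz: "snd m2 ''z'' p = z p" "snd m2 ''y'' p = 0" if "p < np" for p
    using chain_prog[of p m1 g] that same_stored(7)[OF sm1] gR c by (simp_all add: m1_def m2_def z_def)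
  have zeq: "snd m3 ''z'' = snd m2 ''z''" "snd m5 ''z'' = snd m2 ''z''" "snd m6 ''z'' = snd m2 ''z''"
    "snd m3 ''y'' = snd m2 ''y''" "snd m5 ''y'' = snd m4 ''y''"
    by (simp_all add: m3_def m4_def m5_def m6_def sem_frame)
  have of3: "snd m3 ''of'' 0 = pos P k" "fst m3 ''r'' 0 = k"
    using k2 same_stored(12)[OF sm2 kn] by (simp_all add: m3_def)
  have of5: "snd m5 ''of'' 0 = X - pos P k" "fst m5 ''r'' 0 = n - k"
    using k2 same_stored(13)[OF sm4 nk(2)] same_stored(8)[OF sm4] posB by (simp_all add: m5_def)
  have zs: "snd m2 ''z'' p \<le> snd m2 ''z'' p'" if "p \<le> p'" "p' < np" for p p'
    using Rm[OF that] that zz unfolding z_def by (auto simp: max_def)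
  have z\<zeta>: "\<zeta> k \<le> snd m2 ''z'' p" if "p < np" for p using zz that by (simp add: z_def)
  have \<zeta>0: "0 \<le> \<zeta> k" by (simp add: \<zeta>_def)
  have y4: "snd m4 ''y'' p = A.A k (z p - pos P k)" if p: "p < np" for p
  proof -
    have "snd m4 ''y'' p = snd m3 ''y'' p + A.A k (snd m3 ''z'' p - snd m3 ''of'' 0)" unfolding m4_def
      by (rule A.eval_A[OF same_stored(1)[OF sm3] of3(2) kn])
        (use zs z\<zeta> \<zeta>0 X_ge[OF kn] p in \<open>force simp: zeq of3\<close>)+
    then show ?thesis using zz p by (simp add: zeq of3)
  qed
  have y6: "snd m6 ''y'' p = A.A k (z p - pos P k) + B.A (n - k) (z p - (X - pos P k))" if p: "p < np" for p
  proof -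
    have "snd m6 ''y'' p = snd m5 ''y'' p + B.A (n - k) (snd m5 ''z'' p - snd m5 ''of'' 0)" unfolding m6_def
      by (rule B.eval_A[OF same_stored(2)[OF sm5] of5(2) nk(1)])
        (use zs z\<zeta> \<zeta>0 pos_nonneg[OF kn] X_Q p in \<open>force simp: zeq of5 len_Q\<close>)+
    then show ?thesis using zz y4 p by (simp add: zeq of5)
  qed
  define \<Phi> where "\<Phi> z = A.A k (z - pos P k) + B.A (n - k) (z - (X - pos P k))" for z
  have mono: "\<Phi> r \<le> \<Phi> r'" if "r \<le> r'" for r r'
    unfolding \<Phi>_def using that A.A_mono[OF kn] B.A_mono[OF nk(1)] by (intro add_mono) auto
  \<comment> \<open>Translation preserves concavity, and so does the sum of the two sides; thus the
    one-pointer search applies to vertices just as it does to edges.\<close>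
  have conc: "(1 - t) * \<Phi> r + t * \<Phi> r' \<le> \<Phi> ((1 - t) * r + t * r')" if "0 \<le> t" "t \<le> 1" for t r r'
  proof -
    have e: "(1 - t) * (r - c) + t * (r' - c) = (1 - t) * r + t * r' - c" for c by (simp add: algebra_simps)
    show ?thesis
      using add_mono[OF A.A_concave[OF that, of k "r - pos P k" "r' - pos P k"]
          B.A_concave[OF that, of "n - k" "r - (X - pos P k)" "r' - (X - pos P k)"]]
      unfolding e \<Phi>_def distrib_left by linarith
  qed
  note s6 = same_stored[OF sm6] and s7 = same_stored[OF sm7]
  have ka6: "snd m6 ''ka'' 0 = 1"
    using c by (simp add: m1_def m2_def m3_def m4_def m5_def m6_def sem_frame)
  have best: "\<exists>p<np. snd m7 (CHR ''Y'' # g) u = \<Phi> (z p) \<and> snd m7 (CHR ''Z'' # g) u = z p \<and>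
      (\<forall>p'<np. vval k u (z p') \<le> vval k u (z p))" if u: "u < T" for u
  proof -
    have "\<exists>p<np. snd m7 (CHR ''Y'' # g) u = \<Phi> (snd m2 ''z'' p) \<and> snd m7 (CHR ''Z'' # g) u = snd m2 ''z'' p \<and>
      (\<forall>p'<np. cq u * \<Phi> (snd m2 ''z'' p') - 1 * snd m2 ''z'' p' \<le> cq u * \<Phi> (snd m2 ''z'' p) - 1 * snd m2 ''z'' p)"
      using best_concave[of m6 \<Phi> u g, folded m7_def, unfolded s6(4,5,7) zeq(3) ka6,
          OF s6(3) A.np zs _ mono conc u] y6 zz by (simp add: \<Phi>_def)
    then obtain p where p: "p < np" "snd m7 (CHR ''Y'' # g) u = \<Phi> (snd m2 ''z'' p)"
      "snd m7 (CHR ''Z'' # g) u = snd m2 ''z'' p"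
      "\<And>p'. p' < np \<Longrightarrow> cq u * \<Phi> (snd m2 ''z'' p') - 1 * snd m2 ''z'' p' \<le> cq u * \<Phi> (snd m2 ''z'' p) - 1 * snd m2 ''z'' p"
      by blast
    have "vval k u (z p') \<le> vval k u (z p)" if "p' < np" for p'
      using p(4)[OF that] zz(1)[OF that] zz(1)[OF p(1)] unfolding \<Phi>_def by simp
    then show ?thesis using p zz by auto
  qed
  define S where "S = {cf u + cq u * snd m7 (CHR ''Y'' # g) u - snd m7 (CHR ''Z'' # g) u | u. u < T}"
  have "improves m7 (sem ?l m7) {cf u + cq u * snd m7 (CHR ''Y'' # g) u - snd m7 (CHR ''Z'' # g) u | u.
     u < fst m7 ''t'' 0 \<and> True}"
    by (rule upd_loop) (use s7(3,5,6) in \<open>auto simp: store_slopes_def\<close>)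
  then have i7: "improves m7 (sem ?l m7) S" by (simp only: S_def s7(4) simp_thms)
  have o7: "fst m ''o'' 0 = fst m7 ''o'' 0" "snd m ''out'' 0 = snd m7 ''out'' 0"
    by (simp_all add: m1_def m2_def m3_def m4_def m5_def m6_def m7_def sem_frame)
  have "improves m (sem (vertex_pass g e) m) S"
    unfolding m' by (rule improves_cong[OF i7 o7 refl refl])
  moreover have "\<exists>u<T. \<exists>z\<ge>\<zeta> k. v = vval k u z" if "v \<in> S" for v
  proof -
    from that obtain u where u: "u < T" "v = cf u + cq u * snd m7 (CHR ''Y'' # g) u - snd m7 (CHR ''Z'' # g) u"
      by (auto simp: S_def)
    obtain p where "p < np" "snd m7 (CHR ''Y'' # g) u = \<Phi> (z p)" "snd m7 (CHR ''Z'' # g) u = z p"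
      using best[OF u(1)] by blast
    then show ?thesis using u unfolding \<Phi>_def by (intro exI[of _ u] conjI exI[of _ "z p"]) (auto simp: z_def)
  qed
  moreover have "\<exists>v\<in>S. vval k u (max (R p + d) (\<zeta> k)) \<le> v" if u: "u < T" and p: "p < np" for u p
  proof -
    obtain p' where p': "snd m7 (CHR ''Y'' # g) u = \<Phi> (z p')" "snd m7 (CHR ''Z'' # g) u = z p'"
      "vval k u (z p) \<le> vval k u (z p')" using best[OF u] p by blast
    have "vval k u (z p') = cf u + cq u * snd m7 (CHR ''Y'' # g) u - snd m7 (CHR ''Z'' # g) u"
      unfolding p' \<Phi>_def ..
    then have "vval k u (z p') \<in> S" unfolding S_def using u by blast
    then show ?thesis using p'(3) unfolding z_def by blast
  qed
  ultimately show ?thesis by blast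
qed

lemma vertex_prog:
  assumes sm: "same m" and k: "fst m ''k'' 0 = k" "lo \<le> k" "k \<le> hi"
  shows "\<exists>S. improves m (sem vertex_prog m) S \<and> (\<forall>U. upper_bound U \<longrightarrow> (\<forall>v\<in>S. v \<le> U)) \<and>
    (\<forall>u<T. S \<noteq> {} \<and> (\<forall>out. (\<forall>v\<in>S. v \<le> out) \<longrightarrow> vertex_covered k u out))"
proof -
  note s = same_stored[OF sm]
  have kn: "k \<le> n" "n - k \<le> n" using k hi_n by auto
  have posB: "pos Q (n - k) = X - pos P k" using pos_Q[of "n - k"] kn by simp
  let ?i = "PR ''ze'' (NConst 0) (RConst 0) ;;
     PWhen (RLess (rv ''ze'') (RPlus (RRead ''QA'' (nv ''k'')) (RRead ''XA'' (nv ''k''))))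
       (PR ''ze'' (NConst 0) (RPlus (RRead ''QA'' (nv ''k'')) (RRead ''XA'' (nv ''k'')))) ;;
     PWhen (RLess (rv ''ze'') (RPlus (RRead ''QB'' (NMinus (nv ''n'') (nv ''k''))) (RRead ''XB'' (NMinus (nv ''n'') (nv ''k'')))))
       (PR ''ze'' (NConst 0) (RPlus (RRead ''QB'' (NMinus (nv ''n'') (nv ''k''))) (RRead ''XB'' (NMinus (nv ''n'') (nv ''k''))))) ;;
     PR ''ka'' (NConst 0) (RConst 1)"
  define m1 where "m1 = sem ?i m"
  define m2 where "m2 = sem (vertex_pass ''A'' (nv ''k'')) m1"
  have m': "sem vertex_prog m = sem (vertex_pass ''B'' (NMinus (nv ''n'') (nv ''k''))) m2"
    by (simp add: vertex_prog_def m1_def m2_def)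
  have sm1: "same m1" unfolding m1_def by (rule same_sem[OF sm]) auto
  have sm2: "same m2" unfolding m2_def by (rule same_sem[OF sm1]) auto
  have c1: "snd m1 ''ze'' 0 = \<zeta> k" "snd m1 ''ka'' 0 = 1" "fst m1 ''k'' 0 = k"
    using k(1) s(8,12,13,14,15) kn posB by (auto simp: m1_def \<zeta>_def max_def)
  have c2: "snd m2 ''ze'' 0 = \<zeta> k" "snd m2 ''ka'' 0 = 1" "fst m2 ''k'' 0 = k"
    using c1 by (simp_all add: m2_def sem_frame)
  obtain S where S: "improves m1 m2 S" "\<forall>v\<in>S. \<exists>u<T. \<exists>z\<ge>\<zeta> k. v = vval k u z"
    "\<forall>u<T. \<forall>p<np. \<exists>v\<in>S. vval k u (max (RA p + pos P k) (\<zeta> k)) \<le> v"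
    using vertex_pass[OF sm1 c1(3) k(2,3) c1(1,2), of "''A''" "nv ''k''" RA "pos P k", folded m2_def] c1(3) by auto
  obtain S' where S': "improves m2 (sem vertex_prog m) S'" "\<forall>v\<in>S'. \<exists>u<T. \<exists>z\<ge>\<zeta> k. v = vval k u z"
    "\<forall>u<T. \<forall>p<np. \<exists>v\<in>S'. vval k u (max (RB p + (X - pos P k)) (\<zeta> k)) \<le> v"
    using vertex_pass[OF sm2 c2(3) k(2,3) c2(1,2), of "''B''" "NMinus (nv ''n'') (nv ''k'')" RB "X - pos P k", folded m']
      c2(3) same_stored(8)[OF sm2] by auto
  have "improves m1 (sem vertex_prog m) (S \<union> S')" by (rule improves_trans[OF S(1) S'(1)])
  then have 1: "improves m (sem vertex_prog m) (S \<union> S')"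
    by (rule improves_cong) (simp_all add: m1_def)
  have 2: "v \<le> U" if U: "upper_bound U" and v: "v \<in> S \<union> S'" for U v
  proof -
    obtain u z where uz: "u < T" "\<zeta> k \<le> z" "v = vval k u z" using S(2) S'(2) v by blast
    show ?thesis unfolding uz(3)
      by (rule sound[OF U place_vertex[OF k(2,3)]]) (use uz in \<open>auto simp: \<zeta>_def\<close>)
  qed
  have 3: "S \<union> S' \<noteq> {}" if "u < T" for u using S(3) that A.np by blast
  have 4: "vertex_covered k u out" if u: "u < T" and out: "\<forall>v\<in>S \<union> S'. v \<le> out" for u out
  proof (rule vertex_coveredI[OF kn(1) u])
    fix p assume p: "p < np"
    obtain v where "v \<in> S" "vval k u (max (RA p + pos P k) (\<zeta> k)) \<le> v" using S(3) u p by blast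
    then show "let z = max (RA p + pos P k) (\<zeta> k) in vval k u z \<le> out"
      using out unfolding Let_def by (meson UnI1 order_trans)
    obtain v where "v \<in> S'" "vval k u (max (RB p + (X - pos P k)) (\<zeta> k)) \<le> v" using S'(3) u p by blast
    then show "let z = max (RB p + (X - pos P k)) (\<zeta> k) in vval k u z \<le> out"
      using out unfolding Let_def by (meson UnI2 order_trans)
  qed
  show ?thesis using 1 2 3 4 by (intro exI[of _ "S \<union> S'"]) blast
qed

text \<open>Optima outside the edge are simply discarded; hence the edge counts as covered only once
  both of its end vertices are.\<close>

lemma edge_prog:
  assumes sm: "same m" and k: "fst m ''k'' 0 = k" "lo \<le> k" "k < hi"
  shows "\<exists>S. improves m (sem edge_prog m) S \<and> (\<forall>U. upper_bound U \<longrightarrow> (\<forall>v\<in>S. v \<le> U)) \<and>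
    (\<forall>u<T. \<forall>out. (\<forall>v\<in>S. v \<le> out) \<longrightarrow> vertex_covered k u out \<longrightarrow> vertex_covered (Suc k) u out \<longrightarrow>
       edge_covered k u out)"
proof -
  note s = same_stored[OF sm]
  have kn: "Suc k \<le> n" "k \<le> n" using k hi_n by auto
  have nk: "n - k \<le> len Q" by (simp add: len_Q)
  define m1 where "m1 = sem (PR ''ka'' (NConst 0) (RDivide (RConst 1) (RConst 2)) ;; PR ''sh'' (NConst 0) (RConst 0) ;;
     PR ''of'' (NConst 0) (RConst 0)) m"
  define m2 where "m2 = sem (edge_pass ''A'' (nsuc (nv ''k''))) m1"
  define m3 where "m3 = sem (edge_pass ''B'' (NMinus (nv ''n'') (nv ''k''))) m2"
  have m': "sem edge_prog m = sem edge_upd m3" by (simp add: edge_prog_def m1_def m2_def m3_def)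
  have sm1: "same m1" unfolding m1_def by (rule same_sem[OF sm]) auto
  have sm2: "same m2" unfolding m2_def by (rule same_sem[OF sm1]) auto
  have sm3: "same m3" unfolding m3_def by (rule same_sem[OF sm2]) auto
  note s1 = same_stored[OF sm1] and s2 = same_stored[OF sm2] and s3 = same_stored[OF sm3]
  have c1: "snd m1 ''sh'' 0 = 0" "snd m1 ''of'' 0 = 0" "snd m1 ''ka'' 0 = 1 / 2" "fst m1 ''k'' 0 = k"
    using k by (simp_all add: m1_def)
  have c2: "snd m2 ''sh'' 0 = 0" "snd m2 ''of'' 0 = 0" "snd m2 ''ka'' 0 = 1 / 2" "fst m2 ''k'' 0 = k" "fst m3 ''k'' 0 = k"
    using c1 by (simp_all add: m2_def m3_def sem_frame)
  define r l where "r = snd m3 ''ZA''" and "l = snd m3 ''ZB''"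
  have A: "rhoA (Suc k) \<le> r u \<and> snd m3 ''YA'' u = A.A (Suc k) (r u) \<and>
     (\<forall>r'. rhoA (Suc k) \<le> r' \<longrightarrow> cq u * A.A (Suc k) r' - r' / 2 \<le> cq u * A.A (Suc k) (r u) - r u / 2)" if u: "u < T" for u
  proof -
    have v: "nval (nsuc (nv ''k'')) m1 = Suc k" using c1 by simp
    obtain r1 where r1: "rhoA (Suc k) \<le> r1" "snd m2 ''ZA'' u = r1" "snd m2 ''YA'' u = A.A (Suc k) r1"
      "\<And>r'. rhoA (Suc k) \<le> r' \<Longrightarrow> cq u * A.A (Suc k) r' - r' / 2 \<le> cq u * A.A (Suc k) r1 - r1 / 2"
      using A.edge_pass[OF s1(1,3) v kn(1) c1(1,2,3), of u, folded m2_def] u unfolding s1(4,5) by blast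
    have "r u = r1" "snd m3 ''YA'' u = snd m2 ''YA'' u" using r1(2) by (simp_all add: r_def m3_def sem_frame)
    then show ?thesis using r1 by simp
  qed
  have B: "rhoB (n - k) \<le> l u \<and> snd m3 ''YB'' u = B.A (n - k) (l u) \<and>
     (\<forall>r'. rhoB (n - k) \<le> r' \<longrightarrow> cq u * B.A (n - k) r' - r' / 2 \<le> cq u * B.A (n - k) (l u) - l u / 2)" if u: "u < T" for u
  proof -
    have v: "nval (NMinus (nv ''n'') (nv ''k'')) m2 = n - k" using c2 s2(8) by simp
    obtain r1 where r1: "rhoB (n - k) \<le> r1" "snd m3 ''ZB'' u = r1" "snd m3 ''YB'' u = B.A (n - k) r1"
      "\<And>r'. rhoB (n - k) \<le> r' \<Longrightarrow> cq u * B.A (n - k) r' - r' / 2 \<le> cq u * B.A (n - k) r1 - r1 / 2"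
      using B.edge_pass[OF s2(2,3) v nk c2(1,2,3), of u, folded m3_def] u unfolding s2(4,5) by blast
    then show ?thesis by (simp add: l_def)
  qed
  define cond where "cond u \<longleftrightarrow> pos P k + pos P k < l u + X - r u \<and> l u + X - r u < pos P (Suc k) + pos P (Suc k) \<and>
     \<not> r u + l u + X < 0" for u
  define val where "val u = cf u + cq u * (snd m3 ''YA'' u + snd m3 ''YB'' u) - (r u + l u + X) / 2" for u
  define S where "S = {val u | u. u < T \<and> cond u}"
  have "improves m3 (sem edge_upd m3) {val u | u. u < fst m3 ''t'' 0 \<and> cond u}"
    unfolding edge_upd_def Let_def
    by (rule upd_loop) (use s3 c2(5) kn in \<open>auto simp: store_slopes_def cond_def val_def r_def l_def\<close>)
  then have "improves m3 (sem edge_prog m) S" by (simp only: S_def s3(4) m')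
  then have 1: "improves m (sem edge_prog m) S"
    by (rule improves_cong) (simp_all add: m1_def m2_def m3_def sem_frame)
  have 2: "v \<le> U" if U: "upper_bound U" and v: "v \<in> S" for U v
  proof -
    obtain u where u: "u < T" "cond u" "v = val u" using v by (auto simp: S_def)
    define y where "y = (l u + X - r u) / 2"
    define z where "z = (r u + l u + X) / 2"
    have zy: "z - y = r u" "z - (X - y) = l u" by (simp_all add: z_def y_def field_simps)
    have h: "0 \<le> z" "rhoA (Suc k) \<le> z - y" "rhoB (n - k) \<le> z - (X - y)"
      unfolding zy using u A[OF u(1)] B[OF u(1)] by (auto simp: cond_def z_def)
    have py: "pos P k < y" "y < pos P (Suc k)" using u(2) by (auto simp: cond_def y_def)
    have "cf u + cq u * (A.A (Suc k) (z - y) + B.A (n - k) (z - (X - y))) - z \<le> U"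
      by (rule sound[OF U place_edge[OF k(2,3) py] h u(1)])
    then show ?thesis using u A[OF u(1)] B[OF u(1)] unfolding zy by (simp add: val_def z_def)
  qed
  have 3: "edge_covered k u out" if u: "u < T" and out: "\<forall>v\<in>S. v \<le> out"
    and v: "vertex_covered k u out" "vertex_covered (Suc k) u out" for u out
  proof (rule edge_coveredI[OF k(2,3) u, where r="r u" and l="l u"])
    assume "2 * pos P k < l u + X - r u" "l u + X - r u < 2 * pos P (Suc k)" "0 \<le> r u + l u + X"
    then have "val u \<in> S" using u by (auto simp: S_def cond_def)
    then have "val u \<le> out" using out by blast
    then show "cf u + cq u * (A.A (Suc k) (r u) + B.A (n - k) (l u)) - (r u + l u + X) / 2 \<le> out"
      using A[OF u] B[OF u] unfolding val_def by simp
  qed (use A[OF u] B[OF u] v in auto)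
  show ?thesis using 1 2 3 by blast
qed

theorem main_prog:
  assumes T0: "0 < T"
  shows "\<exists>S. improves m0 (sem main_prog m0) S \<and> S \<noteq> {} \<and> (\<forall>U. upper_bound U \<longrightarrow> (\<forall>v\<in>S. v \<le> U)) \<and>
    (\<forall>out. (\<forall>v\<in>S. v \<le> out) \<longrightarrow> upper_bound out)"
proof -
  let ?v = "PWhen (BAnd (BNot (NLess (nv ''k'') (nv ''lo''))) (BNot (NLess (nv ''hi'') (nv ''k'')))) vertex_prog"
  let ?e = "PWhen (BAnd (BNot (NLess (nv ''k'') (nv ''lo''))) (NLess (nv ''k'') (nv ''hi''))) edge_prog"
  \<comment> \<open>Coverage of edge \<open>j\<close> stays an implication because its right end,
    vertex \<open>Suc j\<close>, is processed only in the following round.\<close>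
  let ?I = "\<lambda>k m. \<exists>S. improves m0 m S \<and> (lo < k \<longrightarrow> S \<noteq> {}) \<and> (\<forall>U. upper_bound U \<longrightarrow> (\<forall>v\<in>S. v \<le> U)) \<and>
    (\<forall>out. (\<forall>v\<in>S. v \<le> out) \<longrightarrow> (\<forall>j u. lo \<le> j \<longrightarrow> j < k \<longrightarrow> u < T \<longrightarrow>
       (j \<le> hi \<longrightarrow> vertex_covered j u out) \<and>
       (j < hi \<longrightarrow> vertex_covered j u out \<longrightarrow> vertex_covered (Suc j) u out \<longrightarrow> edge_covered j u out)))"
  have same0: "same m0" by (simp add: same_def)
  have "?I (fst m0 ''n1'' 0) (sem (PFor ''k'' ''n1'' (?v ;; ?e)) m0)"
  proof (rule For_rule[where I="?I"])
    have "improves m0 (nupd m0 ''k'' 0 0) {}" by (rule improves_refl) auto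
    then show "?I 0 (nupd m0 ''k'' 0 0)" by (intro exI[of _ "{}"]) auto
    fix k and m :: store
    assume k: "fst m ''k'' 0 = k" and N: "\<And>a. a \<notin> insert ''k'' (wrN (?v ;; ?e)) \<Longrightarrow> fst m a = fst m0 a"
      and R: "\<And>a. a \<notin> wrR (?v ;; ?e) \<Longrightarrow> snd m a = snd m0 a" and I: "?I k m"
    have sm: "same m" unfolding same_def using N R by simp
    obtain S where S: "improves m0 m S" "lo < k \<longrightarrow> S \<noteq> {}" "\<And>U v. upper_bound U \<Longrightarrow> v \<in> S \<Longrightarrow> v \<le> U"
      "\<And>out j u. \<forall>v\<in>S. v \<le> out \<Longrightarrow> lo \<le> j \<Longrightarrow> j < k \<Longrightarrow> u < T \<Longrightarrow> (j \<le> hi \<longrightarrow> vertex_covered j u out) \<and>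
       (j < hi \<longrightarrow> vertex_covered j u out \<longrightarrow> vertex_covered (Suc j) u out \<longrightarrow> edge_covered j u out)"
      using I by blast
    define m1 where "m1 = sem ?v m"
    have sm1: "same m1" unfolding m1_def by (rule same_sem[OF sm]) auto
    have k1: "fst m1 ''k'' 0 = k" using k by (simp add: m1_def sem_frame)
    note s = same_stored[OF sm] and s1 = same_stored[OF sm1]
    obtain S1 where S1: "improves m m1 S1" "lo \<le> k \<and> k \<le> hi \<longrightarrow> S1 \<noteq> {}" "\<And>U v. upper_bound U \<Longrightarrow> v \<in> S1 \<Longrightarrow> v \<le> U"
      "\<And>u out. u < T \<Longrightarrow> lo \<le> k \<Longrightarrow> k \<le> hi \<Longrightarrow> \<forall>v\<in>S1. v \<le> out \<Longrightarrow> vertex_covered k u out"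
    proof (cases "lo \<le> k \<and> k \<le> hi")
      case True
      then have "m1 = sem vertex_prog m" using k s by (simp add: m1_def)
      then show ?thesis using vertex_prog[OF sm k] True T0 that by metis
    next
      case False
      then have "m1 = m" using k s by (auto simp: m1_def)
      then have "improves m m1 {}" by (simp add: improves_refl)
      then show ?thesis using that[of "{}"] False by auto
    qed
    let ?m2 = "sem ?e m1"
    obtain S2 where S2: "improves m1 ?m2 S2" "\<And>U v. upper_bound U \<Longrightarrow> v \<in> S2 \<Longrightarrow> v \<le> U"
      "\<And>u out. u < T \<Longrightarrow> lo \<le> k \<Longrightarrow> k < hi \<Longrightarrow> \<forall>v\<in>S2. v \<le> out \<Longrightarrow> vertex_covered k u out \<Longrightarrow>
         vertex_covered (Suc k) u out \<Longrightarrow> edge_covered k u out"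
    proof (cases "lo \<le> k \<and> k < hi")
      case True
      then have "?m2 = sem edge_prog m1" using k1 s1 by simp
      then show ?thesis using edge_prog[OF sm1 k1] True that by metis
    next
      case False
      then have "?m2 = m1" using k1 s1 by auto
      then have "improves m1 ?m2 {}" by (simp add: improves_refl)
      then show ?thesis using that[of "{}"] False by auto
    qed
    have "improves m0 ?m2 (S \<union> S1 \<union> S2)" by (rule improves_trans[OF improves_trans[OF S(1) S1(1)] S2(1)])
    then have i: "improves m0 (nupd (sem (?v ;; ?e) m) ''k'' 0 (Suc k)) (S \<union> S1 \<union> S2)"
      by (rule improves_cong) (auto simp: m1_def)
    show "?I (Suc k) (nupd (sem (?v ;; ?e) m) ''k'' 0 (Suc k))"
    proof (rule exI[of _ "S \<union> S1 \<union> S2"], intro conjI allI impI ballI)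
      show "improves m0 (nupd (sem (?v ;; ?e) m) ''k'' 0 (Suc k)) (S \<union> S1 \<union> S2)" by (rule i)
      show "S \<union> S1 \<union> S2 \<noteq> {}" if "lo < Suc k"
        using that S(2) S1(2) lohi(2) by (cases "lo = k") auto
      show "v \<le> U" if "upper_bound U" "v \<in> S \<union> S1 \<union> S2" for U v using that S(3) S1(3) S2(2) by blast
      fix out j u assume out: "\<forall>v\<in>S \<union> S1 \<union> S2. v \<le> out" and j: "lo \<le> j" "j < Suc k" "u < T"
      show "vertex_covered j u out" if "j \<le> hi"
        using S(4)[of out j u] S1(4)[of u out] out j that by (cases "j = k") auto
      show "edge_covered j u out" if "j < hi" "vertex_covered j u out" "vertex_covered (Suc j) u out"
        using S(4)[of out j u] S2(3)[of u out] out j that by (cases "j = k") auto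
    qed
  qed auto
  then obtain S where S: "improves m0 (sem main_prog m0) S" "lo < Suc n \<longrightarrow> S \<noteq> {}"
      "\<And>U v. upper_bound U \<Longrightarrow> v \<in> S \<Longrightarrow> v \<le> U"
      "\<And>out j u. \<forall>v\<in>S. v \<le> out \<Longrightarrow> lo \<le> j \<Longrightarrow> j < Suc n \<Longrightarrow> u < T \<Longrightarrow> (j \<le> hi \<longrightarrow> vertex_covered j u out) \<and>
       (j < hi \<longrightarrow> vertex_covered j u out \<longrightarrow> vertex_covered (Suc j) u out \<longrightarrow> edge_covered j u out)"
    unfolding main_prog_def n1 by blast
  have "upper_bound out" if out: "\<forall>v\<in>S. v \<le> out" for out
    by (rule complete) (use S(4)[OF out] hi_n in auto)
  then show ?thesis using S hi_n lohi by (intro exI[of _ S]) auto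
qed

end

section \<open>Slopes and intercepts of the objective in the total variable weight\<close>

section \<open>Slopes of the objective\<close>

text \<open>Vertices are visited from right to left, so the least capacity on the way to x is
  updated in constant time and its reciprocals appear in increasing order, as the search requires.
  \<open>c1\<close> records whether the minimum has been started; without \<open>mu\<close> only the
  line of vertex \<open>ib\<close> is stored.\<close>

definition slopes_body :: prog where
  "slopes_body = (let e = NMinus (NMinus (nv ''n'') (nv ''u'')) (NConst 1) in
     PWhen (BAnd (RLess (RRead ''XA'' e) (rv ''xx'')) (BNot (NLess e (nv ''ib''))))
      (PWhen (BOr (BNot (NLess (NConst 0) (nv ''c1''))) (RLess (RRead ''CA'' e) (rv ''ca'')))
         (PR ''ca'' (NConst 0) (RRead ''CA'' e)) ;;
       PN ''c1'' (NConst 0) (NConst 1) ;;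
       PWhen (BOr (NLess (NConst 0) (nv ''mu'')) (BNot (NLess (nv ''ib'') e)))
         (PR ''cq'' (nv ''t'') (RDivide (RConst 1) (rv ''ca'')) ;;
          PIf (BOr (RLess (RConst 0) (RRead ''VA'' e)) (BOr (NLess (NConst 0) (nv ''FA'')) (NLess (NConst 0) (nv ''FB''))))
            (PR ''cf'' (nv ''t'') (RPlus (RMinus (rv ''xx'') (RRead ''XA'' e)) (RDivide (RRead ''VA'' e) (rv ''ca''))))
            (PR ''cf'' (nv ''t'') (RConst 0)) ;;
          PN ''t'' (NConst 0) (nsuc (nv ''t'')))))"

definition slopes_prog :: prog where
  "slopes_prog = PN ''t'' (NConst 0) (NConst 0) ;; PN ''c1'' (NConst 0) (NConst 0) ;; PFor ''u'' ''n'' slopes_body"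

lemma wr_slopes [simp]: "wrN slopes_prog = {''t'', ''c1'', ''u''}" "wrR slopes_prog = {''ca'', ''cq'', ''cf''}"
  by (auto simp: slopes_prog_def slopes_body_def Let_def)

definition min_cap :: "path_network \<Rightarrow> real \<Rightarrow> nat \<Rightarrow> real" where
  "min_cap P x e = Min (cap P ` {e'. e \<le> e' \<and> e' < len P \<and> pos P e' < x})"

lemma min_cap_last:
  assumes "valid_network P" "e < len P" "pos P e < x" "Suc e < len P \<Longrightarrow> x \<le> pos P (Suc e)"
  shows "min_cap P x e = cap P e"
proof -
  have "e' = e" if e': "e \<le> e'" "e' < len P" "pos P e' < x" for e'
  proof (rule ccontr)
    assume "e' \<noteq> e"
    then have "Suc e \<le> e'" using e' by simp
    then have "pos P (Suc e) \<le> pos P e'" "Suc e < len P" using e' pos_le_iff[OF assms(1), of "Suc e" e'] by auto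
    then show False using assms(4) e' by simp
  qed
  then have "{e'. e \<le> e' \<and> e' < len P \<and> pos P e' < x} = {e}" using assms(2,3) by blast
  then show ?thesis by (simp add: min_cap_def)
qed

lemma min_cap_step:
  assumes "e < len P" "pos P e < x" "Suc e < len P" "pos P (Suc e) < x"
  shows "min_cap P x e = min (cap P e) (min_cap P x (Suc e))"
proof -
  have "{e'. e \<le> e' \<and> e' < len P \<and> pos P e' < x} = insert e {e'. Suc e \<le> e' \<and> e' < len P \<and> pos P e' < x}"
    using assms by (auto simp: le_less Suc_le_eq)
  moreover have "{e'. Suc e \<le> e' \<and> e' < len P \<and> pos P e' < x} \<noteq> {}" using assms by blast
  ultimately show ?thesis by (simp add: min_cap_def)
qed

lemma min_cap_pos:
  assumes "valid_network P" "e < len P" "pos P e < x"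
  shows "0 < min_cap P x e"
proof -
  have "Min (cap P ` {e'. e \<le> e' \<and> e' < len P \<and> pos P e' < x}) \<in> cap P ` {e'. e \<le> e' \<and> e' < len P \<and> pos P e' < x}"
    using assms by (intro Min_in) auto
  then show ?thesis using assms(1) by (auto simp: min_cap_def valid_network_def)
qed

lemma min_cap_mono:
  assumes "e \<le> e'" "e' < len P" "pos P e' < x"
  shows "min_cap P x e \<le> min_cap P x e'"
  unfolding min_cap_def by (rule Min_antimono) (use assms in auto)

lemma slopes_prog:
  fixes m :: store and P :: path_network
  defines "x \<equiv> snd m ''xx'' 0" and "ib \<equiv> fst m ''ib'' 0" and "v \<equiv> snd m ''VA''" and "m2 \<equiv> sem slopes_prog m"
    and "F \<equiv> 0 < fst m ''FA'' 0 \<or> 0 < fst m ''FB'' 0" and "mu \<equiv> 0 < fst m ''mu'' 0"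
  defines "line \<equiv> \<lambda>m u e. snd m ''cq'' u = 1 / min_cap P x e \<and>
     snd m ''cf'' u = (if 0 < v e \<or> F then x - pos P e + v e / min_cap P x e else 0)"
  defines "TT \<equiv> {e. ib \<le> e \<and> e < len P \<and> pos P e < x \<and> (mu \<or> e = ib)}"
  assumes net: "store_net m ''A'' P"
  shows "fst m2 ''t'' 0 \<le> len P"
    and "\<And>u. u < fst m2 ''t'' 0 \<Longrightarrow> \<exists>e\<in>TT. line m2 u e" and "\<And>e. e \<in> TT \<Longrightarrow> \<exists>u<fst m2 ''t'' 0. line m2 u e"
    and "\<And>u u'. u \<le> u' \<Longrightarrow> u' < fst m2 ''t'' 0 \<Longrightarrow> snd m2 ''cq'' u \<le> snd m2 ''cq'' u'"
proof -
  let ?n = "len P" and ?c = "min_cap P x"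
  have P: "valid_network P" and n: "fst m ''n'' 0 = ?n" and X: "\<And>l. l \<le> ?n \<Longrightarrow> snd m ''XA'' l = pos P l"
    and C: "\<And>e. e < ?n \<Longrightarrow> snd m ''CA'' e = cap P e" using net by (auto simp: store_net_def)
  define m1 where "m1 = sem (PN ''t'' (NConst 0) (NConst 0) ;; PN ''c1'' (NConst 0) (NConst 0)) m"
  \<comment> \<open>After \<open>j\<close> rounds the vertices from \<open>?n - j\<close> on have
    been visited. The running minimum is described only down to \<open>ib\<close>, since the body is
    skipped beyond it.\<close>
  let ?I = "\<lambda>j m'. let t = fst m' ''t'' 0 in t \<le> j \<and>
     (ib \<le> ?n - j \<longrightarrow> (0 < fst m' ''c1'' 0 \<longleftrightarrow> 0 < j \<and> pos P (?n - j) < x) \<and>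
        (0 < fst m' ''c1'' 0 \<longrightarrow> snd m' ''ca'' 0 = ?c (?n - j))) \<and>
     (\<forall>u<t. \<exists>e\<in>TT. ?n - j \<le> e \<and> line m' u e) \<and> (\<forall>e\<in>TT. ?n - j \<le> e \<longrightarrow> (\<exists>u<t. line m' u e)) \<and>
     (\<forall>u'<t. \<forall>u\<le>u'. snd m' ''cq'' u \<le> snd m' ''cq'' u')"
  have "?I (fst m1 ''n'' 0) (sem (PFor ''u'' ''n'' slopes_body) m1)"
  proof (rule For_rule[where I="?I"])
    show "?I 0 (nupd m1 ''u'' 0 0)" by (auto simp: m1_def Let_def TT_def)
    fix j and m' :: store
    assume jn: "j < fst m1 ''n'' 0" and j: "fst m' ''u'' 0 = j"
      and N: "\<And>a. a \<notin> insert ''u'' (wrN slopes_body) \<Longrightarrow> fst m' a = fst m1 a"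
      and R: "\<And>a. a \<notin> wrR slopes_body \<Longrightarrow> snd m' a = snd m1 a" and I: "?I j m'"
    define e where "e = ?n - j - 1"
    have e: "e < ?n" "?n - j = Suc e" "?n - Suc j = e" using jn n by (auto simp: e_def m1_def)
    define t where "t = fst m' ''t'' 0"
    have [simp]: "fst m' ''u'' 0 = j" "fst m' ''t'' 0 = t" "fst m' ''n'' 0 = ?n" "fst m' ''ib'' 0 = ib"
      "(0 < fst m' ''mu'' 0) = mu" "(0 < fst m' ''FA'' 0 \<or> 0 < fst m' ''FB'' 0) = F"
      using j N n by (auto simp: slopes_body_def Let_def m1_def t_def ib_def mu_def F_def)
    have [simp]: "snd m' ''XA'' = snd m ''XA''" "snd m' ''CA'' = snd m ''CA''" "snd m' ''VA'' = v" "snd m' ''xx'' 0 = x"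
      using R by (auto simp: slopes_body_def Let_def m1_def v_def x_def)
    have Xe: "snd m ''XA'' e = pos P e" "snd m ''CA'' e = cap P e" using X C e by auto
    have I': "t \<le> j" "ib \<le> Suc e \<Longrightarrow> 0 < fst m' ''c1'' 0 \<longleftrightarrow> 0 < j \<and> pos P (Suc e) < x"
      "ib \<le> Suc e \<Longrightarrow> 0 < fst m' ''c1'' 0 \<Longrightarrow> snd m' ''ca'' 0 = ?c (Suc e)"
      "\<And>u. u < t \<Longrightarrow> \<exists>e'\<in>TT. Suc e \<le> e' \<and> line m' u e'"
      "\<And>e'. e' \<in> TT \<Longrightarrow> Suc e \<le> e' \<Longrightarrow> \<exists>u<t. line m' u e'"
      "\<And>u u'. u' < t \<Longrightarrow> u \<le> u' \<Longrightarrow> snd m' ''cq'' u \<le> snd m' ''cq'' u'"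
      using I unfolding Let_def e(2) t_def by blast+
    show "?I (Suc j) (nupd (sem slopes_body m') ''u'' 0 (Suc j))"
    proof (cases "pos P e < x \<and> ib \<le> e")
      case False
      then have sem: "sem slopes_body m' = m'"
        by (auto simp: slopes_body_def Let_def e(3) Xe not_less)
      have notTT: "e \<notin> TT" using False by (auto simp: TT_def)
      have 1: "\<exists>e'\<in>TT. e \<le> e' \<and> line m' u e'" if "u < t" for u using I'(4)[OF that] by (meson Suc_leD)
      have 2: "\<exists>u<t. line m' u e'" if "e' \<in> TT" "e \<le> e'" for e'
        using I'(5)[of e'] that notTT by (cases "e' = e") auto
      have 3: "\<not> 0 < fst m' ''c1'' 0" if "ib \<le> e"
      proof -
        have "\<not> pos P (Suc e) < x" using False that pos_less[OF P, of e "Suc e"] e by auto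
        then show ?thesis using I'(2) that by simp
      qed
      show ?thesis unfolding sem Let_def e(3)
        using I'(1,6) 1 2 3 False by (auto simp: line_def)
    next
      case True
      let ?ca = "if \<not> 0 < fst m' ''c1'' 0 \<or> cap P e < snd m' ''ca'' 0 then cap P e else snd m' ''ca'' 0"
      \<comment> \<open>The minimum starts at the edge that contains x in its interior or at its
        right end.\<close>
      have ca: "?ca = ?c e"
      proof (cases "0 < fst m' ''c1'' 0")
        case c1: True
        then have h: "0 < j" "pos P (Suc e) < x" "snd m' ''ca'' 0 = ?c (Suc e)" using I'(2,3) True by auto
        then have "Suc e < ?n" using e by linarith
        then show ?thesis using min_cap_step[of e P x] h e True c1 by (simp add: min_def)
      next
        case c1: False
        have "x \<le> pos P (Suc e)" if "Suc e < ?n"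
        proof -
          have "0 < j" using that e by linarith
          then show ?thesis using I'(2) c1 True by auto
        qed
        then show ?thesis using min_cap_last[OF P e(1), of x] True c1 by simp
      qed
      define m3 where "m3 = nupd (rupd m' ''ca'' 0 (?c e)) ''c1'' 0 1"
      have m3: "sem slopes_body m' = (if mu \<or> e = ib then
          nupd (rupd (rupd m3 ''cq'' t (1 / ?c e)) ''cf'' t (if 0 < v e \<or> F then x - pos P e + v e / ?c e else 0)) ''t'' 0 (Suc t)
          else m3)" (is "_ = ?m")
      proof -
        have r: "rupd m' ''ca'' 0 (snd m' ''ca'' 0) = m'" by (simp add: rupd_def)
        have s1: "sem (PWhen (BOr (BNot (NLess (NConst 0) (nv ''c1''))) (RLess (RRead ''CA'' (NMinus (NMinus (nv ''n'') (nv ''u'')) (NConst 1))) (rv ''ca'')))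
         (PR ''ca'' (NConst 0) (RRead ''CA'' (NMinus (NMinus (nv ''n'') (nv ''u'')) (NConst 1))))) m' = rupd m' ''ca'' 0 (?c e)"
          unfolding ca[symmetric] using r by (simp add: e(3) Xe)
        have le: "(\<not> ib < e) = (e = ib)" using True by auto
        have "sem slopes_body m' = sem (PWhen (BOr (NLess (NConst 0) (nv ''mu'')) (BNot (NLess (nv ''ib'') (NMinus (NMinus (nv ''n'') (nv ''u'')) (NConst 1)))))
         (PR ''cq'' (nv ''t'') (RDivide (RConst 1) (rv ''ca'')) ;;
          PIf (BOr (RLess (RConst 0) (RRead ''VA'' (NMinus (NMinus (nv ''n'') (nv ''u'')) (NConst 1)))) (BOr (NLess (NConst 0) (nv ''FA'')) (NLess (NConst 0) (nv ''FB''))))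
            (PR ''cf'' (nv ''t'') (RPlus (RMinus (rv ''xx'') (RRead ''XA'' (NMinus (NMinus (nv ''n'') (nv ''u'')) (NConst 1)))) (RDivide (RRead ''VA'' (NMinus (NMinus (nv ''n'') (nv ''u'')) (NConst 1))) (rv ''ca''))))
            (PR ''cf'' (nv ''t'') (RConst 0)) ;;
          PN ''t'' (NConst 0) (nsuc (nv ''t'')))) m3"
          unfolding slopes_body_def Let_def m3_def
          using True s1 by (simp add: e(3) Xe not_less del: fst_rupd)
        also have "\<dots> = ?m" using X[of ib] True e(1) by (simp add: m3_def e(3) Xe le)
        finally show ?thesis .
      qed
      have old: "line ?m u e' = line m' u e'" if "u < t" for u e'
        using that by (simp add: line_def m3_def)
      have tt: "fst ?m ''t'' 0 = (if mu \<or> e = ib then Suc t else t)" by (simp add: m3_def)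
      have eTT: "e \<in> TT \<longleftrightarrow> mu \<or> e = ib" using True e by (auto simp: TT_def)
      have new: "line ?m t e" if "mu \<or> e = ib" using that by (simp add: line_def m3_def)
      have 1: "\<exists>e'\<in>TT. e \<le> e' \<and> line ?m u e'" if u: "u < fst ?m ''t'' 0" for u
      proof (cases "u < t")
        case True
        then show ?thesis using I'(4)[OF True] old[OF True] by (meson Suc_leD)
      next
        case False
        then have "u = t" "mu \<or> e = ib" using u tt by (auto split: if_splits)
        then show ?thesis using new eTT by blast
      qed
      have 2: "\<exists>u<fst ?m ''t'' 0. line ?m u e'" if e': "e' \<in> TT" "e \<le> e'" for e'
      proof (cases "e' = e")
        case True
        then show ?thesis using new e'(1) eTT tt by (intro exI[of _ t]) auto
      next
        case False
        then obtain u where "u < t" "line m' u e'" using I'(5)[of e'] e' by auto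
        then show ?thesis using old[of u e'] tt by (intro exI[of _ u]) auto
      qed
      have 3: "snd ?m ''cq'' u \<le> snd ?m ''cq'' u'" if u: "u' < fst ?m ''t'' 0" "u \<le> u'" for u u'
      proof (cases "u' < t")
        case True
        then show ?thesis using I'(6)[OF True u(2)] u(2) by (simp add: m3_def)
      next
        case False
        then have u': "u' = t" "mu \<or> e = ib" using u tt by (auto split: if_splits)
        show ?thesis
        proof (cases "u = t")
          case False
          then have ut: "u < t" using u u' by simp
          obtain e' where e': "e' \<in> TT" "Suc e \<le> e'" "snd m' ''cq'' u = 1 / ?c e'"
            using I'(4)[OF ut] by (auto simp: line_def)
          \<comment> \<open>A longer stretch has the smaller minimal capacity, so the slope added
            now is at least every earlier one.\<close>
          have "?c e \<le> ?c e'" using e' by (intro min_cap_mono) (auto simp: TT_def)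
          moreover have "0 < ?c e" using min_cap_pos[OF P e(1)] True by simp
          ultimately have "1 / ?c e' \<le> 1 / ?c e" by (intro divide_left_mono) auto
          then show ?thesis using ut u' e'(3) by (simp add: m3_def)
        qed (use u' in simp)
      qed
      have 4: "fst ?m ''t'' 0 \<le> Suc j" using tt I'(1) by simp
      have 5: "fst ?m ''c1'' 0 = 1" "snd ?m ''ca'' 0 = ?c e" by (simp_all add: m3_def)
      have fr: "fst (nupd ?m ''u'' 0 (Suc j)) ''t'' = fst ?m ''t''" "fst (nupd ?m ''u'' 0 (Suc j)) ''c1'' = fst ?m ''c1''"
        "snd (nupd ?m ''u'' 0 (Suc j)) = snd ?m" by simp_all
      have lf: "line (nupd ?m ''u'' 0 (Suc j)) = line ?m" by (intro ext) (simp only: line_def fr)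
      show ?thesis unfolding m3 Let_def e(3) fr lf 5 using 1 2 3 4 True by blast
    qed
  qed (auto simp: slopes_body_def Let_def)
  then have "?I ?n m2" by (simp add: m1_def m2_def slopes_prog_def n)
  then have *: "fst m2 ''t'' 0 \<le> ?n" "\<forall>u<fst m2 ''t'' 0. \<exists>e\<in>TT. line m2 u e"
    "\<forall>e\<in>TT. \<exists>u<fst m2 ''t'' 0. line m2 u e"
    "\<forall>u'<fst m2 ''t'' 0. \<forall>u\<le>u'. snd m2 ''cq'' u \<le> snd m2 ''cq'' u'"
    by (auto simp: Let_def)
  show "fst m2 ''t'' 0 \<le> ?n" "\<And>u. u < fst m2 ''t'' 0 \<Longrightarrow> \<exists>e\<in>TT. line m2 u e"
    "\<And>e. e \<in> TT \<Longrightarrow> \<exists>u<fst m2 ''t'' 0. line m2 u e"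
    "\<And>u u'. u \<le> u' \<Longrightarrow> u' < fst m2 ''t'' 0 \<Longrightarrow> snd m2 ''cq'' u \<le> snd m2 ''cq'' u'"
    using * by blast+
qed

section \<open>Variable weights equal to zero versus positive\<close>

section \<open>The four regimes\<close>

text \<open>A flag selects a positive variable weight; without it the weight is frozen at 0. A
  regime asking for a positive weight of width 0 is empty and is skipped, as the tables presuppose a
  positive width.\<close>

definition regime_prog :: "bool \<Rightarrow> bool \<Rightarrow> prog" where
  "regime_prog fA fB =
     PN ''FA'' (NConst 0) (NConst (of_bool fA)) ;; PN ''FB'' (NConst 0) (NConst (of_bool fB)) ;;
     PR ''AA'' (NConst 0) (if fA then rv ''HA'' else RConst 0) ;;
     PR ''AB'' (NConst 0) (if fB then rv ''HB'' else RConst 0) ;;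
     PWhen (BAnd (BOr (NLess (nv ''FA'') (NConst 1)) (RLess (RConst 0) (rv ''HA'')))
                 (BOr (NLess (nv ''FB'') (NConst 1)) (RLess (RConst 0) (rv ''HB''))))
       (side_prog ''A'' ;; side_prog ''B'' ;; slopes_prog ;; main_prog)"

definition regimes_prog :: prog where
  "regimes_prog = PN ''o'' (NConst 0) (NConst 0) ;; regime_prog False False ;; regime_prog False True ;;
     regime_prog True False ;; regime_prog True True"

definition regime_N :: "string set" where
  "regime_N = {''FA'', ''FB'', ''k'', ''l'', ''p'', ''q'', ''LA'', ''LB'', ''t'', ''c1'', ''u'', ''s'', ''r'', ''o''}"

definition regime_R :: "string set" where
  "regime_R = {''AA'', ''AB'', ''VA'', ''MA'', ''BA'', ''QA'', ''PA'', ''RA'', ''VB'', ''MB'', ''BB'', ''QB'', ''PB'', ''RB'',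
     ''ca'', ''cq'', ''cf'', ''ze'', ''ka'', ''sh'', ''of'', ''z'', ''y'', ''YA'', ''ZA'', ''YB'', ''ZB'', ''out''}"

lemma wr_regime: "wrN (regime_prog fA fB) = regime_N" "wrR (regime_prog fA fB) = regime_R"
  by (auto simp: regime_prog_def regime_N_def regime_R_def)

text \<open>The common form of the six problems. The assumptions on \<open>ib\<close> put every
  variable weight that can vary behind each vertex of the objective, so that the objective depends
  on \<open>\<alpha> + \<beta>\<close> alone.\<close>

locale loaded =
  fixes P Q :: path_network and m0 :: store and x :: real and iA iB lo hi ib :: nat and hA hB :: real
    and w :: "nat \<Rightarrow> real" and TT :: "nat set"
  assumes netA: "store_net m0 ''A'' P" and netB: "store_net m0 ''B'' Q" and sizes: "store_sizes m0"
    and n1: "fst m0 ''n1'' 0 = Suc (len P)" and ns: "fst m0 ''ns'' 0 = 4 * len P + 4"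
    and pos_Q: "\<And>l. l \<le> len P \<Longrightarrow> pos Q l = pos P (len P) - pos P (len P - l)"
    and w: "\<And>l. l \<le> len P \<Longrightarrow> 0 \<le> w l" "snd m0 ''WA'' = w"
    and wB: "\<And>l. l \<le> len P \<Longrightarrow> snd m0 ''WB'' l = w (len P - l)"
    and vars: "fst m0 ''IA'' 0 = iA" "fst m0 ''IB'' 0 = iB" "fst m0 ''lo'' 0 = lo" "fst m0 ''hi'' 0 = hi"
      "fst m0 ''ib'' 0 = ib" "snd m0 ''HA'' 0 = hA" "snd m0 ''HB'' 0 = hB" "snd m0 ''xx'' 0 = x"
    and h: "0 \<le> hA" "0 \<le> hB" and lohi: "iA \<le> lo" "lo \<le> hi" "hi + iB \<le> len P"
    and ib: "iA \<le> ib" "0 < hB \<Longrightarrow> len P - iB \<le> ib" "pos P ib < x" "ib \<le> len P" and x: "x \<le> pos P (len P)"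
    and TT: "TT = (if 0 < fst m0 ''mu'' 0 then {t. t \<le> len P \<and> ib \<le> t \<and> pos P t < x} else {ib})"
begin

definition sA :: "real \<Rightarrow> real \<Rightarrow> scenario" where
  "sA \<alpha> \<beta> l = w l + (if l = iA then \<alpha> else 0) + (if l = len P - iB then \<beta> else 0)"

definition sB :: "real \<Rightarrow> real \<Rightarrow> scenario" where
  "sB \<alpha> \<beta> l = snd m0 ''WB'' l + (if l = iB then \<beta> else 0) + (if l = len P - iA then \<alpha> else 0)"

definition bounds_regime :: "bool \<Rightarrow> bool \<Rightarrow> real \<Rightarrow> bool" where
  "bounds_regime fA fB U \<longleftrightarrow> (\<forall>\<alpha> \<beta> y. \<forall>t\<in>TT. (if fA then 0 < \<alpha> \<and> \<alpha> \<le> hA else \<alpha> = 0) \<longrightarrow>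
     (if fB then 0 < \<beta> \<and> \<beta> \<le> hB else \<beta> = 0) \<longrightarrow> pos P lo \<le> y \<longrightarrow> y \<le> pos P hi \<longrightarrow>
     g_time P t x (sA \<alpha> \<beta>) -
       max (Theta_L P y (sA \<alpha> \<beta>)) (Theta_L Q (pos P (len P) - y) (sB \<alpha> \<beta>)) \<le> U)"

lemma len_Q: "len Q = len P" using netA netB by (simp add: store_net_def)

lemma valid: "valid_network P" "valid_network Q" using netA netB by (simp_all add: store_net_def)

lemma TT_iff: "TT = {e. ib \<le> e \<and> e < len P \<and> pos P e < x \<and> (0 < fst m0 ''mu'' 0 \<or> e = ib)}"
proof -
  have "e < len P" if "e \<le> len P" "pos P e < x" for e using that x by (cases "e = len P") auto
  then show ?thesis using ib(3,4) by (auto simp: TT)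
qed

definition agrees :: "store \<Rightarrow> bool" where
  "agrees m \<longleftrightarrow> (\<forall>a. a \<notin> regime_N \<longrightarrow> fst m a = fst m0 a) \<and> (\<forall>a. a \<notin> regime_R \<longrightarrow> snd m a = snd m0 a)"

lemma regime:
  assumes ag: "agrees m"
  shows "\<exists>S. improves m (sem (regime_prog fA fB) m) S \<and> (\<not> fA \<and> \<not> fB \<longrightarrow> S \<noteq> {}) \<and>
     (\<forall>U. bounds_regime fA fB U \<longrightarrow> (\<forall>v\<in>S. v \<le> U)) \<and>
     (\<forall>out. (\<forall>v\<in>S. v \<le> out) \<longrightarrow> bounds_regime fA fB out)"
proof -
  define m1 where "m1 = sem (PN ''FA'' (NConst 0) (NConst (of_bool fA)) ;; PN ''FB'' (NConst 0) (NConst (of_bool fB)) ;;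
     PR ''AA'' (NConst 0) (if fA then rv ''HA'' else RConst 0) ;;
     PR ''AB'' (NConst 0) (if fB then rv ''HB'' else RConst 0)) m"
  have HH: "snd m ''HA'' 0 = hA" "snd m ''HB'' 0 = hB" using ag vars by (auto simp: agrees_def regime_R_def)
  have v1: "fst m1 ''FA'' 0 = of_bool fA" "fst m1 ''FB'' 0 = of_bool fB"
    "snd m1 ''AA'' 0 = (if fA then hA else 0)" "snd m1 ''AB'' 0 = (if fB then hB else 0)"
    using HH by (auto simp: m1_def)
  have o1: "fst m ''o'' 0 = fst m1 ''o'' 0" "snd m ''out'' 0 = snd m1 ''out'' 0" by (auto simp: m1_def)
  have ag1: "agrees m1" using ag by (auto simp: agrees_def m1_def regime_N_def regime_R_def)
  define m2 where "m2 = sem (side_prog ''A'') m1"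
  define m3 where "m3 = sem (side_prog ''B'') m2"
  define m4 where "m4 = sem slopes_prog m3"
  have step: "sem (regime_prog fA fB) m =
      (if (fA \<longrightarrow> 0 < hA) \<and> (fB \<longrightarrow> 0 < hB) then sem main_prog m4 else m1)"
    using v1 HH by (auto simp: regime_prog_def m1_def m2_def m3_def m4_def)
  show ?thesis
  proof (cases "(fA \<longrightarrow> 0 < hA) \<and> (fB \<longrightarrow> 0 < hB)")
    case False
    then have "bounds_regime fA fB U" for U by (auto simp: bounds_regime_def)
    moreover have "improves m (sem (regime_prog fA fB) m) {}" unfolding step using False o1 by (auto intro: improves_refl)
    ultimately show ?thesis using False by (intro exI[of _ "{}"]) auto
  next
    case True
    let ?n = "len P"
    have nP: "fst m1 ''n'' 0 = ?n" using ag1 netA by (auto simp: agrees_def regime_N_def store_net_def)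
    have netA1: "store_net m1 ''A'' P" and netB1: "store_net m1 ''B'' Q" and sz1: "store_sizes m1"
      using netA netB sizes ag1 by (simp_all add: store_net_def store_sizes_def agrees_def regime_N_def regime_R_def)
    have W1: "snd m1 ''WA'' = w" "snd m1 ''WB'' = snd m0 ''WB''" "fst m1 ''IA'' 0 = iA" "fst m1 ''IB'' 0 = iB"
      "snd m1 ''xx'' 0 = x" "fst m1 ''ib'' 0 = ib" "fst m1 ''mu'' = fst m0 ''mu''"
      "fst m1 ''lo'' 0 = lo" "fst m1 ''hi'' 0 = hi" "fst m1 ''n1'' 0 = Suc ?n" "fst m1 ''ns'' 0 = 4 * ?n + 4"
      using ag1 vars w(2) n1 ns by (simp_all add: agrees_def regime_N_def regime_R_def)
    have fr: "a \<notin> {''k'', ''l'', ''p'', ''q'', ''LA'', ''LB'', ''t'', ''c1'', ''u''} \<Longrightarrow> fst m4 a = fst m1 a" for a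
      by (simp add: m2_def m3_def m4_def sem_frame)
    have fr': "a \<notin> {''VA'', ''MA'', ''BA'', ''QA'', ''PA'', ''RA'', ''VB'', ''MB'', ''BB'', ''QB'', ''PB'', ''RB'', ''ca'', ''cq'', ''cf''} \<Longrightarrow>
       snd m4 a = snd m1 a" for a
      by (simp add: m2_def m3_def m4_def sem_frame)
    have m2': "snd m2 a = snd m4 a" if "a \<in> {''VA'', ''MA'', ''BA'', ''QA'', ''RA''}" for a
      using that by (auto simp: m3_def m4_def sem_frame)
    have m2'': "fst m2 ''LA'' = fst m4 ''LA''" by (simp add: m3_def m4_def sem_frame)
    have m3': "snd m3 a = snd m4 a" if "a \<in> {''VB'', ''MB'', ''BB'', ''QB'', ''RB''}" for a
      using that by (auto simp: m4_def sem_frame)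
    have m3'': "fst m3 ''LB'' = fst m4 ''LB''" by (simp add: m4_def sem_frame)
    have netB2: "store_net m2 ''B'' Q" and sz2: "store_sizes m2" and netA3: "store_net m3 ''A'' P"
      using netA1 netB1 sz1 by (simp_all add: store_net_def store_sizes_def m2_def m3_def sem_frame)
    define a b where "a = (if fA then hA else 0)" and "b = (if fB then hB else 0)"
    define VA VB where "VA = snd m4 ''VA''" and "VB = snd m4 ''VB''"
    let ?aA = "\<lambda>l. 0 < VA l \<or> fA \<and> iA \<le> l" and ?aB = "\<lambda>l. 0 < VB l \<or> fB \<and> iB \<le> l"
    have A: "side P w iA a fA (snd m4 ''MA'') (snd m4 ''BA'') (snd m4 ''QA'') (snd m4 ''RA'')
        (\<lambda>k p. fst m4 ''LA'' (k * Suc (2 * ?n) + p)) (Suc (2 * ?n)) VA ?aA"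
      using side_prog[of m1 "''A''" P, folded m2_def] netA1 sz1 w(1) True lohi ib(1,4)
      unfolding W1 v1 m2'[of "''VA''", simplified] m2'[of "''MA''", simplified] m2'[of "''BA''", simplified]
        m2'[of "''QA''", simplified] m2'[of "''RA''", simplified] m2'' VA_def[symmetric] a_def[symmetric]
      by (simp add: a_def)
    have B2: "snd m2 ''WB'' = snd m0 ''WB''" "fst m2 ''IB'' 0 = iB" "fst m2 ''FB'' 0 = of_bool fB" "snd m2 ''AB'' 0 = b"
      using W1 v1 by (simp_all add: m2_def sem_frame b_def)
    have B: "side Q (snd m0 ''WB'') iB b fB (snd m4 ''MB'') (snd m4 ''BB'') (snd m4 ''QB'') (snd m4 ''RB'')
        (\<lambda>k p. fst m4 ''LB'' (k * Suc (2 * ?n) + p)) (Suc (2 * ?n)) VB ?aB"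
      using side_prog[of m2 "''B''" Q, folded m3_def] netB2 sz2 w(1) wB True lohi len_Q
      unfolding B2 m3'[of "''VB''", simplified] m3'[of "''MB''", simplified] m3'[of "''BB''", simplified]
        m3'[of "''QB''", simplified] m3'[of "''RB''", simplified] m3'' VB_def[symmetric]
      by (simp add: b_def)
    interpret A: side P w iA a fA "snd m4 ''MA''" "snd m4 ''BA''" "snd m4 ''QA''" "snd m4 ''RA''"
        "\<lambda>k p. fst m4 ''LA'' (k * Suc (2 * ?n) + p)" "Suc (2 * ?n)" VA ?aA by (rule A)
    interpret B: side Q "snd m0 ''WB''" iB b fB "snd m4 ''MB''" "snd m4 ''BB''" "snd m4 ''QB''" "snd m4 ''RB''"
        "\<lambda>k p. fst m4 ''LB'' (k * Suc (2 * ?n) + p)" "Suc (2 * ?n)" VB ?aB by (rule B)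
    let ?T = "fst m4 ''t'' 0" and ?cf = "snd m4 ''cf''" and ?cq = "snd m4 ''cq''"
    have S3: "snd m3 ''xx'' 0 = x" "fst m3 ''ib'' 0 = ib" "fst m3 ''mu'' = fst m0 ''mu''" "fst m3 ''FA'' 0 = of_bool fA"
      "fst m3 ''FB'' 0 = of_bool fB" "snd m3 ''VA'' = VA"
      using W1 v1 by (simp_all add: VA_def m4_def m3_def m2_def sem_frame)
    define F where "F \<longleftrightarrow> 0 < (of_bool fA :: nat) \<or> 0 < (of_bool fB :: nat)"
    define line where "line u e \<longleftrightarrow> ?cq u = 1 / min_cap P x e \<and>
       ?cf u = (if 0 < VA e \<or> F then x - pos P e + VA e / min_cap P x e else 0)" for u e
    note slo = slopes_prog[OF netA3, folded m4_def, unfolded S3, folded F_def, folded TT_iff, folded line_def]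
    define ok where "ok \<alpha> \<beta> \<longleftrightarrow> 0 \<le> \<alpha> \<and> \<alpha> \<le> a \<and> (fA \<longrightarrow> 0 < \<alpha>) \<and> 0 \<le> \<beta> \<and> \<beta> \<le> b \<and> (fB \<longrightarrow> 0 < \<beta>)" for \<alpha> \<beta>
    have lineg: "g_time P e x (sA \<alpha> \<beta>) = ?cf u + ?cq u * (\<alpha> + \<beta>)" if e: "e \<in> TT" "line u e" and o: "ok \<alpha> \<beta>" for e u \<alpha> \<beta>
    proof -
      have en: "ib \<le> e" "e < ?n" "pos P e < x" using e(1) by (auto simp: TT_iff)
      have "wsum (sA \<alpha> \<beta>) 0 e = wsum w 0 e + (if iA \<le> e then \<alpha> else 0) + (if ?n - iB \<le> e then \<beta> else 0)"
        by (simp add: wsum_def sA_def sum.distrib)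
      \<comment> \<open>Both variable weights are included in the prefix sum, except that a right
        weight beyond \<open>e\<close> is necessarily 0.\<close>
      moreover have "iA \<le> e" "\<not> ?n - iB \<le> e \<Longrightarrow> \<beta> = 0"
        using ib(1,2) en o h by (auto simp: ok_def b_def split: if_splits)
      ultimately have W: "wsum (sA \<alpha> \<beta>) 0 e = VA e + \<alpha> + \<beta>" using A.V_eq[of e] en by auto
      have V0: "0 \<le> VA e" using A.V_nonneg en by simp
      have c: "path_cap P (pos P e) x = min_cap P x e"
        unfolding min_cap_def by (rule path_cap_right[OF valid(1)]) (use en x in auto)
      show ?thesis
      \<comment> \<open>Within a regime the sign of the weight sum is the same for all admissible
        weights, so \<open>g_time\<close> stays in one branch and is affine.\<close>
      proof (cases "0 < VA e \<or> F")
        case T: True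
        then have "0 < VA e + \<alpha> + \<beta>" using V0 o by (auto simp: F_def ok_def)
        then show ?thesis using e(2) T unfolding g_time_def W c
          by (simp add: line_def path_dist_def add_divide_distrib)
      next
        case False
        then have "\<alpha> = 0" "\<beta> = 0" "VA e = 0" using V0 o by (auto simp: F_def ok_def a_def b_def split: if_splits)
        then show ?thesis using e(2) False unfolding g_time_def W by (simp add: line_def)
      qed
    qed
    have cq0: "0 \<le> ?cq u" if u: "u < ?T" for u
    proof -
      obtain e where "e \<in> TT" "?cq u = 1 / min_cap P x e" using slo(2)[OF u] unfolding line_def by blast
      then show ?thesis using min_cap_pos[OF valid(1), of e x] by (auto simp: TT_iff)
    qed
    have ids: "fst m4 ''n'' 0 = ?n" "fst m4 ''np'' 0 = Suc (2 * ?n)" "fst m4 ''ns'' 0 = 4 * ?n + 4"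
      "\<And>k. k \<le> ?n \<Longrightarrow> fst m4 ''bs'' k = k * Suc (2 * ?n)"
      using nP sz1 W1 by (simp_all add: fr store_sizes_def Let_def)
    interpret stored P w iA a fA "snd m4 ''MA''" "snd m4 ''BA''" "snd m4 ''QA''" "snd m4 ''RA''"
        "\<lambda>k p. fst m4 ''LA'' (k * Suc (2 * ?n) + p)" "Suc (2 * ?n)" VA ?aA
        Q "snd m0 ''WB''" iB b fB "snd m4 ''MB''" "snd m4 ''BB''" "snd m4 ''QB''" "snd m4 ''RB''"
        "\<lambda>k p. fst m4 ''LB'' (k * Suc (2 * ?n) + p)" VB ?aB lo hi x TT ?T ?cf ?cq sA sB ok m4
    proof unfold_locales
      show "\<exists>t\<in>TT. \<forall>\<alpha> \<beta>. ok \<alpha> \<beta> \<longrightarrow> g_time P t x (sA \<alpha> \<beta>) = ?cf u + ?cq u * (\<alpha> + \<beta>)" if "u < ?T" for u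
        using slo(2)[OF that] lineg by blast
      show "\<exists>u<?T. \<forall>\<alpha> \<beta>. ok \<alpha> \<beta> \<longrightarrow> g_time P t x (sA \<alpha> \<beta>) = ?cf u + ?cq u * (\<alpha> + \<beta>)" if "t \<in> TT" for t
        using slo(3)[OF that] lineg[OF that] by blast
      show "A.side_stored m4 ''A''" unfolding A.side_stored_def using ids by simp
      show "B.side_stored m4 ''B''" unfolding B.side_stored_def using ids len_Q by simp
      show "store_net m4 ''A'' P" "store_net m4 ''B'' Q"
        using netA1 netB1 by (simp_all add: store_net_def fr fr')
      show "store_slopes m4" using cq0 slo(1,4) ids by (simp add: store_slopes_def)
    qed (use len_Q pos_Q lohi cq0 W1 in \<open>auto simp: sA_def sB_def ok_def fr\<close>)
    \<comment> \<open>At least one line exists, which guarantees a nonempty set of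
      candidates.\<close>
    have "ib \<in> TT" using ib(3,4) by (simp add: TT)
    then have "0 < ?T" using slo(3) by fastforce
    then obtain S where S: "improves m4 (sem main_prog m4) S" "S \<noteq> {}"
      "\<And>U. upper_bound U \<Longrightarrow> \<forall>v\<in>S. v \<le> U" "\<And>out. (\<forall>v\<in>S. v \<le> out) \<Longrightarrow> upper_bound out"
      using main_prog by blast
    have ub: "upper_bound U \<longleftrightarrow> bounds_regime fA fB U" for U
    proof -
      have "ok \<alpha> \<beta> \<longleftrightarrow> (if fA then 0 < \<alpha> \<and> \<alpha> \<le> hA else \<alpha> = 0) \<and> (if fB then 0 < \<beta> \<and> \<beta> \<le> hB else \<beta> = 0)" for \<alpha> \<beta>
        by (auto simp: ok_def a_def b_def)
      then show ?thesis unfolding upper_bound_def bounds_regime_def Th_def by blast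
    qed
    have "improves m (sem (regime_prog fA fB) m) S"
    proof -
      have "sem (regime_prog fA fB) m = sem main_prog m4" using step True by simp
      moreover have "fst m ''o'' 0 = fst m4 ''o'' 0" "snd m ''out'' 0 = snd m4 ''out'' 0"
        using o1 by (simp_all add: fr fr')
      ultimately show ?thesis using improves_cong[OF S(1)] by metis
    qed
    then show ?thesis using S ub by blast
  qed
qed

theorem regimes:
  defines "out \<equiv> snd (sem regimes_prog m0) ''out'' 0"
  defines "ub \<equiv> \<lambda>U. \<forall>\<alpha> \<beta> y. \<forall>t\<in>TT. 0 \<le> \<alpha> \<longrightarrow> \<alpha> \<le> hA \<longrightarrow> 0 \<le> \<beta> \<longrightarrow> \<beta> \<le> hB \<longrightarrow> pos P lo \<le> y \<longrightarrow> y \<le> pos P hi \<longrightarrow>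
     g_time P t x (sA \<alpha> \<beta>) -
       max (Theta_L P y (sA \<alpha> \<beta>)) (Theta_L Q (pos P (len P) - y) (sB \<alpha> \<beta>)) \<le> U"
  shows "ub out" "ub U \<Longrightarrow> out \<le> U"
proof -
  define m1 where "m1 = sem (PN ''o'' (NConst 0) (NConst 0)) m0"
  define m2 where "m2 = sem (regime_prog False False) m1"
  define m3 where "m3 = sem (regime_prog False True) m2"
  define m4 where "m4 = sem (regime_prog True False) m3"
  define m5 where "m5 = sem (regime_prog True True) m4"
  have m5: "sem regimes_prog m0 = m5" by (simp add: regimes_prog_def m1_def m2_def m3_def m4_def m5_def)
  have ag: "agrees (sem (regime_prog fA fB) m)" if "agrees m" for m fA fB
    using that unfolding agrees_def by (metis sem_frame wr_regime)
  have a1: "agrees m1" by (simp add: agrees_def m1_def regime_N_def)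
  have a2: "agrees m2" unfolding m2_def by (rule ag[OF a1])
  have a3: "agrees m3" unfolding m3_def by (rule ag[OF a2])
  have a4: "agrees m4" unfolding m4_def by (rule ag[OF a3])
  obtain S1 where S1: "improves m1 m2 S1" "S1 \<noteq> {}" "\<And>U. bounds_regime False False U \<Longrightarrow> \<forall>v\<in>S1. v \<le> U"
    "\<And>out. \<forall>v\<in>S1. v \<le> out \<Longrightarrow> bounds_regime False False out"
    using regime[OF a1, of False False, folded m2_def] by blast
  obtain S2 where S2: "improves m2 m3 S2" "\<And>U. bounds_regime False True U \<Longrightarrow> \<forall>v\<in>S2. v \<le> U"
    "\<And>out. \<forall>v\<in>S2. v \<le> out \<Longrightarrow> bounds_regime False True out"
    using regime[OF a2, of False True, folded m3_def] by blast
  obtain S3 where S3: "improves m3 m4 S3" "\<And>U. bounds_regime True False U \<Longrightarrow> \<forall>v\<in>S3. v \<le> U"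
    "\<And>out. \<forall>v\<in>S3. v \<le> out \<Longrightarrow> bounds_regime True False out"
    using regime[OF a3, of True False, folded m4_def] by blast
  obtain S4 where S4: "improves m4 m5 S4" "\<And>U. bounds_regime True True U \<Longrightarrow> \<forall>v\<in>S4. v \<le> U"
    "\<And>out. \<forall>v\<in>S4. v \<le> out \<Longrightarrow> bounds_regime True True out"
    using regime[OF a4, of True True, folded m5_def] by blast
  have i: "improves m1 m5 (S1 \<union> S2 \<union> S3 \<union> S4)"
    by (intro improves_trans[OF improves_trans[OF improves_trans[OF S1(1) S2(1)] S3(1)] S4(1)])
  have o1: "fst m1 ''o'' 0 = 0" by (simp add: m1_def)
  have imp: "\<forall>v\<in>S1 \<union> S2 \<union> S3 \<union> S4. 0 < fst m5 ''o'' 0 \<and> v \<le> snd m5 ''out'' 0"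
    using i[unfolded improves_def, THEN conjunct2, THEN conjunct1] .
  have imp2: "0 < fst m5 ''o'' 0 \<longrightarrow> snd m5 ''out'' 0 \<le> U" if "\<forall>v\<in>S1 \<union> S2 \<union> S3 \<union> S4. v \<le> U" for U
    using i[unfolded improves_def, THEN conjunct2, THEN conjunct2, THEN spec, of U] o1 that by simp
  have out: "out = snd m5 ''out'' 0" by (simp add: out_def m5)
  \<comment> \<open>Each closed weight range is the union of the point 0 and its positive part, one
    for each value of the flag.\<close>
  have ubs: "ub U \<longleftrightarrow> (\<forall>fA fB. bounds_regime fA fB U)" for U
  proof
    assume h': "ub U"
    show "\<forall>fA fB. bounds_regime fA fB U"
      using h' h unfolding ub_def bounds_regime_def by (auto split: if_splits)
  next
    assume r: "\<forall>fA fB. bounds_regime fA fB U"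
    show "ub U" unfolding ub_def
    proof (intro allI ballI impI)
      fix \<alpha> \<beta> y t
      assume "t \<in> TT" "0 \<le> \<alpha>" "\<alpha> \<le> hA" "0 \<le> \<beta>" "\<beta> \<le> hB" "pos P lo \<le> y" "y \<le> pos P hi"
      then show "g_time P t x (sA \<alpha> \<beta>) -
       max (Theta_L P y (sA \<alpha> \<beta>)) (Theta_L Q (pos P (len P) - y) (sB \<alpha> \<beta>)) \<le> U"
        using r[rule_format, of "0 < \<alpha>" "0 < \<beta>"] unfolding bounds_regime_def by force
    qed
  qed
  show "ub out" unfolding ubs
  proof (intro allI)
    fix fA fB
    show "bounds_regime fA fB out"
      using imp S1(4)[of out] S2(3)[of out] S3(3)[of out] S4(3)[of out] unfolding out
      by (cases fA; cases fB) auto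
  qed
  assume "ub U"
  then have r: "bounds_regime fA fB U" for fA fB using ubs by blast
  have "\<forall>v\<in>S1 \<union> S2 \<union> S3 \<union> S4. v \<le> U" using S1(3) S2(2) S3(2) S4(2) r by blast
  \<comment> \<open>The regime with both weights frozen at 0 is never empty, so \<open>out\<close>
    holds a genuine candidate.\<close>
  moreover have "0 < fst m5 ''o'' 0" using imp S1(2) by blast
  ultimately show "out \<le> U" using imp2 out by simp
qed

end

section \<open>Reduction of the six functions to one problem\<close>

section \<open>Loading the input\<close>

text \<open>The three functions \<open>G\<close> and the three functions \<open>H\<close> are evaluated by one program scheme.
  \<open>mir\<close> selects \<open>H\<close>, evaluated on the reflected network, \<open>br\<close> selects the functions with a bar and
  \<open>pr\<close> the functions without bar that have two indices.\<close>

definition ridx :: "bool \<Rightarrow> nexp \<Rightarrow> nexp" where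
  "ridx mir e = (if mir then NMinus (nv ''n'') e else e)"

text \<open>\<open>ns\<close> is 4n + 4, enough rounds for both pointer walks: 2(2n + 1) when
  evaluating, and at most (2n + 1) + n when optimising.\<close>

definition sizes_prog :: prog where
  "sizes_prog = PN ''n1'' (NConst 0) (nsuc (nv ''n'')) ;; PN ''nn'' (NConst 0) (NPlus (nv ''n'') (nv ''n'')) ;;
     PN ''np'' (NConst 0) (nsuc (nv ''nn'')) ;;
     PN ''ns'' (NConst 0) (NPlus (NPlus (nv ''nn'') (nv ''nn'')) (NConst 4))"

definition index_prog :: "bool \<Rightarrow> prog" where
  "index_prog mir = PN ''ia'' (NConst 0) (ridx mir (nv (if mir then ''j'' else ''i''))) ;;
     PN ''ib'' (NConst 0) (ridx mir (nv (if mir then ''i'' else ''j''))) ;;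
     PR ''xx'' (NConst 0) (if mir then RMinus (RRead ''pos'' (nv ''n'')) (rv ''x'') else rv ''x'')"

text \<open>Vertices strictly between \<open>IA\<close> and \<open>uu\<close> receive their maximal
  weight. With two indices and no bar, \<open>uu\<close> is one larger because vertex
  \<open>ib\<close> is fixed at its maximum; with a single index \<open>IA\<close> and
  \<open>uu\<close> coincide and the range is empty. Without a bar, \<open>IB\<close> is a
  placeholder since the width of the right weight is 0.\<close>

definition mode_prog :: "bool \<Rightarrow> bool \<Rightarrow> prog" where
  "mode_prog br pr = PN ''IA'' (NConst 0) (nv (if br \<or> pr then ''ia'' else ''ib'')) ;;
     PN ''uu'' (NConst 0) (if pr then nsuc (nv ''ib'') else nv ''ib'') ;;
     PN ''IB'' (NConst 0) (if br then NMinus (nv ''n'') (nv ''ib'') else NConst 0) ;;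
     PN ''lo'' (NConst 0) (nv (if br then ''ia'' else ''ib'')) ;;
     PN ''hi'' (NConst 0) (nv (if br then ''ib'' else ''n'')) ;;
     PN ''mu'' (NConst 0) (NConst (of_bool br))"

definition width_prog :: "bool \<Rightarrow> bool \<Rightarrow> prog" where
  "width_prog mir br =
     PR ''HA'' (NConst 0) (RMinus (RRead ''wmax'' (ridx mir (nv ''IA''))) (RRead ''wmin'' (ridx mir (nv ''IA'')))) ;;
     PR ''HB'' (NConst 0) (if br then RMinus (RRead ''wmax'' (ridx mir (nv ''ib''))) (RRead ''wmin'' (ridx mir (nv ''ib'')))
        else RConst 0)"

definition pre_prog :: "bool \<Rightarrow> bool \<Rightarrow> bool \<Rightarrow> prog" where
  "pre_prog mir br pr = sizes_prog ;; index_prog mir ;; mode_prog br pr ;; width_prog mir br"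

definition load_body :: "bool \<Rightarrow> prog" where
  "load_body mir =
     PR ''XA'' (nv ''l'') (if mir then RMinus (RRead ''pos'' (nv ''n'')) (RRead ''pos'' (NMinus (nv ''n'') (nv ''l'')))
        else RRead ''pos'' (nv ''l'')) ;;
     PR ''CA'' (nv ''l'') (RRead ''cap'' (if mir then NMinus (NMinus (nv ''n'') (nv ''l'')) (NConst 1) else nv ''l'')) ;;
     PIf (BAnd (NLess (nv ''IA'') (nv ''l'')) (NLess (nv ''l'') (nv ''uu'')))
       (PR ''WA'' (nv ''l'') (RRead ''wmax'' (ridx mir (nv ''l''))))
       (PR ''WA'' (nv ''l'') (RRead ''wmin'' (ridx mir (nv ''l''))))"

definition mirror_body :: prog where
  "mirror_body =
     PR ''XB'' (nv ''l'') (RMinus (RRead ''XA'' (nv ''n'')) (RRead ''XA'' (NMinus (nv ''n'') (nv ''l'')))) ;;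
     PR ''CB'' (nv ''l'') (RRead ''CA'' (NMinus (NMinus (nv ''n'') (nv ''l'')) (NConst 1))) ;;
     PR ''WB'' (nv ''l'') (RRead ''WA'' (NMinus (nv ''n'') (nv ''l'')))"

definition load_prog :: "bool \<Rightarrow> prog" where
  "load_prog mir =
     PN ''bs'' (NConst 0) (NConst 0) ;;
     PFor ''k'' ''n'' (PN ''bs'' (nsuc (nv ''k'')) (NPlus (NRead ''bs'' (nv ''k'')) (nv ''np''))) ;;
     PFor ''l'' ''n1'' (load_body mir) ;; PFor ''l'' ''n1'' mirror_body"

lemma load_prog:
  fixes m :: store and mir :: bool
  defines "m' \<equiv> sem (load_prog mir) m" and "n \<equiv> fst m ''n'' 0"
  assumes n1: "fst m ''n1'' 0 = Suc n"
  shows "k \<le> n \<Longrightarrow> fst m' ''bs'' k = k * fst m ''np'' 0"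
    and "l \<le> n \<Longrightarrow> snd m' ''XA'' l = (if mir then snd m ''pos'' n - snd m ''pos'' (n - l) else snd m ''pos'' l)"
    and "l < n \<Longrightarrow> snd m' ''CA'' l = snd m ''cap'' (if mir then n - Suc l else l)"
    and "l \<le> n \<Longrightarrow> snd m' ''WA'' l = (let l' = if mir then n - l else l in
       if fst m ''IA'' 0 < l \<and> l < fst m ''uu'' 0 then snd m ''wmax'' l' else snd m ''wmin'' l')"
    and "l \<le> n \<Longrightarrow> snd m' ''XB'' l = snd m' ''XA'' n - snd m' ''XA'' (n - l)"
    and "l < n \<Longrightarrow> snd m' ''CB'' l = snd m' ''CA'' (n - Suc l)"
    and "l \<le> n \<Longrightarrow> snd m' ''WB'' l = snd m' ''WA'' (n - l)"
proof -
  define m1 where "m1 = sem (PN ''bs'' (NConst 0) (NConst 0)) m"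
  let ?p = "PN ''bs'' (nsuc (nv ''k'')) (NPlus (NRead ''bs'' (nv ''k'')) (nv ''np''))"
  define m2 where "m2 = sem (PFor ''k'' ''n'' ?p) m1"
  define m3 where "m3 = sem (PFor ''l'' ''n1'' (load_body mir)) m2"
  have m': "m' = sem (PFor ''l'' ''n1'' mirror_body) m3"
    by (simp add: m'_def load_prog_def m1_def m2_def m3_def)
  let ?I = "\<lambda>k m'. \<forall>k'\<le>k. fst m' ''bs'' k' = k' * fst m ''np'' 0"
  have "?I (fst m1 ''n'' 0) m2" unfolding m2_def
  proof (rule For_rule[where I="?I"])
    fix k and m' :: store
    assume k: "fst m' ''k'' 0 = k" and N: "\<And>a. a \<notin> insert ''k'' (wrN ?p) \<Longrightarrow> fst m' a = fst m1 a" and I: "?I k m'"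
    have "fst m' ''np'' = fst m ''np''" using N by (simp add: m1_def)
    then show "?I (Suc k) (nupd (sem ?p m') ''k'' 0 (Suc k))" using I k by (auto simp: le_Suc_eq)
  qed (auto simp: m1_def)
  then have bs: "k \<le> n \<Longrightarrow> fst m2 ''bs'' k = k * fst m ''np'' 0" for k by (simp add: m1_def n_def)
  have fN: "fst m2 a = fst m a" if "a \<noteq> ''bs''" "a \<noteq> ''k''" for a
    using that by (simp add: m2_def m1_def sem_frame del: sem.simps(6))
  have fR: "snd m2 a = snd m a" for a by (simp add: m2_def m1_def sem_frame del: sem.simps(6))
  let ?J = "\<lambda>j m'. \<forall>l<j. snd m' ''XA'' l = (if mir then snd m ''pos'' n - snd m ''pos'' (n - l) else snd m ''pos'' l) \<and>
     snd m' ''CA'' l = snd m ''cap'' (if mir then n - Suc l else l) \<and>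
     snd m' ''WA'' l = (let l' = if mir then n - l else l in
       if fst m ''IA'' 0 < l \<and> l < fst m ''uu'' 0 then snd m ''wmax'' l' else snd m ''wmin'' l')"
  have J: "?J (fst m2 ''n1'' 0) m3" unfolding m3_def
  proof (rule For_rule[where I="?J"])
    fix k and m' :: store
    assume k: "fst m' ''l'' 0 = k" and N: "\<And>a. a \<notin> insert ''l'' (wrN (load_body mir)) \<Longrightarrow> fst m' a = fst m2 a"
      and R: "\<And>a. a \<notin> wrR (load_body mir) \<Longrightarrow> snd m' a = snd m2 a" and I: "?J k m'"
    have [simp]: "fst m' ''n'' 0 = n" "fst m' ''IA'' = fst m ''IA''" "fst m' ''uu'' = fst m ''uu''"
      using N fN by (simp_all add: load_body_def n_def)
    have [simp]: "snd m' ''pos'' = snd m ''pos''" "snd m' ''cap'' = snd m ''cap''" "snd m' ''wmin'' = snd m ''wmin''"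
      "snd m' ''wmax'' = snd m ''wmax''"
      using R fR by (simp_all add: load_body_def)
    show "?J (Suc k) (nupd (sem (load_body mir) m') ''l'' 0 (Suc k))"
      using I k by (auto simp: less_Suc_eq load_body_def ridx_def Let_def)
  qed (auto simp: load_body_def)
  have gN: "fst m3 a = fst m2 a" if "a \<noteq> ''l''" for a
    using that by (simp add: m3_def load_body_def sem_frame del: sem.simps(6))
  have n3: "fst m3 ''n'' 0 = n" "fst m3 ''n1'' 0 = Suc n" using gN fN n1 by (simp_all add: n_def)
  let ?K = "\<lambda>j m'. \<forall>l<j. snd m' ''XB'' l = snd m3 ''XA'' n - snd m3 ''XA'' (n - l) \<and>
     snd m' ''CB'' l = snd m3 ''CA'' (n - Suc l) \<and> snd m' ''WB'' l = snd m3 ''WA'' (n - l)"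
  have K: "?K (fst m3 ''n1'' 0) m'" unfolding m'
  proof (rule For_rule[where I="?K"])
    fix k and m' :: store
    assume k: "fst m' ''l'' 0 = k" and N: "\<And>a. a \<notin> insert ''l'' (wrN mirror_body) \<Longrightarrow> fst m' a = fst m3 a"
      and R: "\<And>a. a \<notin> wrR mirror_body \<Longrightarrow> snd m' a = snd m3 a" and I: "?K k m'"
    have [simp]: "fst m' ''n'' 0 = n" using N n3 by (simp add: mirror_body_def)
    have [simp]: "snd m' ''XA'' = snd m3 ''XA''" "snd m' ''CA'' = snd m3 ''CA''" "snd m' ''WA'' = snd m3 ''WA''"
      using R by (simp_all add: mirror_body_def)
    show "?K (Suc k) (nupd (sem mirror_body m') ''l'' 0 (Suc k))"
      using I k by (auto simp: less_Suc_eq mirror_body_def)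
  qed (auto simp: mirror_body_def)
  have fA: "snd m' a = snd m3 a" if "a \<in> {''XA'', ''CA'', ''WA''}" for a
    using that unfolding m' by (intro sem_frame) (auto simp: mirror_body_def)
  have fbs: "fst m' ''bs'' = fst m2 ''bs''"
    unfolding m' by (simp add: sem_frame mirror_body_def gN del: sem.simps(6))
  have n2: "fst m2 ''n1'' 0 = Suc n" using fN n1 by simp
  show "k \<le> n \<Longrightarrow> fst m' ''bs'' k = k * fst m ''np'' 0" using bs fbs by simp
  show "l \<le> n \<Longrightarrow> snd m' ''XA'' l = (if mir then snd m ''pos'' n - snd m ''pos'' (n - l) else snd m ''pos'' l)"
    "l < n \<Longrightarrow> snd m' ''CA'' l = snd m ''cap'' (if mir then n - Suc l else l)"
    "l \<le> n \<Longrightarrow> snd m' ''WA'' l = (let l' = if mir then n - l else l in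
       if fst m ''IA'' 0 < l \<and> l < fst m ''uu'' 0 then snd m ''wmax'' l' else snd m ''wmin'' l')"
    using J n2 fA by simp_all
  show "l \<le> n \<Longrightarrow> snd m' ''XB'' l = snd m' ''XA'' n - snd m' ''XA'' (n - l)"
    "l < n \<Longrightarrow> snd m' ''CB'' l = snd m' ''CA'' (n - Suc l)"
    "l \<le> n \<Longrightarrow> snd m' ''WB'' l = snd m' ''WA'' (n - l)"
    using K n3 fA by simp_all
qed

text \<open>The scenarios over which the six functions are maximized. The variable weights are \<open>\<alpha>\<close> and \<open>\<beta>\<close>
  above their lower bounds; \<open>\<beta>\<close> is used only for the functions with a bar.\<close>

definition fam :: "path_network \<Rightarrow> nat \<Rightarrow> nat \<Rightarrow> bool \<Rightarrow> bool \<Rightarrow> bool \<Rightarrow> real \<Rightarrow> real \<Rightarrow> scenario" where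
  "fam P i j mir br pr \<alpha> \<beta> = (\<lambda>l.
     (if (br \<or> pr) \<and> i < l \<and> l < j \<or> pr \<and> l = (if mir then i else j) then wmax P l else wmin P l) +
     (if l = (if mir = (br \<or> pr) then j else i) then \<alpha> else 0) + (if br \<and> l = (if mir then i else j) then \<beta> else 0))"

text \<open>The stored result is characterised as a least upper bound over weights, sinks and
  vertices at once. The two clauses are exactly what is needed to identify it with a nested supremum
  and infimum.\<close>

lemma fam_value:
  fixes P :: path_network and mir br pr :: bool and i j :: nat and x :: real
  defines "n \<equiv> len P"
  defines "m0 \<equiv> sem (load_prog mir) (sem (pre_prog mir br pr) (input P i j x))"
  defines "a0 \<equiv> if mir = (br \<or> pr) then j else i" and "b0 \<equiv> if mir then i else j"
  defines "hA \<equiv> wmax P a0 - wmin P a0" and "hB \<equiv> if br then wmax P b0 - wmin P b0 else 0"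
  defines "TT \<equiv> if br then (if mir then {t. t \<le> n \<and> x < pos P t \<and> pos P t \<le> pos P i}
       else {t. t \<le> n \<and> pos P j \<le> pos P t \<and> pos P t < x}) else {b0}"
  defines "Y \<equiv> if br then {pos P i..pos P j} else if mir then {pos P 0..pos P i} else {pos P j..pos P n}"
  defines "val \<equiv> \<lambda>t y s. (if mir then h_time P t x s else g_time P t x s) - Theta P y s"
  defines "out \<equiv> snd (sem regimes_prog m0) ''out'' 0"
  assumes P: "valid_network P" and ij: "i < j" "j \<le> n" and x: "pos P 0 \<le> x" "x \<le> pos P n"
    and dom: "if mir then x < pos P i else pos P j < x" and bp: "\<not> (br \<and> pr)"
  shows "\<And>\<alpha> \<beta> y t. 0 \<le> \<alpha> \<Longrightarrow> \<alpha> \<le> hA \<Longrightarrow> 0 \<le> \<beta> \<Longrightarrow> \<beta> \<le> hB \<Longrightarrow> y \<in> Y \<Longrightarrow> t \<in> TT \<Longrightarrow>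
      val t y (fam P i j mir br pr \<alpha> \<beta>) \<le> out"
    and "\<And>U. (\<And>\<alpha> \<beta> y t. 0 \<le> \<alpha> \<Longrightarrow> \<alpha> \<le> hA \<Longrightarrow> 0 \<le> \<beta> \<Longrightarrow> \<beta> \<le> hB \<Longrightarrow> y \<in> Y \<Longrightarrow> t \<in> TT \<Longrightarrow>
      val t y (fam P i j mir br pr \<alpha> \<beta>) \<le> U) \<Longrightarrow> out \<le> U"
proof -
  let ?m = "input P i j x"
  define m1 where "m1 = sem (pre_prog mir br pr) ?m"
  have m0: "m0 = sem (load_prog mir) m1" by (simp add: m0_def m1_def)
  \<comment> \<open>The computation always runs in the orientation of the functions
    \<open>G\<close>. For \<open>H\<close> the reflected network takes the left role, the original
    one the right role, and the two indices exchange their order.\<close>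
  define P' Q where "P' = (if mir then mirror P else P)" and "Q = (if mir then P else mirror P)"
  define ia ib where "ia = (if mir then n - j else i)" and "ib = (if mir then n - i else j)"
  define iA where "iA = (if br \<or> pr then ia else ib)"
  define iB where "iB = (if br then n - ib else 0)"
  define lo hi where "lo = (if br then ia else ib)" and "hi = (if br then ib else n)"
  define x' where "x' = (if mir then pos P n - x else x)"
  have iain: "ia < ib" "ib \<le> n" using ij by (auto simp: ia_def ib_def)
  have in1: "fst ?m ''n'' 0 = n" "fst ?m ''i'' 0 = i" "fst ?m ''j'' 0 = j" "snd ?m ''x'' 0 = x"
    "\<And>l. l \<le> n \<Longrightarrow> snd ?m ''pos'' l = pos P l" "\<And>l. l < n \<Longrightarrow> snd ?m ''cap'' l = cap P l"
    "\<And>l. l \<le> n \<Longrightarrow> snd ?m ''wmin'' l = wmin P l" "\<And>l. l \<le> n \<Longrightarrow> snd ?m ''wmax'' l = wmax P l"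
    by (simp_all add: input_def n_def)
  define p1 where "p1 = sem sizes_prog ?m"
  define p2 where "p2 = sem (index_prog mir) p1"
  define p3 where "p3 = sem (mode_prog br pr) p2"
  have m1: "m1 = sem (width_prog mir br) p3" by (simp add: m1_def pre_prog_def p1_def p2_def p3_def)
  have P1: "fst p1 ''n'' 0 = n" "fst p1 ''i'' 0 = i" "fst p1 ''j'' 0 = j" "snd p1 = snd ?m"
    "fst p1 ''n1'' 0 = Suc n" "fst p1 ''nn'' 0 = 2 * n" "fst p1 ''np'' 0 = Suc (2 * n)" "fst p1 ''ns'' 0 = 4 * n + 4"
    using in1(1-3) by (simp_all add: p1_def sizes_prog_def)
  have P2: "fst p2 ''ia'' 0 = ia" "fst p2 ''ib'' 0 = ib" "snd p2 ''xx'' 0 = x'"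
    using P1 in1(4,5) by (simp_all add: p2_def index_prog_def ridx_def ia_def ib_def x'_def)
  have P2': "fst p2 a = fst p1 a" if "a \<noteq> ''ia''" "a \<noteq> ''ib''" for a
    using that by (simp add: p2_def index_prog_def)
  have P2'': "snd p2 a = snd ?m a" if "a \<noteq> ''xx''" for a
    using that P1(4) by (simp add: p2_def index_prog_def)
  have P3: "fst p3 ''IA'' 0 = iA" "fst p3 ''IB'' 0 = iB" "fst p3 ''lo'' 0 = lo" "fst p3 ''hi'' 0 = hi"
    "fst p3 ''mu'' 0 = of_bool br" "fst p3 ''uu'' 0 = (if pr then Suc ib else ib)"
    using P1 P2 P2' by (simp_all add: p3_def mode_prog_def iA_def iB_def lo_def hi_def)
  have P3': "fst p3 a = fst p2 a" if "a \<notin> {''IA'', ''uu'', ''IB'', ''lo'', ''hi'', ''mu''}" for a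
    using that by (simp add: p3_def mode_prog_def)
  have P3'': "snd p3 = snd p2" by (simp add: p3_def mode_prog_def)
  have m1N: "fst m1 = fst p3" by (simp add: m1 width_prog_def)
  have N1: "fst m1 ''n'' 0 = n" "fst m1 ''n1'' 0 = Suc n" "fst m1 ''nn'' 0 = 2 * n" "fst m1 ''np'' 0 = Suc (2 * n)"
    "fst m1 ''ns'' 0 = 4 * n + 4" "fst m1 ''ib'' 0 = ib" "fst m1 ''IA'' 0 = iA" "fst m1 ''IB'' 0 = iB"
    "fst m1 ''lo'' 0 = lo" "fst m1 ''hi'' 0 = hi" "fst m1 ''mu'' 0 = of_bool br"
    "fst m1 ''uu'' 0 = (if pr then Suc ib else ib)"
    using P1 P2 P3 by (simp_all add: m1N P3' P2')
  have x1: "snd m1 ''xx'' 0 = x'" using P2 by (simp add: m1 width_prog_def P3'')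
  have arr1: "snd m1 ''pos'' = snd ?m ''pos''" "snd m1 ''cap'' = snd ?m ''cap''" "snd m1 ''wmin'' = snd ?m ''wmin''"
    "snd m1 ''wmax'' = snd ?m ''wmax''" by (simp_all add: m1 width_prog_def P3'' P2'')
  have a0: "a0 = (if mir then n - iA else iA)" "a0 \<le> n" "b0 = (if mir then n - ib else ib)" "b0 \<le> n"
    using ij by (auto simp: a0_def b0_def iA_def ia_def ib_def)
  have H1: "snd m1 ''HA'' 0 = hA" "snd m1 ''HB'' 0 = hB"
  proof -
    have e: "nval (ridx mir (nv ''IA'')) p3 = a0" "nval (ridx mir (nv ''ib'')) p3 = b0"
      "nval (ridx mir (nv ''ib'')) (rupd p3 a k v) = b0" for a k v
      using N1 a0(1,3) unfolding m1N by (simp_all add: ridx_def)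
    have "snd m1 ''HA'' 0 = snd ?m ''wmax'' a0 - snd ?m ''wmin'' a0"
      by (simp add: m1 width_prog_def e P3'' P2'')
    then show "snd m1 ''HA'' 0 = hA" using in1(7,8) a0 by (simp add: hA_def)
    have "snd m1 ''HB'' 0 = (if br then snd ?m ''wmax'' b0 - snd ?m ''wmin'' b0 else 0)"
      by (simp add: m1 width_prog_def e P3'' P2'')
    then show "snd m1 ''HB'' 0 = hB" using in1(7,8) a0 by (simp add: hB_def)
  qed
  have ld: "\<And>k. k \<le> n \<Longrightarrow> fst m0 ''bs'' k = k * Suc (2 * n)"
    "\<And>l. l \<le> n \<Longrightarrow> snd m0 ''XA'' l = pos P' l" "\<And>l. l < n \<Longrightarrow> snd m0 ''CA'' l = cap P' l"
    "\<And>l. l \<le> n \<Longrightarrow> snd m0 ''WA'' l = (if iA < l \<and> l < (if pr then Suc ib else ib) then wmax P' l else wmin P' l)"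
    "\<And>l. l \<le> n \<Longrightarrow> snd m0 ''XB'' l = snd m0 ''XA'' n - snd m0 ''XA'' (n - l)"
    "\<And>l. l < n \<Longrightarrow> snd m0 ''CB'' l = snd m0 ''CA'' (n - Suc l)"
    "\<And>l. l \<le> n \<Longrightarrow> snd m0 ''WB'' l = snd m0 ''WA'' (n - l)"
    using load_prog[of m1 _ mir, folded m0, unfolded N1] in1(5-8) unfolding arr1
    by (auto simp: P'_def n_def[symmetric] Let_def)
  have V: "valid_network P'" "valid_network Q" "len P' = n" "len Q = n"
    using P valid_mirror by (auto simp: P'_def Q_def n_def)
  have p0: "pos P 0 = 0" using P by (simp add: valid_network_def)
  have pQ: "pos Q l = pos P' n - pos P' (n - l)" if "l \<le> n" for l
    using that p0 by (auto simp: P'_def Q_def n_def)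
  have cQ: "cap Q l = cap P' (n - Suc l)" if "l < n" for l using that by (auto simp: P'_def Q_def n_def)
  have fr: "fst m0 a = fst m1 a" if "a \<notin> {''bs'', ''k'', ''l''}" for a
    unfolding m0 by (rule sem_frame) (use that in \<open>auto simp: load_prog_def load_body_def mirror_body_def\<close>)
  have fr': "snd m0 a = snd m1 a" if "a \<notin> {''XA'', ''CA'', ''WA'', ''XB'', ''CB'', ''WB''}" for a
    unfolding m0 by (rule sem_frame) (use that in \<open>auto simp: load_prog_def load_body_def mirror_body_def\<close>)
  have wP: "0 \<le> wmin P l" "wmin P l \<le> wmax P l" if "l \<le> n" for l using P that by (auto simp: valid_network_def n_def)
  define w where "w = snd m0 ''WA''"
  define T' where "T' = (if 0 < fst m0 ''mu'' 0 then {t. t \<le> n \<and> ib \<le> t \<and> pos P' t < x'} else {ib})"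
  have posib: "pos P' ib < x'" using dom ij by (auto simp: P'_def ib_def x'_def n_def)
  have x'n: "0 \<le> x'" "x' \<le> pos P' n" using x p0 by (auto simp: P'_def x'_def n_def)
  interpret loaded P' Q m0 x' iA iB lo hi ib hA hB w T'
  proof
    show "store_net m0 ''A'' P'" using V ld N1 by (simp add: store_net_def fr)
    show "store_net m0 ''B'' Q" using V ld N1 pQ cQ by (simp add: store_net_def fr)
    show "store_sizes m0" using N1 ld by (simp add: store_sizes_def fr Let_def)
    show "0 \<le> w l" if "l \<le> len P'" for l
      unfolding w_def using ld(4)[of l] that V wP[of l] wP[of "n - l"] by (auto simp: P'_def n_def)
    show "0 \<le> hA" "0 \<le> hB" using wP a0 by (auto simp: hA_def hB_def)
    show "len P' - iB \<le> ib" if "0 < hB" using that V iain by (auto simp: hB_def iB_def split: if_splits)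
    show "T' = (if 0 < fst m0 ''mu'' 0 then {t. t \<le> len P' \<and> ib \<le> t \<and> pos P' t < x'} else {ib})"
      by (simp add: T'_def V)
  qed (use V N1 ld pQ H1 x1 iain posib x'n in
      \<open>auto simp: fr fr' w_def iA_def iB_def lo_def hi_def\<close>)
  have sA_fam: "sA \<alpha> \<beta> l = fam P i j mir br pr \<alpha> \<beta> (if mir then n - l else l)" if l: "l \<le> n" and \<beta>: "0 \<le> \<beta>" "\<beta> \<le> hB" for \<alpha> \<beta> l
  proof -
    have b: "\<not> br \<Longrightarrow> \<beta> = 0" using \<beta> by (simp add: hB_def)
    have eq: "(if mir then n - l else l) = a0 \<longleftrightarrow> l = iA" "(if mir then n - l else l) = b0 \<longleftrightarrow> l = ib"
      using a0 l ij iain by (auto simp: iA_def)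
    have mid: "(iA < l \<and> l < (if pr then Suc ib else ib)) \<longleftrightarrow>
       ((br \<or> pr) \<and> i < (if mir then n - l else l) \<and> (if mir then n - l else l) < j \<or>
         pr \<and> (if mir then n - l else l) = b0)"
      unfolding eq using l ij iain bp by (auto simp: iA_def ia_def ib_def split: if_splits)
    have wl: "w l = (if iA < l \<and> l < (if pr then Suc ib else ib) then wmax P (if mir then n - l else l)
        else wmin P (if mir then n - l else l))"
      unfolding w_def ld(4)[OF l] by (auto simp: P'_def n_def)
    have iBl: "l = len P' - iB \<longleftrightarrow> (if br then l = ib else l = n)" using V iain by (auto simp: iB_def)
    show ?thesis
      unfolding sA_def wl iBl mid fam_def a0_def[symmetric] b0_def[symmetric] eq using b by simp
  qed
  have sB_fam: "sB \<alpha> \<beta> l = fam P i j mir br pr \<alpha> \<beta> (if mir then l else n - l)" if l: "l \<le> n" and \<beta>: "0 \<le> \<beta>" "\<beta> \<le> hB" for \<alpha> \<beta> l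
  proof -
    have "l = iB \<longleftrightarrow> n - l = n - iB" "l = n - iA \<longleftrightarrow> n - l = iA"
      using l iain by (auto simp: iB_def iA_def)
    then have "sB \<alpha> \<beta> l = sA \<alpha> \<beta> (n - l)"
      unfolding sB_def sA_def using ld(7)[OF l] V by (simp add: w_def)
    then show ?thesis using sA_fam[of "n - l" \<beta> \<alpha>] l \<beta> by simp
  qed
  \<comment> \<open>Reflection exchanges the two arguments of the maximum in \<open>Theta\<close>,
    and the positions of vertex and sink are reflected back.\<close>
  have valeq: "g_time P' t x' (sA \<alpha> \<beta>) - max (Theta_L P' y (sA \<alpha> \<beta>)) (Theta_L Q (pos P' (len P') - y) (sB \<alpha> \<beta>))
      = val (if mir then n - t else t) (if mir then pos P n - y else y) (fam P i j mir br pr \<alpha> \<beta>)"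
    if t: "t \<in> T'" and y: "pos P' lo \<le> y" "y \<le> pos P' hi" and \<beta>: "0 \<le> \<beta>" "\<beta> \<le> hB" for \<alpha> \<beta> y t
  proof -
    let ?s = "fam P i j mir br pr \<alpha> \<beta>"
    have tn: "t \<le> n" "pos P' t < x'" using t posib iain by (auto simp: T'_def split: if_splits)
    have l: "lo \<le> n" "hi \<le> n" using iain by (auto simp: lo_def hi_def)
    have P0: "pos P' 0 = 0" using V(1) by (simp add: valid_network_def)
    have "0 \<le> pos P' lo" "pos P' hi \<le> pos P' n"
      using pos_le_iff[OF V(1), of 0 lo] pos_le_iff[OF V(1), of hi n] V(3) l P0 by simp_all
    then have y0: "0 \<le> y" "y \<le> pos P' n" using y by linarith+
    show ?thesis
    proof (cases mir)
      case False
      have "g_time P t x (sA \<alpha> \<beta>) = g_time P t x ?s"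
        by (rule g_time_cong) (use sA_fam tn \<beta> False in simp)
      moreover have "Theta_L P y (sA \<alpha> \<beta>) = Theta_L P y ?s"
        by (rule Theta_L_cong) (use sA_fam \<beta> False n_def in simp)
      moreover have "Theta_L (mirror P) (pos P n - y) (sB \<alpha> \<beta>) = Theta_L (mirror P) (pos P n - y) (\<lambda>l. ?s (n - l))"
        by (rule Theta_L_cong) (use sB_fam \<beta> False n_def in simp)
      ultimately show ?thesis
        using False Theta_R_mirror[OF P y0(1), of ?s]
        by (simp add: P'_def Q_def x'_def val_def Theta_def n_def[symmetric])
    next
      case True
      have "g_time (mirror P) t x' (sA \<alpha> \<beta>) = g_time (mirror P) t x' (\<lambda>l. ?s (n - l))"
        by (rule g_time_cong) (use sA_fam tn \<beta> True in simp)
      moreover have "h_time P (n - t) x ?s = g_time (mirror P) (len P - (n - t)) (pos P (len P) - x) (\<lambda>l. ?s (len P - l))"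
        by (rule h_time_mirror[OF P]) (use tn True x p0 in \<open>auto simp: P'_def x'_def n_def\<close>)
      moreover have "Theta_L (mirror P) y (sA \<alpha> \<beta>) = Theta_L (mirror P) y (\<lambda>l. ?s (n - l))"
        by (rule Theta_L_cong) (use sA_fam \<beta> True n_def in simp)
      moreover have "Theta_R P (pos P n - y) ?s = Theta_L (mirror P) (pos P (len P) - (pos P n - y)) (\<lambda>l. ?s (len P - l))"
        by (rule Theta_R_mirror[OF P]) (use y0 True p0 in \<open>simp add: P'_def n_def\<close>)
      moreover have "Theta_L P (pos P n - y) (sB \<alpha> \<beta>) = Theta_L P (pos P n - y) ?s"
        by (rule Theta_L_cong) (use sB_fam \<beta> True n_def in simp)
      ultimately show ?thesis
        using True tn p0 by (simp add: P'_def Q_def x'_def val_def Theta_def n_def[symmetric] max.commute)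
    qed
  qed
  have TT_eq: "TT = (if mir then (\<lambda>t. n - t) ` T' else T')"
  proof -
    have mu: "fst m0 ''mu'' 0 = of_bool br" using N1 by (simp add: fr)
    show ?thesis
    proof (cases "br \<and> mir")
      case True
      have "TT \<subseteq> (\<lambda>t. n - t) ` T'"
      proof
        fix t assume t: "t \<in> TT"
        then have h: "t \<le> n" "x < pos P t" "t \<le> i"
          using True ij pos_le_iff[OF P, of t i] by (auto simp: TT_def n_def)
        then have "n - t \<in> T'" using True mu by (auto simp: T'_def P'_def ib_def x'_def n_def)
        then show "t \<in> (\<lambda>t. n - t) ` T'" using h by (intro image_eqI[of _ _ "n - t"]) auto
      qed
      moreover have "(\<lambda>t. n - t) ` T' \<subseteq> TT"
        using True mu ij pos_le_iff[OF P, of _ i] by (auto simp: T'_def TT_def P'_def ib_def x'_def n_def)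
      ultimately show ?thesis using True by auto
    next
      case False
      then show ?thesis
        using mu ij pos_le_iff[OF P, of j]
        by (auto simp: T'_def TT_def P'_def ib_def x'_def b0_def n_def)
    qed
  qed
  have Y_iff: "(if mir then pos P n - y else y) \<in> Y \<longleftrightarrow> pos P' lo \<le> y \<and> y \<le> pos P' hi" for y
    using ij p0 by (auto simp: Y_def P'_def lo_def hi_def ia_def ib_def n_def)
  define r where "r y = (if mir then pos P n - y else y)" for y
  have rr: "r (r y) = y" for y by (simp add: r_def)
  note R = regimes[folded out_def]
  show "val t y (fam P i j mir br pr \<alpha> \<beta>) \<le> out"
    if h: "0 \<le> \<alpha>" "\<alpha> \<le> hA" "0 \<le> \<beta>" "\<beta> \<le> hB" "y \<in> Y" "t \<in> TT" for \<alpha> \<beta> y t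
  proof -
    obtain t' where t': "t' \<in> T'" "t = (if mir then n - t' else t')" using TT_eq h(6) by (cases mir) auto
    have y': "pos P' lo \<le> r y" "r y \<le> pos P' hi" using Y_iff[of "r y"] h(5) rr[of y] by (auto simp: r_def)
    have "g_time P' t' x' (sA \<alpha> \<beta>) - max (Theta_L P' (r y) (sA \<alpha> \<beta>))
        (Theta_L Q (pos P' (len P') - r y) (sB \<alpha> \<beta>)) \<le> out"
      using R(1) t'(1) h(1-4) y' by blast
    then have v: "val (if mir then n - t' else t') (if mir then pos P n - r y else r y) (fam P i j mir br pr \<alpha> \<beta>) \<le> out"
      unfolding valeq[OF t'(1) y' h(3,4)] .
    have ry: "(if mir then pos P n - r y else r y) = y" by (simp add: r_def)
    show ?thesis using v unfolding ry t'(2) .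
  qed
  show "out \<le> U" if U: "\<And>\<alpha> \<beta> y t. 0 \<le> \<alpha> \<Longrightarrow> \<alpha> \<le> hA \<Longrightarrow> 0 \<le> \<beta> \<Longrightarrow> \<beta> \<le> hB \<Longrightarrow> y \<in> Y \<Longrightarrow> t \<in> TT \<Longrightarrow>
      val t y (fam P i j mir br pr \<alpha> \<beta>) \<le> U" for U
  proof (rule R(2), intro allI ballI impI)
    fix \<alpha> \<beta> y t
    assume h: "t \<in> T'" "0 \<le> \<alpha>" "\<alpha> \<le> hA" "0 \<le> \<beta>" "\<beta> \<le> hB" "pos P' lo \<le> y" "y \<le> pos P' hi"
    show "g_time P' t x' (sA \<alpha> \<beta>) - max (Theta_L P' y (sA \<alpha> \<beta>)) (Theta_L Q (pos P' (len P') - y) (sB \<alpha> \<beta>)) \<le> U"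
      unfolding valeq[OF h(1,6,7,4,5)]
      by (rule U) (use h Y_iff[of y] TT_eq in auto)
  qed
qed

section \<open>The quadratic time bound\<close>

section \<open>Running time\<close>

lemma prefix_time [simp]: "wf_prog (prefix_prog g)" "bounds (prefix_prog g) = {''n''}" "depth (prefix_prog g) = 1"
  by (auto simp: prefix_prog_def)

lemma lines_time [simp]: "wf_prog (lines_prog g)" "bounds (lines_prog g) = {''n''}" "depth (lines_prog g) = 2"
  by (auto simp: lines_prog_def)

lemma rho_time [simp]: "wf_prog (rho_prog g)" "bounds (rho_prog g) = {''n''}" "depth (rho_prog g) = 2"
  by (auto simp: rho_prog_def)

lemma points_time [simp]: "wf_prog (points_prog g)" "bounds (points_prog g) = {''n''}" "depth (points_prog g) = 2"
  by (auto simp: points_prog_def points_body_def)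

lemma sort_time [simp]: "wf_prog (sort_prog g)" "bounds (sort_prog g) = {''nn''}" "depth (sort_prog g) = 2"
  by (auto simp: sort_prog_def sort_body_def)

lemma table_time [simp]: "wf_prog (table_prog g)" "bounds (table_prog g) = {''n'', ''np''}" "depth (table_prog g) = 2"
  by (auto simp: table_prog_def table_body_def Let_def)

lemma side_time [simp]: "wf_prog (side_prog g)" "bounds (side_prog g) = {''n'', ''nn'', ''np''}" "depth (side_prog g) = 2"
  by (auto simp: side_prog_def)

lemma eval_time [simp]: "wf_prog (eval_prog g)" "bounds (eval_prog g) = {''ns''}" "depth (eval_prog g) = 1"
  by (auto simp: eval_prog_def eval_body_def Let_def)

lemma best_time [simp]: "wf_prog (best_prog g)" "bounds (best_prog g) = {''ns''}" "depth (best_prog g) = 1"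
  by (auto simp: best_prog_def best_body_def Let_def)

lemma chain_time [simp]: "wf_prog (chain_prog g)" "bounds (chain_prog g) = {''np''}" "depth (chain_prog g) = 1"
  by (auto simp: chain_prog_def)

lemma upd_time [simp]: "wf_prog (upd_prog e)" "bounds (upd_prog e) = {}" "depth (upd_prog e) = 0"
  by (auto simp: upd_prog_def)

lemma edge_pass_time [simp]: "wf_prog (edge_pass g e)" "bounds (edge_pass g e) = {''np'', ''ns''}" "depth (edge_pass g e) = 1"
  by (auto simp: edge_pass_def)

lemma vertex_pass_time [simp]: "wf_prog (vertex_pass g e)" "bounds (vertex_pass g e) = {''n'', ''np'', ''ns''}"
  "depth (vertex_pass g e) = 1"
  by (auto simp: vertex_pass_def)

lemma vertex_time [simp]: "wf_prog vertex_prog" "bounds vertex_prog = {''n'', ''np'', ''ns''}" "depth vertex_prog = 1"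
  by (auto simp: vertex_prog_def)

lemma edge_time [simp]: "wf_prog edge_prog" "bounds edge_prog = {''n'', ''np'', ''ns''}" "depth edge_prog = 1"
  by (auto simp: edge_prog_def edge_upd_def Let_def)

lemma main_time [simp]: "wf_prog main_prog" "bounds main_prog = {''n'', ''n1'', ''np'', ''ns''}" "depth main_prog = 2"
  by (auto simp: main_prog_def)

lemma slopes_time [simp]: "wf_prog slopes_prog" "bounds slopes_prog = {''n''}" "depth slopes_prog = 1"
  by (auto simp: slopes_prog_def slopes_body_def Let_def)

lemma regime_time [simp]: "wf_prog (regime_prog fA fB)" "bounds (regime_prog fA fB) = {''n'', ''n1'', ''nn'', ''np'', ''ns''}"
  "depth (regime_prog fA fB) = 2"
  by (auto simp: regime_prog_def)

lemma regimes_time [simp]: "wf_prog regimes_prog" "bounds regimes_prog = {''n'', ''n1'', ''nn'', ''np'', ''ns''}"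
  "depth regimes_prog = 2" "wrN regimes_prog = regime_N"
  by (auto simp: regimes_prog_def wr_regime regime_N_def)

lemma load_time [simp]: "wf_prog (load_prog mir)" "bounds (load_prog mir) = {''n'', ''n1''}" "depth (load_prog mir) = 1"
  "wrN (load_prog mir) = {''bs'', ''k'', ''l''}"
  by (auto simp: load_prog_def load_body_def mirror_body_def)

lemma pre_time [simp]: "wf_prog (pre_prog mir br pr)" "bounds (pre_prog mir br pr) = {}" "depth (pre_prog mir br pr) = 0"
  by (auto simp: pre_prog_def sizes_prog_def index_prog_def mode_prog_def width_prog_def)

text \<open>The preparation contains no loop and costs a constant. In the rest all loop bounds are
  at most 4n + 4, the value of \<open>ns\<close>, and loops are nested at most twice.\<close>

definition eval_time_bound :: "bool \<Rightarrow> bool \<Rightarrow> bool \<Rightarrow> nat \<Rightarrow> nat" where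
  "eval_time_bound mir br pr n =
     cost (pre_prog mir br pr) + cost (load_prog mir ;; regimes_prog) * Suc (4 * n + 4) ^ 2"

lemma eval_time_bound: "(\<lambda>n. real (eval_time_bound mir br pr n)) \<in> O(\<lambda>n. real n ^ 2)"
proof (rule bigoI)
  let ?a = "cost (pre_prog mir br pr)" and ?b = "cost (load_prog mir ;; regimes_prog)"
  show "\<forall>\<^sub>F n in sequentially. norm (real (eval_time_bound mir br pr n)) \<le> real (?a + ?b * 81) * norm (real n ^ 2)"
    using eventually_ge_at_top[of 1]
  proof eventually_elim
    case (elim n)
    \<comment> \<open>For positive n, 4n + 5 is at most 9n; this is the origin of 81.\<close>
    have "eval_time_bound mir br pr n \<le> ?a * n ^ 2 + ?b * (9 * n) ^ 2"
      unfolding eval_time_bound_def using elim by (intro add_mono mult_le_mono2 power_mono) auto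
    also have "\<dots> = (?a + ?b * 81) * n ^ 2" by (simp add: algebra_simps power_mult_distrib)
    finally have "real (eval_time_bound mir br pr n) \<le> real ((?a + ?b * 81) * n ^ 2)" by (rule of_nat_mono)
    then show ?case by simp
  qed
qed

text \<open>The preparation writes the loop bounds themselves, so it cannot be part of a program to
  which \<open>exec_compile\<close> applies as a whole; it is timed separately.\<close>

lemma exec_eval:
  fixes mir br pr :: bool and P :: path_network and i j :: nat and x :: real
  defines "m1 \<equiv> sem (pre_prog mir br pr) (input P i j x)"
  shows "\<exists>t \<le> eval_time_bound mir br pr (len P).
    exec (Seq (compile (pre_prog mir br pr)) (compile (load_prog mir ;; regimes_prog))) (input P i j x) t
      (sem regimes_prog (sem (load_prog mir) m1))"
proof -
  let ?p = "pre_prog mir br pr" and ?q = "load_prog mir ;; regimes_prog" and ?n = "len P"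
  obtain t where t: "t \<le> cost ?p" "exec (compile ?p) (input P i j x) t m1"
    using exec_compile[of ?p "input P i j x" 0] by (auto simp: m1_def)
  define p1 where "p1 = sem sizes_prog (input P i j x)"
  have p1: "fst p1 ''n'' 0 = ?n" "fst p1 ''n1'' 0 = Suc ?n" "fst p1 ''nn'' 0 = 2 * ?n"
    "fst p1 ''np'' 0 = Suc (2 * ?n)" "fst p1 ''ns'' 0 = 4 * ?n + 4"
    by (simp_all add: p1_def sizes_prog_def input_def)
  have "fst m1 a = fst p1 a" if "a \<in> {''n'', ''n1'', ''nn'', ''np'', ''ns''}" for a
  proof -
    have "m1 = sem (index_prog mir ;; mode_prog br pr ;; width_prog mir br) p1"
      by (simp only: m1_def pre_prog_def p1_def sem.simps)
    then show ?thesis using that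
      by (simp only:) (rule sem_frame, auto simp: index_prog_def mode_prog_def width_prog_def)
  qed
  then have b: "\<forall>b\<in>bounds ?q. fst m1 b 0 \<le> 4 * ?n + 4" using p1 by auto
  have "bounds ?q \<inter> wrN ?q = {}" by (auto simp: regime_N_def)
  then obtain u where u: "u \<le> cost ?q * Suc (4 * ?n + 4) ^ depth ?q" "exec (compile ?q) m1 u (sem ?q m1)"
    using exec_compile[OF _ _ b] by auto
  have "depth ?q = 2" by simp
  then have "t + u \<le> eval_time_bound mir br pr ?n" using t(1) u(1) unfolding eval_time_bound_def by (simp only: add_mono)
  then show ?thesis using exec.Seq[OF t(2) u(2)] by auto
qed

section \<open>From least upper bounds to the nested suprema and infima of the definitions\<close>

section \<open>The value as a least upper bound\<close>

text \<open>Subtracting an infimum is taking a supremum of differences, so the nested expression is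
  the supremum over all triples. Nonnegativity of \<theta> bounds the infimum from below, and
  \<open>out\<close> bounds the supremum from above, as real-valued \<open>INF\<close> and
  \<open>SUP\<close> require.\<close>

lemma sup_inf_value:
  fixes g :: "nat \<Rightarrow> 's \<Rightarrow> real" and \<theta> :: "real \<Rightarrow> 's \<Rightarrow> real"
  assumes ne: "SS \<noteq> {}" "Y \<noteq> {}" "finite TT" "TT \<noteq> {}"
    and nonneg: "\<And>y s. y \<in> Y \<Longrightarrow> 0 \<le> \<theta> y s"
    and ub: "\<And>s y t. s \<in> SS \<Longrightarrow> y \<in> Y \<Longrightarrow> t \<in> TT \<Longrightarrow> g t s - \<theta> y s \<le> out"
    and least: "\<And>U. (\<And>s y t. s \<in> SS \<Longrightarrow> y \<in> Y \<Longrightarrow> t \<in> TT \<Longrightarrow> g t s - \<theta> y s \<le> U) \<Longrightarrow> out \<le> U"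
  shows "(SUP s\<in>SS. Max ((\<lambda>t. g t s) ` TT) - (INF y\<in>Y. \<theta> y s)) = out" (is "(SUP s\<in>SS. ?F s) = _")
proof (rule antisym)
  have F: "?F s \<le> out" if s: "s \<in> SS" for s
  proof -
    have "Max ((\<lambda>t. g t s) ` TT) \<in> (\<lambda>t. g t s) ` TT" using ne by (intro Max_in) auto
    then obtain t where t: "t \<in> TT" "Max ((\<lambda>t. g t s) ` TT) = g t s" by auto
    have "g t s - out \<le> (INF y\<in>Y. \<theta> y s)"
      by (rule cINF_greatest[OF ne(2)]) (use ub[OF s _ t(1)] in \<open>simp add: algebra_simps\<close>)
    then show ?thesis using t(2) by linarith
  qed
  show "(SUP s\<in>SS. ?F s) \<le> out" by (rule cSUP_least[OF ne(1) F])
  show "out \<le> (SUP s\<in>SS. ?F s)"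
  proof (rule least)
    fix s y t assume h: "s \<in> SS" "y \<in> Y" "t \<in> TT"
    have "g t s \<le> Max ((\<lambda>t. g t s) ` TT)" using h ne by (intro Max_ge) auto
    moreover have "(INF y\<in>Y. \<theta> y s) \<le> \<theta> y s"
      by (rule cINF_lower[OF _ h(2)]) (use nonneg in \<open>auto intro!: bdd_belowI2[where m=0]\<close>)
    moreover have "?F s \<le> (SUP s\<in>SS. ?F s)"
      by (rule cSUP_upper[OF h(1)]) (use F in \<open>auto intro!: bdd_aboveI2[where M=out]\<close>)
    ultimately show "g t s - \<theta> y s \<le> (SUP s\<in>SS. ?F s)" by linarith
  qed
qed

definition fams :: "path_network \<Rightarrow> nat \<Rightarrow> nat \<Rightarrow> bool \<Rightarrow> bool \<Rightarrow> bool \<Rightarrow> scenario set" where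
  "fams P i j mir br pr = {fam P i j mir br pr \<alpha> \<beta> | \<alpha> \<beta>.
     0 \<le> \<alpha> \<and> \<alpha> \<le> wmax P (if mir = (br \<or> pr) then j else i) - wmin P (if mir = (br \<or> pr) then j else i) \<and>
     0 \<le> \<beta> \<and> \<beta> \<le> (if br then wmax P (if mir then i else j) - wmin P (if mir then i else j) else 0)}"

text \<open>The hypothesis on \<open>D\<close> places x strictly beyond vertex \<open>i\<close> or
  \<open>j\<close>, which makes the set of the inner maximum nonempty; the machine run and the value
  are then combined.\<close>

lemma evaluable_fams:
  assumes bp: "\<not> (br \<and> pr)"
    and F: "\<And>P i j x. valid_network P \<Longrightarrow> i < j \<Longrightarrow> j \<le> len P \<Longrightarrow>
       F P i j x = (SUP s\<in>fams P i j mir br pr.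
         Max ((\<lambda>t. if mir then h_time P t x s else g_time P t x s) `
           (if br then (if mir then {t. t \<le> len P \<and> x < pos P t \<and> pos P t \<le> pos P i}
             else {t. t \<le> len P \<and> pos P j \<le> pos P t \<and> pos P t < x}) else {if mir then i else j})) -
         (INF y\<in>(if br then {pos P i..pos P j} else if mir then {pos P 0..pos P i} else {pos P j..pos P (len P)}).
           Theta P y s))"
    and D: "\<And>P i j x. D P i j x \<Longrightarrow> if mir then x < pos P i else pos P j < x"
  shows "evaluable_in (\<lambda>n. real n ^ 2) D F"
  unfolding evaluable_in_def
proof (rule exI[of _ "Seq (compile (pre_prog mir br pr)) (compile (load_prog mir ;; regimes_prog))"],
    rule bexI[of _ "\<lambda>n. real (eval_time_bound mir br pr n)"], intro allI impI)
  show "(\<lambda>n. real (eval_time_bound mir br pr n)) \<in> O(\<lambda>n. real n ^ 2)" by (rule eval_time_bound)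
  fix P i j x
  assume "valid_network P \<and> i < j \<and> j \<le> len P \<and> x \<in> {pos P 0..pos P (len P)} \<and> D P i j x"
  then have P: "valid_network P" and ij: "i < j" "j \<le> len P" and x: "pos P 0 \<le> x" "x \<le> pos P (len P)"
    and dom: "if mir then x < pos P i else pos P j < x" using D by auto
  let ?m = "sem regimes_prog (sem (load_prog mir) (sem (pre_prog mir br pr) (input P i j x)))"
  obtain t where t: "t \<le> eval_time_bound mir br pr (len P)"
    "exec (Seq (compile (pre_prog mir br pr)) (compile (load_prog mir ;; regimes_prog))) (input P i j x) t ?m"
    using exec_eval by blast
  note v = fam_value[OF P ij x dom bp]
  have w: "wmin P l \<le> wmax P l" if "l \<le> len P" for l using P that by (simp add: valid_network_def)
  have "F P i j x = snd ?m ''out'' 0"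
    unfolding F[OF P ij]
  proof (rule sup_inf_value)
    have "fam P i j mir br pr 0 0 \<in> fams P i j mir br pr"
      unfolding fams_def using w ij by (intro CollectI exI[of _ 0]) auto
    then show "fams P i j mir br pr \<noteq> {}" by blast
    show "(if br then {pos P i..pos P j} else if mir then {pos P 0..pos P i} else {pos P j..pos P (len P)}) \<noteq> {}"
      using ij pos_le_iff[OF P, of i j] pos_le_iff[OF P, of 0 i] pos_le_iff[OF P, of j "len P"] by auto
    have i0: "i \<in> {t. t \<le> len P \<and> x < pos P t \<and> pos P t \<le> pos P i}" if mir using that dom ij by simp
    have j0: "j \<in> {t. t \<le> len P \<and> pos P j \<le> pos P t \<and> pos P t < x}" if "\<not> mir" using that dom ij by simp
    show "(if br then (if mir then {t. t \<le> len P \<and> x < pos P t \<and> pos P t \<le> pos P i}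
             else {t. t \<le> len P \<and> pos P j \<le> pos P t \<and> pos P t < x}) else {if mir then i else j}) \<noteq> {}"
      using i0 j0 by (cases br; cases mir) auto
    fix y s assume "y \<in> (if br then {pos P i..pos P j} else if mir then {pos P 0..pos P i} else {pos P j..pos P (len P)})"
    then have "y \<le> pos P (len P)"
      using ij pos_le_iff[OF P, of j "len P"] pos_le_iff[OF P, of i "len P"] by (auto split: if_splits)
    then show "0 \<le> Theta P y s" using Theta_L_nonneg[OF P] by (simp add: Theta_def le_max_iff_disj)
  next
    fix s y t
    assume "s \<in> fams P i j mir br pr"
      "y \<in> (if br then {pos P i..pos P j} else if mir then {pos P 0..pos P i} else {pos P j..pos P (len P)})"
      "t \<in> (if br then (if mir then {t. t \<le> len P \<and> x < pos P t \<and> pos P t \<le> pos P i}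
             else {t. t \<le> len P \<and> pos P j \<le> pos P t \<and> pos P t < x}) else {if mir then i else j})"
    then show "(if mir then h_time P t x s else g_time P t x s) - Theta P y s \<le> snd ?m ''out'' 0"
      using v(1) unfolding fams_def by blast
  next
    fix U
    assume U: "\<And>s y t. s \<in> fams P i j mir br pr \<Longrightarrow>
      y \<in> (if br then {pos P i..pos P j} else if mir then {pos P 0..pos P i} else {pos P j..pos P (len P)}) \<Longrightarrow>
      t \<in> (if br then (if mir then {t. t \<le> len P \<and> x < pos P t \<and> pos P t \<le> pos P i}
             else {t. t \<le> len P \<and> pos P j \<le> pos P t \<and> pos P t < x}) else {if mir then i else j}) \<Longrightarrow>
      (if mir then h_time P t x s else g_time P t x s) - Theta P y s \<le> U"
    show "snd ?m ''out'' 0 \<le> U"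
      by (rule v(2), rule U) (unfold fams_def, blast)
  qed auto
  then show "\<exists>t m. exec (Seq (compile (pre_prog mir br pr)) (compile (load_prog mir ;; regimes_prog))) (input P i j x) t m \<and>
      snd m ''out'' 0 = F P i j x \<and> real t \<le> real (eval_time_bound mir br pr (len P))"
    using t by (intro exI[of _ t] exI[of _ ?m]) simp
qed

lemma fam_scen:
  assumes "i < j"
  shows "fam P i j False False False \<alpha> 0 = scen P j j (wmin P j + \<alpha>) (wmin P j + \<alpha>)"
    and "fam P i j True False False \<alpha> 0 = scen P i i (wmin P i + \<alpha>) (wmin P i + \<alpha>)"
    and "fam P i j False False True \<alpha> 0 = scen P i j (wmin P i + \<alpha>) (wmax P j)"
    and "fam P i j True False True \<alpha> 0 = scen P i j (wmax P i) (wmin P j + \<alpha>)"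
    and "fam P i j False True False \<alpha> \<beta> = scen P i j (wmin P i + \<alpha>) (wmin P j + \<beta>)"
    and "fam P i j True True False \<alpha> \<beta> = scen P i j (wmin P i + \<beta>) (wmin P j + \<alpha>)"
  using assms by (auto simp: fam_def scen_def fun_eq_iff)

text \<open>Reflection only decides which of the two parameters belongs to \<open>i\<close> and
  which to \<open>j\<close>; the family as a set is the same.\<close>

lemma scens_bar:
  assumes ij: "i < j"
  shows "scens P i j = fams P i j mir True False"
proof (intro equalityI subsetI)
  fix s assume "s \<in> scens P i j"
  then obtain \<alpha> \<beta> where h: "s = scen P i j \<alpha> \<beta>" "\<alpha> \<in> {wmin P i..wmax P i}" "\<beta> \<in> {wmin P j..wmax P j}"
    by (auto simp: scens_def)
  then have "s = fam P i j mir True False (if mir then \<beta> - wmin P j else \<alpha> - wmin P i) (if mir then \<alpha> - wmin P i else \<beta> - wmin P j)"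
    by (cases mir) (simp_all add: fam_scen[OF ij])
  then show "s \<in> fams P i j mir True False" unfolding fams_def using h
    by (intro CollectI exI conjI) (assumption, auto)
next
  fix s assume "s \<in> fams P i j mir True False"
  then obtain \<alpha> \<beta> where h: "s = fam P i j mir True False \<alpha> \<beta>" "0 \<le> \<alpha>" "0 \<le> \<beta>"
    "\<alpha> \<le> wmax P (if mir then j else i) - wmin P (if mir then j else i)"
    "\<beta> \<le> wmax P (if mir then i else j) - wmin P (if mir then i else j)" by (auto simp: fams_def)
  show "s \<in> scens P i j"
  proof (cases mir)
    case True
    then show ?thesis using h ij unfolding scens_def
      by (intro CollectI exI[of _ "wmin P i + \<beta>"] exI[of _ "wmin P j + \<alpha>"]) (simp add: fam_scen[OF ij])
  next
    case False
    then show ?thesis using h ij unfolding scens_def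
      by (intro CollectI exI[of _ "wmin P i + \<alpha>"] exI[of _ "wmin P j + \<beta>"]) (simp add: fam_scen[OF ij])
  qed
qed

lemma scens_single:
  assumes ij: "i < j"
  shows "scens P (if mir then i else j) (if mir then i else j) = fams P i j mir False False"
proof -
  let ?k = "if mir then i else j"
  have f: "fam P i j mir False False \<alpha> 0 = scen P ?k ?k (wmin P ?k + \<alpha>) (wmin P ?k + \<alpha>)" for \<alpha>
    by (cases mir) (simp_all add: fam_scen[OF ij])
  have fams: "fams P i j mir False False = {fam P i j mir False False \<alpha> 0 | \<alpha>. 0 \<le> \<alpha> \<and> \<alpha> \<le> wmax P ?k - wmin P ?k}"
    unfolding fams_def by (cases mir) auto
  show ?thesis
  proof (intro equalityI subsetI)
    fix s assume "s \<in> scens P ?k ?k"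
    then obtain \<alpha> where h: "s = scen P ?k ?k \<alpha> \<alpha>" "\<alpha> \<in> {wmin P ?k..wmax P ?k}"
      unfolding scens_def by blast
    then have "s = fam P i j mir False False (\<alpha> - wmin P ?k) 0" by (simp add: f)
    then show "s \<in> fams P i j mir False False" unfolding fams using h(2) by fastforce
  next
    fix s assume "s \<in> fams P i j mir False False"
    then obtain \<alpha> where h: "s = scen P ?k ?k (wmin P ?k + \<alpha>) (wmin P ?k + \<alpha>)" "0 \<le> \<alpha>" "\<alpha> \<le> wmax P ?k - wmin P ?k"
      unfolding fams f by blast
    then show "s \<in> scens P ?k ?k" unfolding scens_def
      by (intro CollectI exI[of _ "wmin P ?k + \<alpha>"]) simp
  qed
qed

text \<open>One end is pinned at its maximum, an admissible value because intervals are nonempty,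
  and a single parameter remains at the other end.\<close>

lemma scens_pair:
  assumes ij: "i < j" and w: "wmin P (if mir then i else j) \<le> wmax P (if mir then i else j)"
  shows "{s \<in> scens P i j. s (if mir then i else j) = wmax P (if mir then i else j)} = fams P i j mir False True"
proof -
  let ?k = "if mir then j else i"
  have fams: "fams P i j mir False True = {fam P i j mir False True \<alpha> 0 | \<alpha>. 0 \<le> \<alpha> \<and> \<alpha> \<le> wmax P ?k - wmin P ?k}"
    unfolding fams_def by (cases mir) auto
  have at: "scen P i j \<alpha> \<beta> i = \<alpha>" "scen P i j \<alpha> \<beta> j = \<beta>" for \<alpha> \<beta> using ij by (simp_all add: scen_def)
  show ?thesis
  proof (intro equalityI subsetI)
    fix s assume s: "s \<in> {s \<in> scens P i j. s (if mir then i else j) = wmax P (if mir then i else j)}"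
    then obtain \<alpha> \<beta> where h: "s = scen P i j \<alpha> \<beta>" "\<alpha> \<in> {wmin P i..wmax P i}" "\<beta> \<in> {wmin P j..wmax P j}"
      by (auto simp: scens_def)
    have "s = fam P i j mir False True (if mir then \<beta> - wmin P j else \<alpha> - wmin P i) 0"
      using s h(1) at by (cases mir) (simp_all add: fam_scen[OF ij])
    then show "s \<in> fams P i j mir False True" unfolding fams using h(2,3)
      by (intro CollectI exI conjI) (assumption, auto)
  next
    fix s assume "s \<in> fams P i j mir False True"
    then obtain \<alpha> where h: "s = fam P i j mir False True \<alpha> 0" "0 \<le> \<alpha>" "\<alpha> \<le> wmax P ?k - wmin P ?k"
      unfolding fams by blast
    show "s \<in> {s \<in> scens P i j. s (if mir then i else j) = wmax P (if mir then i else j)}"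
    proof (cases mir)
      case True
      then have "s = scen P i j (wmax P i) (wmin P j + \<alpha>)" using h by (simp add: fam_scen[OF ij])
      then show ?thesis using True h w ij at unfolding scens_def by (auto intro!: exI)
    next
      case False
      then have "s = scen P i j (wmin P i + \<alpha>) (wmax P j)" using h by (simp add: fam_scen[OF ij])
      then show ?thesis using False h w ij at unfolding scens_def by (auto intro!: exI)
    qed
  qed
qed

theorem theorem4:
  "evaluable_in (\<lambda>n. real n ^ 2) (\<lambda>P i j x. pos P j < x) (\<lambda>P i j x. G_single P j x) \<and>
   evaluable_in (\<lambda>n. real n ^ 2) (\<lambda>P i j x. pos P j < x) (\<lambda>P i j x. G_pair P i j x) \<and>
   evaluable_in (\<lambda>n. real n ^ 2) (\<lambda>P i j x. pos P j < x) (\<lambda>P i j x. G_bar P i j x) \<and>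
   evaluable_in (\<lambda>n. real n ^ 2) (\<lambda>P i j x. x < pos P i) (\<lambda>P i j x. H_single P i x) \<and>
   evaluable_in (\<lambda>n. real n ^ 2) (\<lambda>P i j x. x < pos P i) (\<lambda>P i j x. H_pair P i j x) \<and>
   evaluable_in (\<lambda>n. real n ^ 2) (\<lambda>P i j x. x < pos P i) (\<lambda>P i j x. H_bar P i j x)"
proof (intro conjI)
  have w: "wmin P l \<le> wmax P l" if "valid_network P" "l \<le> len P" for P l
    using that by (simp add: valid_network_def)
  \<comment> \<open>In the functions without a bar the objective has a single vertex, and the
    maximum over a one-element set is that value.\<close>
  show "evaluable_in (\<lambda>n. real n ^ 2) (\<lambda>P i j x. pos P j < x) (\<lambda>P i j x. G_single P j x)"
    by (rule evaluable_fams[where mir=False and br=False and pr=False])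
      (simp_all add: G_single_def scens_single[where mir=False, simplified])
  show "evaluable_in (\<lambda>n. real n ^ 2) (\<lambda>P i j x. pos P j < x) (\<lambda>P i j x. G_pair P i j x)"
    by (rule evaluable_fams[where mir=False and br=False and pr=True])
      (simp_all add: G_pair_def scens_pair[where mir=False, simplified] w)
  show "evaluable_in (\<lambda>n. real n ^ 2) (\<lambda>P i j x. pos P j < x) (\<lambda>P i j x. G_bar P i j x)"
    by (rule evaluable_fams[where mir=False and br=True and pr=False])
      (simp_all add: G_bar_def scens_bar[where mir=False])
  show "evaluable_in (\<lambda>n. real n ^ 2) (\<lambda>P i j x. x < pos P i) (\<lambda>P i j x. H_single P i x)"
    by (rule evaluable_fams[where mir=True and br=False and pr=False])
      (simp_all add: H_single_def scens_single[where mir=True, simplified])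
  show "evaluable_in (\<lambda>n. real n ^ 2) (\<lambda>P i j x. x < pos P i) (\<lambda>P i j x. H_pair P i j x)"
    by (rule evaluable_fams[where mir=True and br=False and pr=True])
      (simp_all add: H_pair_def scens_pair[where mir=True, simplified] w)
  show "evaluable_in (\<lambda>n. real n ^ 2) (\<lambda>P i j x. x < pos P i) (\<lambda>P i j x. H_bar P i j x)"
    by (rule evaluable_fams[where mir=True and br=True and pr=False])
      (simp_all add: H_bar_def scens_bar[where mir=True])
qed

end
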